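(* Let $p, q$ be odd prime numbers, and assume that the equation $x^p - y^q = 1$ has some nontrivial solution, i.e. a solution in integers $x, y$ with $x \neq 0$ and $y \neq 0$. Then either $q^2 \mid p^q - p$, or the $q$-rank of the relative class group of the $p$-th cyclotomic field $\mathbb{Q}(\zeta_p)$ is at least $(p-5)/2$.
   Context: Let $\zeta_p$ be a primitive $p$-th root of unity, $K = \mathbb{Q}(\zeta_p)$ the $p$-th cyclotomic field and $K^+ = \mathbb{Q}(\zeta_p + \zeta_p^{-1})$ its maximal real subfield. The relative class group of $K$ is the kernel of the norm map $\mathrm{Cl}(K) \to \mathrm{Cl}(K^+)$ on ideal class groups; its order is the relative class number $h^-(p)$. The $q$-rank of a finite abelian group $A$ is $\dim_{\mathbb{F}_q}(A/qA)$ (with $A$ written additively). The "either ... or" is inclusive (at least one of the two alternatives holds). A solution $(x,y)$ is called nontrivial if $x$ and $y$ are both nonzero integers. *)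

theory Defs
  imports
    Complex_Main
    "HOL-Algebra.Algebra"
    "HOL-Algebra.Algebraic_Closure_Type"
    "HOL-Number_Theory.Residues"
    "HOL-Computational_Algebra.Polynomial"
    "Jordan_Normal_Form.Missing_VectorSpace"
begin

hide_const (open) Divisibility.prime

text \<open>
  Number fields are realised as subsets of the complex numbers. A subset \<open>K\<close> is turned into
  a ring record by restricting the carrier of the ring record of the type \<^typ>\<open>complex\<close>.
\<close>

abbreviation complex_ring :: "complex ring" where
  "complex_ring \<equiv> ring_of_type_algebra"

definition primitive_root_of_unity :: "nat \<Rightarrow> complex \<Rightarrow> bool" where
  "primitive_root_of_unity n z \<longleftrightarrow> 0 < n \<and> z ^ n = 1 \<and> (\<forall>k. 0 < k \<and> k < n \<longrightarrow> z ^ k \<noteq> 1)"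

text \<open>\<open>generate_field\<close> closes under \<open>1\<close>, so this is the field generated over the rationals.\<close>

definition rat_adjoin :: "complex \<Rightarrow> complex set" where
  "rat_adjoin z = generate_field complex_ring {z}"

definition ring_of_integers :: "complex set \<Rightarrow> complex set" where
  "ring_of_integers K = {x \<in> K. algebraic_int x}"

text \<open>
  A fractional ideal here is always nonzero. The condition that \<open>d I\<close> is an ideal of the ring of
  integers contains that \<open>I\<close> is a submodule of \<open>K\<close>.
\<close>

definition fractional_ideal :: "complex set \<Rightarrow> complex set \<Rightarrow> bool" where
  "fractional_ideal K I \<longleftrightarrow> I \<noteq> {0} \<and>
     (\<exists>d \<in> ring_of_integers K. d \<noteq> 0 \<and>
        ideal ((\<lambda>x. d * x) ` I) (complex_ring\<lparr>carrier := ring_of_integers K\<rparr>))"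

text \<open>
  \<open>ideal_prod complex_ring I J\<close> consists of the finite sums of products \<open>i * j\<close> computed in the
  complex numbers. It is meaningful for arbitrary sets \<open>I\<close> and \<open>J\<close>, not only for ideals.
\<close>

definition fractional_ideal_group :: "complex set \<Rightarrow> complex set monoid" where
  "fractional_ideal_group K =
     \<lparr>carrier = {I. fractional_ideal K I},
      monoid.mult = ideal_prod complex_ring,
      one = ring_of_integers K\<rparr>"

definition principal_fractional_ideals :: "complex set \<Rightarrow> complex set set" where
  "principal_fractional_ideals K = {(\<lambda>x. a * x) ` ring_of_integers K |a. a \<in> K \<and> a \<noteq> 0}"

definition class_group :: "complex set \<Rightarrow> complex set set monoid" where
  "class_group K = fractional_ideal_group K Mod principal_fractional_ideals K"

text \<open>
  The embeddings of \<open>K\<close> into the complex numbers over the subfield \<open>F\<close>; \<open>extensional\<close> makes each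
  of them a single HOL function. The relative norm of an element is the product of its images.
\<close>

definition embeddings_over :: "complex set \<Rightarrow> complex set \<Rightarrow> (complex \<Rightarrow> complex) set" where
  "embeddings_over F K =
     {\<sigma> \<in> extensional K. \<sigma> \<in> ring_hom (complex_ring\<lparr>carrier := K\<rparr>) complex_ring \<and> (\<forall>x\<in>F. \<sigma> x = x)}"

definition relative_norm :: "complex set \<Rightarrow> complex set \<Rightarrow> complex \<Rightarrow> complex" where
  "relative_norm F K a = (\<Prod>\<sigma>\<in>embeddings_over F K. \<sigma> a)"

text \<open>
  The relative norm of a fractional ideal of \<open>K\<close> is the fractional ideal of \<open>F\<close> generated by the
  relative norms of its elements.
\<close>

definition ideal_norm :: "complex set \<Rightarrow> complex set \<Rightarrow> complex set \<Rightarrow> complex set" where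
  "ideal_norm F K I = ideal_prod complex_ring (ring_of_integers F) (relative_norm F K ` I)"

text \<open>
  The norm of an ideal class is the common class of the norms of its members.
\<close>

definition class_norm ::
  "complex set \<Rightarrow> complex set \<Rightarrow> complex set set \<Rightarrow> complex set set" where
  "class_norm F K C =
     the_elem ((\<lambda>I. principal_fractional_ideals F #>\<^bsub>fractional_ideal_group F\<^esub> ideal_norm F K I) ` C)"

definition relative_class_group :: "complex set \<Rightarrow> complex set \<Rightarrow> complex set set monoid" where
  "relative_class_group F K =
     (class_group K)\<lparr>carrier := kernel (class_group K) (class_group F) (class_norm F K)\<rparr>"

text \<open>
  For a multiplicatively written abelian group \<open>A\<close>, the quotient of \<open>A\<close> by the \<open>q\<close>-th powers,
  as a module over the integers modulo \<open>q\<close>. The ring multiplication and unit of the module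
  record play no role and are left unspecified.
\<close>

definition mod_powers :: "nat \<Rightarrow> ('a, 'b) monoid_scheme \<Rightarrow> 'a set monoid" where
  "mod_powers q A = A Mod ((\<lambda>a. a [^]\<^bsub>A\<^esub> q) ` carrier A)"

definition mod_powers_module :: "nat \<Rightarrow> ('a, 'b) monoid_scheme \<Rightarrow> (int, 'a set) module" where
  "mod_powers_module q A =
     \<lparr>carrier = carrier (mod_powers q A),
      monoid.mult = undefined,
      one = undefined,
      ring.zero = \<one>\<^bsub>mod_powers q A\<^esub>,
      ring.add = (\<otimes>\<^bsub>mod_powers q A\<^esub>),
      module.smult = (\<lambda>k x. x [^]\<^bsub>mod_powers q A\<^esub> k)\<rparr>"

definition q_rank :: "nat \<Rightarrow> ('a, 'b) monoid_scheme \<Rightarrow> nat" where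
  "q_rank q A = vectorspace.dim (residue_ring (int q)) (mod_powers_module q A)"

end

theory Submission
  imports
    Defs
    "HOL-Analysis.Generalised_Binomial_Theorem"
    "HOL-Number_Theory.Number_Theory"
    "Jordan_Normal_Form.Char_Poly"
begin

text \<open>
  By Cassels, \<open>p\<close> divides \<open>y\<close> and \<open>q\<close> divides \<open>x\<close>. The first makes each
  \<open>xi c = (x - \<zeta> ^ c) / (1 - \<zeta> ^ c)\<close> generate the \<open>q\<close>-th power of an ideal \<open>A c\<close> of \<open>\<rat>(\<zeta>)\<close>, and the
  classes of \<open>A c / cnj (A c)\<close> for \<open>1 \<le> c \<le> (p - 1) / 2\<close> lie in the \<open>q\<close>-torsion of the relative class group.
  If the \<open>q\<close>-rank is smaller than \<open>(p - 1) / 2\<close>, they satisfy a nontrivial relation with exponents modulo \<open>q\<close>.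
  A quotient of a unit by its complex conjugate is a root of unity by Kronecker, hence a \<open>q\<close>-th power, so
  the relation says that a product of powers of \<open>(1 - x * \<zeta> ^ c) / (1 - x * \<zeta> ^ (p - c))\<close> is a \<open>q\<close>-th power. As
  \<open>q\<close> divides \<open>x\<close> and is unramified, this product is \<open>1\<close> modulo \<open>q\<^sup>2\<close>, which forces \<open>q\<^sup>2\<close> to divide \<open>x\<close>.
  Finally \<open>x - 1 = p ^ (q - 1) * a ^ q\<close> turns this into \<open>p ^ (q - 1) \<equiv> 1\<close> modulo \<open>q\<^sup>2\<close>.
\<close>

section \<open>Cassels' theorem\<close>

text \<open>An equality of ideals determines numbers only up to units, and the unit group of
  \<open>\<rat>(\<zeta>)\<close> is infinite for \<open>p > 3\<close>. Dividing by the complex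
  conjugate leaves only roots of unity, of order prime to \<open>q\<close>; this is why the
  quotients \<open>A c / cnj (A c)\<close>, and with them the relative class group, appear. There
  are \<open>(p - 1) / 2\<close> of them because conjugate indices give inverse quotients. The
  relation comes from counting. A finite abelian group has as many \<open>q\<close>-torsion elements
  as its quotient by \<open>q\<close>-th powers has elements, so a small rank leaves fewer of them
  than there are exponent vectors with entries below \<open>q\<close>, and two vectors collide. No
  factorization into prime ideals enters. The root \<open>A c\<close> is written down by two
  generators, since the \<open>xi c\<close> are pairwise comaximal; this uses that
  \<open>p ^ 2\<close> divides \<open>x - 1\<close>. Ideals are inverted by finiteness of the class
  number, because two powers of an ideal lie in the same class.\<close>

lemma coprime_int_odd_power:
  fixes a b c :: int
  assumes "coprime a b" "a * b = c ^ n" "odd n"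
  obtains d where "a = d ^ n"
proof -
  have n0: "n > 0" using assms(3) by (auto simp: odd_pos)
  have "\<exists>d. a = d ^ n"
  proof (cases "a = 0 \<or> b = 0")
    case True
    show ?thesis
    proof (cases "a = 0")
      case True
      then show ?thesis using n0 by (intro exI[of _ 0]) auto
    next
      case False
      with True have "b = 0" by auto
      hence "\<bar>a\<bar> = 1" using assms(1) by auto
      hence "a = 1 \<or> a = -1" by auto
      then show ?thesis
      proof
        assume "a = 1" then show ?thesis by (intro exI[of _ 1]) auto
      next
        assume "a = -1" then show ?thesis using assms(3) by (intro exI[of _ "-1"]) auto
      qed
    qed
  next
    case False
    have cp: "coprime (nat \<bar>a\<bar>) (nat \<bar>b\<bar>)" using assms(1) by (simp add: coprime_int_iff[symmetric])
    have "nat \<bar>a\<bar> * nat \<bar>b\<bar> = nat \<bar>c\<bar> ^ n"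
      using assms(2) by (metis abs_ge_zero abs_mult nat_mult_distrib nat_power_eq power_abs)
    hence "is_nth_power n (nat \<bar>a\<bar> * nat \<bar>b\<bar>)" by (auto simp: is_nth_power_def)
    from is_nth_power_mult_coprime_natD(1)[OF cp this] have "is_nth_power n (nat \<bar>a\<bar>)"
      using False by simp
    then obtain e where "nat \<bar>a\<bar> = e ^ n" by (auto simp: is_nth_power_def)
    hence e: "\<bar>a\<bar> = int e ^ n" by (metis int_nat_eq of_nat_power abs_ge_zero)
    show ?thesis
    proof (cases "a > 0")
      case True then show ?thesis using e by auto
    next
      case False
      hence "a = (- int e) ^ n" using e assms(3) by (simp add: power_minus_odd)
      then show ?thesis by blast
    qed
  qed
  thus ?thesis using that by auto
qed

text \<open>Taylor expansion to second order at \<open>x = 1\<close>. If an odd \<open>p\<close>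
  divides \<open>x - 1\<close> and \<open>n = p\<close>, the linear coefficient
  \<open>p * (p - 1) / 2\<close> is a multiple of \<open>p\<close>, so the geometric sum is
  \<open>p\<close> modulo \<open>p ^ 2\<close> and contains \<open>p\<close> exactly once.\<close>

lemma sum_powers_cong:
  fixes x :: int
  shows "(x - 1)\<^sup>2 dvd (\<Sum>i<n. x ^ i) - int n - (x - 1) * (\<Sum>i<n. int i)"
proof -
  have "(x - 1)\<^sup>2 dvd x ^ i - 1 - (x - 1) * int i" for i :: nat
  proof (induction i)
    case 0 show ?case by simp
  next
    case (Suc i)
    have "x ^ Suc i - 1 - (x - 1) * int (Suc i) =
        x * (x ^ i - 1 - (x - 1) * int i) + (x - 1)\<^sup>2 * int i"
      by (simp add: algebra_simps power2_eq_square)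
    then show ?case using Suc by simp
  qed
  hence "(x - 1)\<^sup>2 dvd (\<Sum>i<n. x ^ i - 1 - (x - 1) * int i)"
    by (intro dvd_sum) auto
  also have "(\<Sum>i<n. x ^ i - 1 - (x - 1) * int i) =
      (\<Sum>i<n. x ^ i) - int n - (x - 1) * (\<Sum>i<n. int i)"
    by (simp add: sum_subtractf sum_distrib_left)
  finally show ?thesis .
qed

lemma sum_powers_cong1:
  fixes x :: int
  shows "x - 1 dvd (\<Sum>i<n. x ^ i) - int n"
proof -
  have "x - 1 dvd (\<Sum>i<n. x ^ i) - int n - (x - 1) * (\<Sum>i<n. int i)"
    using sum_powers_cong[of x n] by (rule dvd_trans[rotated]) (simp add: power2_eq_square)
  thus ?thesis by (metis dvd_diff_left_iff dvd_triv_left)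
qed

text \<open>For odd \<open>n\<close> the numbers \<open>x ^ n - 1\<close> and \<open>x - 1\<close>
  have the same sign. This makes the root \<open>u\<close> in \<open>dvd_factors\<close>
  positive.\<close>

lemma sum_powers_pos_odd:
  fixes x :: int
  assumes "odd n"
  shows "(\<Sum>i<n. x ^ i) > 0"
proof (cases "x = 1")
  case True
  then show ?thesis using assms by (auto simp: odd_pos)
next
  case False
  have eq: "x ^ n - 1 = (x - 1) * (\<Sum>i<n. x ^ i)" by (rule power_diff_1_eq)
  show ?thesis
  proof (cases "x > 1")
    case True
    hence "x ^ n > 1" using assms by (auto simp: odd_pos intro: one_less_power)
    thus ?thesis using eq True by (smt (verit) zero_less_mult_pos)
  next
    case f: False
    hence "x - 1 < 0" using False by auto
    moreover have "x ^ n < 1"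
    proof (cases "x \<le> 0")
      case True
      hence "x ^ n \<le> 0" using assms by (simp add: power_le_zero_eq odd_pos)
      thus ?thesis by simp
    qed (use f False in auto)
    ultimately show ?thesis using eq
      by (smt (verit, best) mult_nonneg_nonpos mult_minus_left)
  qed
qed

lemma int_fermat:
  assumes "prime q"
  shows "int q dvd k ^ q - k"
proof (cases "int q dvd k")
  case True
  have "q > 0" using assms prime_gt_0_nat by blast
  hence "k dvd k ^ q" by (simp add: dvd_power)
  hence "int q dvd k ^ q" using True dvd_trans by blast
  thus ?thesis using True by (rule dvd_diff)
next
  case False
  have q0: "q > 0" using assms prime_gt_0_nat by blast
  have "\<not> q dvd nat (k mod int q)"
  proof
    assume "q dvd nat (k mod int q)"
    hence "int q dvd int (nat (k mod int q))" by (simp only: int_dvd_int_iff)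
    thus False using False q0 by (simp add: dvd_mod_iff)
  qed
  hence "[nat (k mod int q) ^ (q - 1) = 1] (mod q)" by (rule fermat_theorem[OF assms])
  hence "[int (nat (k mod int q) ^ (q - 1)) = int 1] (mod int q)" by (simp only: cong_int_iff)
  hence "[(k mod int q) ^ (q - 1) = 1] (mod int q)" using q0 by simp
  hence "[k ^ (q - 1) = 1] (mod int q)"
    by (simp add: unique_euclidean_semiring_class.cong_def power_mod)
  hence "int q dvd k ^ (q - 1) - 1" by (simp add: cong_iff_dvd_diff)
  hence "int q dvd k * (k ^ (q - 1) - 1)" by simp
  also have "k * (k ^ (q - 1) - 1) = k ^ q - k"
    using q0 by (simp add: algebra_simps power_eq_if)
  finally show ?thesis .
qed

section \<open>Factorization of \<open>x ^ p - 1\<close> for a solution\<close>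

locale catalan_solution =
  fixes p q :: nat and x y :: int
  assumes p: "prime p" "odd p" and q: "prime q" "odd q"
    and nz: "x \<noteq> 0" "y \<noteq> 0" and eq: "x ^ p - y ^ q = 1"
begin

lemma p3: "p \<ge> 3" and q3: "q \<ge> 3"
proof -
  have "p \<noteq> 2" "q \<noteq> 2" using p q by auto
  thus "p \<ge> 3" "q \<ge> 3" using prime_ge_2_nat[OF p(1)] prime_ge_2_nat[OF q(1)] by auto
qed

text \<open>Both exponents are odd, so the equation is symmetric in \<open>(p, x)\<close> and
  \<open>(q, -y)\<close>. Every statement about \<open>p\<close> and \<open>y\<close> thereby also
  yields one about \<open>q\<close> and \<open>x\<close>.\<close>

lemma swap: "catalan_solution q p (-y) (-x)"
proof
  show "(-y) ^ q - (-x) ^ p = 1" using eq p q by simp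
qed (use p q nz in auto)

lemma factorization: "(x - 1) * (\<Sum>i<p. x ^ i) = y ^ q"
  using power_diff_1_eq[of x p] eq by simp

lemma x_neq_1: "x \<noteq> 1"
  using eq nz q3 by auto

lemma prime_int_p: "prime (int p)" using p by simp

text \<open>A common divisor of \<open>x - 1\<close> and the geometric sum divides \<open>p\<close>.
  If \<open>p\<close> does not divide \<open>y\<close> the two factors of \<open>y ^ q\<close> are
  coprime, and the odd exponent absorbs the sign of the root.\<close>

lemma not_dvd_factors:
  assumes "\<not> int p dvd y"
  obtains a where "x - 1 = a ^ q"
proof -
  define S where "S = (\<Sum>i<p. x ^ i)"
  have c: "coprime (x - 1) S"
  proof (rule coprimeI)
    fix g assume g: "g dvd x - 1" "g dvd S"
    have "x - 1 dvd S - int p" using sum_powers_cong1[of x p] by (simp add: S_def)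
    hence "g dvd int p" using g by (metis diff_diff_eq2 dvd_diff dvd_trans diff_add_cancel add_diff_cancel_left')
    hence "\<bar>g\<bar> = 1 \<or> \<bar>g\<bar> = int p"
      using prime_int_p by (metis abs_1 abs_of_nat dvd_abs_iff abs_dvd_iff prime_int_iff abs_ge_zero)
    moreover have "\<bar>g\<bar> \<noteq> int p"
    proof
      assume "\<bar>g\<bar> = int p"
      hence "int p dvd x - 1" using g by (metis abs_dvd_iff)
      hence "int p dvd y ^ q" using factorization by (metis dvd_mult2)
      thus False using assms prime_int_p prime_dvd_power by blast
    qed
    ultimately show "is_unit g" by (metis abs_dvd_iff dvd_refl)
  qed
  from coprime_int_odd_power[OF c] factorization q(2) that show ?thesis
    unfolding S_def by metis
qed

text \<open>The geometric sum contains \<open>p\<close> exactly once. Moving this \<open>p\<close>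
  to the other factor gives the coprime pair \<open>p * (x - 1)\<close> and \<open>T\<close> with
  product \<open>y ^ q\<close>, so each of them is a \<open>q\<close>-th power.\<close>

lemma dvd_factors:
  assumes "int p dvd y"
  obtains a u where "x - 1 = int p ^ (q - 1) * a ^ q" "(\<Sum>i<p. x ^ i) = int p * u ^ q" "\<not> int p dvd u" "u > 0"
proof -
  define S where "S = (\<Sum>i<p. x ^ i)"
  have f: "(x - 1) * S = y ^ q" using factorization S_def by simp
  have "int p dvd y ^ q" using assms q3 by (simp add: dvd_power_iff prime_int_p dvd_trans dvd_power)
  hence d: "int p dvd x - 1"
  proof -
    have "int p dvd x - 1 \<or> int p dvd S" using \<open>int p dvd y ^ q\<close> f prime_int_p prime_dvd_mult_iff by metis
    moreover have "int p dvd x - 1" if "int p dvd S"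
    proof -
      have "int p dvd x ^ p - 1" using that power_diff_1_eq[of x p] S_def by simp
      hence "[x ^ p = 1] (mod int p)" by (simp add: cong_iff_dvd_diff)
      moreover have "[x ^ p = x] (mod int p)"
        using int_fermat[OF p(1), of x] by (simp add: cong_iff_dvd_diff)
      ultimately have "[x = 1] (mod int p)" using cong_sym cong_trans by blast
      thus ?thesis by (simp add: cong_iff_dvd_diff)
    qed
    ultimately show ?thesis by auto
  qed
  have "int p ^ 2 dvd S - int p"
  proof -
    have 1: "(x - 1)\<^sup>2 dvd S - int p - (x - 1) * (\<Sum>i<p. int i)"
      using sum_powers_cong[of x p] S_def by simp
    have 2: "(\<Sum>i<p. int i) = int p * int ((p - 1) div 2)"
    proof -
      have "(\<Sum>i<p. i) = p * (p - 1) div 2"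
        using Sum_Ico_nat[of 0 p] by (simp add: atLeast0LessThan)
      also have "\<dots> = p * ((p - 1) div 2)" using p(2) by (simp add: div_mult_swap)
      finally have "int (\<Sum>i<p. i) = int (p * ((p - 1) div 2))" by (simp only:)
      thus ?thesis by simp
    qed
    have "(int p)\<^sup>2 dvd (x - 1)\<^sup>2" using d by simp
    hence "(int p)\<^sup>2 dvd S - int p - (x - 1) * (\<Sum>i<p. int i)" using 1 dvd_trans by blast
    moreover have "(int p)\<^sup>2 dvd (x - 1) * (\<Sum>i<p. int i)"
      using d unfolding 2 power2_eq_square by (simp add: mult_dvd_mono)
    ultimately show ?thesis by (metis diff_add_cancel dvd_add)
  qed
  then obtain k where "S - int p = int p ^ 2 * k" by blast
  hence S: "S = int p * (1 + int p * k)" by (simp add: algebra_simps power2_eq_square)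
  define T where "T = 1 + int p * k"
  have npT: "\<not> int p dvd T"
  proof
    assume "int p dvd T"
    hence "int p dvd T - int p * k" by simp
    thus False using p3 by (simp add: T_def)
  qed
  have c: "coprime (int p * (x - 1)) T"
  proof -
    have 1: "coprime (int p) T" using npT prime_int_p prime_imp_coprime by blast
    have "coprime (x - 1) T"
    proof (rule coprimeI)
      fix g assume g: "g dvd x - 1" "g dvd T"
      have "x - 1 dvd S - int p" using sum_powers_cong1[of x p] by (simp add: S_def)
      hence "g dvd S - int p" using g dvd_trans by blast
      moreover have "g dvd S" using g S T_def by simp
      ultimately have "g dvd int p" by (metis dvd_diff diff_diff_eq2 add_diff_cancel_left' diff_add_cancel)
      thus "is_unit g" using g 1 by (metis coprime_common_divisor)
    qed
    thus ?thesis using 1 by simp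
  qed
  have e: "(int p * (x - 1)) * T = y ^ q" using f S T_def by (simp add: mult_ac)
  obtain b where b: "int p * (x - 1) = b ^ q" using coprime_int_odd_power[OF c e q(2)] .
  obtain u where u: "T = u ^ q"
    using coprime_int_odd_power[of T "int p * (x - 1)" y q] c e q(2) by (metis coprime_commute mult.commute)
  have "int p dvd b" using b prime_int_p prime_dvd_power by (metis dvd_triv_left)
  then obtain a where a: "b = int p * a" by blast
  have "int p * (x - 1) = int p * (int p ^ (q - 1) * a ^ q)"
    using b a q3 by (simp add: power_mult_distrib mult.assoc[symmetric] power_Suc[symmetric] del: power_Suc)
  hence 1: "x - 1 = int p ^ (q - 1) * a ^ q" using p3 by simp
  have "S > 0" unfolding S_def using sum_powers_pos_odd[OF p(2)] .
  hence "u ^ q > 0" using S u T_def p3 by (simp add: zero_less_mult_iff)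
  hence "u > 0" using q(2) odd_pos[OF q(2)] by (auto simp: zero_less_power_eq)
  moreover have "\<not> int p dvd u" using npT u q3 by (metis dvd_power dvd_trans gr0I not_numeral_le_zero)
  ultimately show ?thesis using that[of a u] 1 S u T_def S_def by auto
qed

end

section \<open>Cassels' theorem for \<open>p < q\<close>\<close>

lemma power_add_one_gt:
  fixes A :: int
  assumes "A \<ge> 1" "n \<ge> 2"
  shows "A ^ n + 1 < (A + 1) ^ n"
proof -
  obtain k where k: "n = Suc (Suc k)" using assms(2) by (metis Suc_le_D numeral_2_eq_2 Suc_le_mono)
  have "(A + 1) ^ n = (A + 1) ^ Suc k * A + (A + 1) ^ Suc k" by (simp add: k algebra_simps)
  moreover have "(A + 1) ^ Suc k \<ge> A ^ Suc k" using assms(1) by (intro power_mono) auto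
  hence "(A + 1) ^ Suc k * A \<ge> A ^ Suc k * A" using assms(1) by (intro mult_right_mono) auto
  moreover have "(A + 1) ^ Suc k > 1" using assms(1) by (intro one_less_power) auto
  ultimately have "(A + 1) ^ n > A ^ Suc k * A + 1" by linarith
  thus ?thesis by (simp add: k mult.commute)
qed

text \<open>Division by \<open>a ^ (p * q)\<close> leaves \<open>(1 + 1 / a ^ q) ^ p\<close> and
  \<open>(1 + 1 / a ^ p) ^ q\<close>; passing from the first to the second enlarges both base and
  exponent.\<close>

lemma power_compare_pos:
  fixes a :: int
  assumes "a \<ge> 1" "p < q" "p > 0"
  shows "(a ^ q + 1) ^ p < (a ^ p + 1) ^ q"
proof -
  define c where "c = (of_int a :: real)"
  have c: "c \<ge> 1" using assms by (simp add: c_def)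
  define s where "s = 1 / c ^ q"
  define t where "t = 1 / c ^ p"
  have "s > 0" "s \<le> t" using c assms by (auto simp: s_def t_def intro!: frac_le power_increasing)
  have "(1 + s) ^ p < (1 + s) ^ q" using \<open>s > 0\<close> assms by (intro power_strict_increasing) auto
  also have "\<dots> \<le> (1 + t) ^ q" using \<open>s > 0\<close> \<open>s \<le> t\<close> by (intro power_mono) auto
  finally have "c ^ (p * q) * (1 + s) ^ p < c ^ (p * q) * (1 + t) ^ q"
    using c by simp
  also have "c ^ (p * q) * (1 + s) ^ p = (c ^ q * (1 + s)) ^ p"
    by (simp add: power_mult_distrib power_mult[symmetric] mult.commute)
  also have "c ^ q * (1 + s) = c ^ q + 1" using c by (simp add: s_def field_simps)
  also have "c ^ (p * q) * (1 + t) ^ q = (c ^ p * (1 + t)) ^ q"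
    by (simp add: power_mult_distrib power_mult[symmetric])
  also have "c ^ p * (1 + t) = c ^ p + 1" using c by (simp add: t_def field_simps)
  finally have "real_of_int ((a ^ q + 1) ^ p) < real_of_int ((a ^ p + 1) ^ q)"
    by (simp add: c_def)
  thus ?thesis by (simp only: of_int_less_iff)
qed

text \<open>As for \<open>power_compare_pos\<close>, but the bases \<open>1 - t\<close> and
  \<open>1 - s\<close> lie below 1, where the larger exponent makes the power smaller.\<close>

lemma power_compare_neg:
  fixes a :: int
  assumes "a \<ge> 2" "p < q" "p > 0"
  shows "(a ^ p - 1) ^ q < (a ^ q - 1) ^ p"
proof -
  define c where "c = (of_int a :: real)"
  have c: "c \<ge> 2" using assms by (simp add: c_def)
  define s where "s = 1 / c ^ q"
  define t where "t = 1 / c ^ p"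
  have "s > 0" "s \<le> t" using c assms by (auto simp: s_def t_def intro!: frac_le power_increasing)
  have "c ^ 1 \<le> c ^ p" using c assms by (intro power_increasing) auto
  hence "c ^ p > 1" using c by simp
  hence t1: "0 < t" "t < 1" using \<open>s > 0\<close> \<open>s \<le> t\<close> by (auto simp: t_def)
  have "(1 - t) ^ q < (1 - t) ^ p" using t1 assms by (intro power_strict_decreasing) auto
  also have "\<dots> \<le> (1 - s) ^ p" using t1 \<open>s \<le> t\<close> by (intro power_mono) auto
  finally have "c ^ (p * q) * (1 - t) ^ q < c ^ (p * q) * (1 - s) ^ p"
    using c by simp
  also have "c ^ (p * q) * (1 - s) ^ p = (c ^ q * (1 - s)) ^ p"
    by (simp add: power_mult_distrib power_mult[symmetric] mult.commute)
  also have "c ^ q * (1 - s) = c ^ q - 1" using c by (simp add: s_def field_simps)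
  also have "c ^ (p * q) * (1 - t) ^ q = (c ^ p * (1 - t)) ^ q"
    by (simp add: power_mult_distrib power_mult[symmetric])
  also have "c ^ p * (1 - t) = c ^ p - 1" using c by (simp add: t_def field_simps)
  finally have "real_of_int ((a ^ p - 1) ^ q) < real_of_int ((a ^ q - 1) ^ p)"
    by (simp add: c_def)
  thus ?thesis by (simp only: of_int_less_iff)
qed

context catalan_solution
begin

text \<open>Otherwise \<open>x - 1 = a ^ q\<close> and \<open>y ^ q = (a ^ q + 1) ^ p - 1\<close>.
  For positive \<open>a\<close> this lies strictly between the \<open>q\<close>-th powers of
  \<open>a ^ p\<close> and \<open>a ^ p + 1\<close>; for negative \<open>a\<close> the same happens
  to \<open>- y\<close> between \<open>b ^ p - 1\<close> and \<open>b ^ p\<close> with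
  \<open>b = - a\<close>. The comparison of the two exponents is where \<open>p < q\<close>
  enters.\<close>

lemma cassels_easy:
  assumes "p < q"
  shows "int p dvd y"
proof (rule ccontr)
  assume "\<not> int p dvd y"
  then obtain a where a: "x - 1 = a ^ q" using not_dvd_factors by metis
  have x: "x = a ^ q + 1" using a by simp
  have p0: "p > 0" using p3 by simp
  have q0: "q > 0" using q3 by simp
  have yq: "y ^ q = (a ^ q + 1) ^ p - 1" using eq x by simp
  have "a \<noteq> 0" using x_neq_1 a q0 by (auto simp: zero_power)
  then consider "a \<ge> 1" | "a \<le> -1" by linarith
  then show False
  proof cases
    case 1
    have "y ^ q < (a ^ p + 1) ^ q" using power_compare_pos[OF 1 assms p0] yq by linarith
    hence up: "y < a ^ p + 1" using q(2) 1 by (intro power_less_imp_less_base[of y q]) auto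
    have "(a ^ q) ^ p + 1 < (a ^ q + 1) ^ p" using 1 p3 by (intro power_add_one_gt) auto
    hence "(a ^ p) ^ q < y ^ q" using yq by (simp add: power_mult[symmetric] mult.commute)
    hence "a ^ p < y"
      using 1 by (metis linorder_not_less power_less_imp_less_base power_mono_odd q(2))
    thus False using up by linarith
  next
    case 2
    define b where "b = - a"
    have "b \<ge> 1" using 2 by (simp add: b_def)
    have aq: "a ^ q = - (b ^ q)" using q(2) by (simp add: b_def)
    \<comment> \<open>\<open>b = 1\<close> would mean \<open>x = 0\<close>, the trivial solution
      with \<open>y = -1\<close>.\<close>
    have "b \<noteq> 1" using aq x nz by auto
    hence b: "b \<ge> 2" using \<open>b \<ge> 1\<close> by linarith
    have zq: "(-y) ^ q = (b ^ q - 1) ^ p + 1"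
    proof -
      have "(-y) ^ q = - (y ^ q)" using q(2) by simp
      also have "\<dots> = 1 - (- (b ^ q - 1)) ^ p" using yq aq by simp
      also have "(- (b ^ q - 1)) ^ p = - ((b ^ q - 1) ^ p)" using p(2) by (rule power_minus_odd)
      finally show ?thesis by simp
    qed
    have "(b ^ p - 1) ^ q < (-y) ^ q" using power_compare_neg[OF b assms p0] zq by linarith
    hence lo: "b ^ p - 1 < -y"
      by (metis linorder_not_less power_mono_odd q(2))
    have "(b ^ q - 1) ^ p + 1 < (b ^ p) ^ q"
    proof -
      have "b ^ 1 \<le> b ^ q" using b q0 by (intro power_increasing) auto
      hence "b ^ q - 1 \<ge> 1" using b by simp
      hence "(b ^ q - 1) ^ p + 1 < (b ^ q - 1 + 1) ^ p" using p3 by (intro power_add_one_gt) auto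
      thus ?thesis by (simp add: power_mult[symmetric] mult.commute)
    qed
    hence "(-y) ^ q < (b ^ p) ^ q" using zq by linarith
    hence "-y < b ^ p"
      by (metis linorder_not_less power_mono_odd q(2))
    thus False using lo by linarith
  qed
qed

text \<open>With equal exponents \<open>x - y\<close> divides 1, so \<open>x = y + 1\<close>; but
  the \<open>p\<close>-th powers of consecutive nonzero integers are more than 1 apart.\<close>

lemma p_neq_q: "p \<noteq> q"
proof
  assume "p = q"
  hence e: "x ^ p - y ^ p = 1" using eq by simp
  have "x ^ p - y ^ p = (x - y) * (\<Sum>i<p. x ^ i * y ^ (p - Suc i))"
    by (simp add: power_diff_sumr2 mult.commute)
  hence "x - y dvd 1" using e by (metis dvd_triv_left)
  moreover have "x > y" using e power_mono_odd[OF p(2), of x y] by force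
  ultimately have xy: "x = y + 1" by auto
  have *: "(A + 1) ^ p > A ^ p + 1" if "A \<ge> 1" for A :: int
    using that p3 by (intro power_add_one_gt) auto
  show False
  proof (cases "y \<ge> 1")
    case True
    show False using *[OF True] e unfolding xy by linarith
  next
    case False
    hence "- x \<ge> 1" using nz xy by linarith
    from *[OF this] have "(- y) ^ p > (- x) ^ p + 1" using xy by (simp add: algebra_simps)
    thus False using e p(2) by simp
  qed
qed

end

section \<open>Binomial coefficients with a rational upper entry\<close>

lemma multiplicity_fact_rec:
  assumes "prime (q::nat)"
  shows "multiplicity q (fact m) = m div q + multiplicity q (fact (m div q))"
proof (induction m)
  case 0
  show ?case by simp
next
  case (Suc m)
  have q: "q \<ge> 2" using assms prime_ge_2_nat by blast
  have *: "multiplicity q (fact (Suc m) :: nat) = multiplicity q (Suc m) + multiplicity q (fact m :: nat)"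
    using assms by (simp add: prime_elem_multiplicity_mult_distrib del: mult_Suc)
  show ?case
  proof (cases "q dvd Suc m")
    case True
    then obtain c where c: "Suc m = q * c" by blast
    have c0: "c > 0" using c by (cases c) auto
    obtain c' where c': "c = Suc c'" using c0 by (cases c) auto
    have "m = q * c' + (q - 1)" using c c' q by simp
    hence d: "m div q = c'" using q by (intro div_nat_eqI) auto
    have d': "Suc m div q = c" using c q by simp
    have "multiplicity q (Suc m) = Suc (multiplicity q c)"
      unfolding c using q c0 by (intro multiplicity_times_same) auto
    moreover have "multiplicity q (fact c :: nat) = multiplicity q c + multiplicity q (fact c' :: nat)"
      unfolding c' using assms by (simp add: prime_elem_multiplicity_mult_distrib del: mult_Suc)
    ultimately show ?thesis using * Suc d d' c' by simp
  next
    case False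
    hence "multiplicity q (Suc m) = 0" by (rule not_dvd_imp_multiplicity_0)
    moreover have "Suc m div q = m div q" using False by (simp add: div_Suc dvd_eq_mod_eq_0)
    ultimately show ?thesis using * Suc by simp
  qed
qed

text \<open>Legendre's formula bounds the multiplicity by \<open>m / (q - 1)\<close>; the constant 2
  is what \<open>q \<ge> 3\<close> gives. It controls the power of \<open>q\<close> in the
  denominators of the binomial series.\<close>

lemma multiplicity_fact_bound:
  assumes "prime (q::nat)" "q \<ge> 3"
  shows "m > 0 \<Longrightarrow> 2 * multiplicity q (fact m) < m"
proof (induction m rule: less_induct)
  case (less m)
  have e: "multiplicity q (fact m) = m div q + multiplicity q (fact (m div q))"
    by (rule multiplicity_fact_rec[OF assms(1)])
  have b: "3 * (m div q) \<le> m"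
    using assms(2) by (metis div_times_less_eq_dividend le_trans mult.commute mult_le_mono1)
  show ?case
  proof (cases "m div q = 0")
    case True
    then show ?thesis using e less.prems by simp
  next
    case False
    hence "2 * multiplicity q (fact (m div q)) < m div q" using b less.prems by (intro less.IH) auto
    then show ?thesis using e b by linarith
  qed
qed

text \<open>The coefficient is the product of the \<open>p - j * q\<close> divided by
  \<open>q ^ k * fact k\<close>. These factors are prime to \<open>q\<close>, so no power of
  \<open>q\<close> cancels; at all other primes the coefficient is integral. The stated exponent of
  \<open>q\<close> is therefore exact.\<close>

lemma gbinomial_rational_numerator:
  assumes "prime (q::nat)" "\<not> q dvd p"
  obtains N :: int where "\<not> int q dvd N"
    "((real p / real q) gchoose k) * real q ^ (k + multiplicity q (fact k)) = of_int N"
proof -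
  define e where "e = multiplicity q (fact k :: nat)"
  have q: "q \<ge> 2" using assms prime_ge_2_nat by blast
  obtain k' where k': "fact k = q ^ e * k'" "\<not> q dvd k'"
    using multiplicity_decompose'[of "fact k :: nat" q] q unfolding e_def by (auto simp: prime_nat_iff)
  have k'0: "k' > 0" using k'(2) by (cases k') auto
  define P where "P = (\<Prod>j<k. int p - int j * int q)"
  have "coprime q k'" using k'(2) assms(1) prime_imp_coprime by blast
  then obtain R where "[q * R = Suc 0] (mod k')" using cong_solve_coprime_nat by blast
  hence R: "[q * R = 1] (mod k')" by simp
  have Ri: "[int q * int R = 1] (mod int k')" using R by (metis cong_int_iff of_nat_1 of_nat_mult)
  \<comment> \<open>\<open>A\<close> is \<open>p / q\<close> read modulo \<open>k'\<close>: up to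
    the factors \<open>q\<close> the product becomes a falling factorial of a natural number, which
    \<open>fact k\<close> divides.\<close>
  define A where "A = p * R"
  have falling: "(\<Prod>j<k. int A - int j) = fact k * int (A choose k)"
  proof -
    have "real_of_int (\<Prod>j<k. int A - int j) = (\<Prod>i = 0..<k. real A - real i)"
      by (simp add: atLeast0LessThan)
    also have "\<dots> = fact k * (real A gchoose k)" by (simp add: gbinomial_mult_fact)
    also have "real A gchoose k = real (A choose k)" by (simp add: binomial_gbinomial)
    finally have "real_of_int (\<Prod>j<k. int A - int j) = real_of_int (fact k * int (A choose k))" by simp
    thus ?thesis by (simp only: of_int_eq_iff)
  qed
  have "[P = (\<Prod>j<k. int q * (int A - int j))] (mod int k')"
    unfolding P_def
  proof (rule cong_prod)
    fix j
    have "int q * (int A - int j) - (int p - int j * int q) = int p * (int q * int R - 1)"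
      by (simp add: A_def algebra_simps)
    moreover have "int k' dvd int q * int R - 1" using Ri by (simp add: cong_iff_dvd_diff)
    ultimately have "int k' dvd int q * (int A - int j) - (int p - int j * int q)" by simp
    hence "[int q * (int A - int j) = int p - int j * int q] (mod int k')"
      by (simp add: cong_iff_dvd_diff)
    thus "[int p - int j * int q = int q * (int A - int j)] (mod int k')" by (rule cong_sym)
  qed
  moreover have "int k' dvd (\<Prod>j<k. int q * (int A - int j))"
  proof -
    have "int k' dvd int (fact k)" using k'(1) by simp
    hence "int k' dvd (\<Prod>j<k. int A - int j)" unfolding falling by (simp add: dvd_mult2)
    thus ?thesis by (simp add: prod.distrib)
  qed
  ultimately have "int k' dvd P" by (metis cong_dvd_iff)
  then obtain N where N: "P = int k' * N" by blast
  have "[P = (\<Prod>j<k. int p)] (mod int q)"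
    unfolding P_def by (intro cong_prod) (simp add: cong_iff_dvd_diff)
  hence "[P = int p ^ k] (mod int q)" by simp
  moreover have "\<not> int q dvd int p ^ k"
    using assms by (metis int_dvd_int_iff of_nat_power prime_dvd_power_nat)
  ultimately have "\<not> int q dvd P" by (metis cong_dvd_iff)
  hence 1: "\<not> int q dvd N" using N by auto
  have "real q ^ k * (\<Prod>j<k. real p / real q - real j) = (\<Prod>j<k. real q * (real p / real q - real j))"
    by (simp add: prod.distrib)
  also have "\<dots> = (\<Prod>j<k. real p - real j * real q)"
    using q by (intro prod.cong) (auto simp: field_simps)
  also have "\<dots> = of_int P" by (simp add: P_def)
  finally have 2: "real q ^ k * (\<Prod>j<k. real p / real q - real j) = of_int P" .
  have 3: "fact k * ((real p / real q) gchoose k) = (\<Prod>j<k. real p / real q - real j)"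
    by (simp add: gbinomial_mult_fact atLeast0LessThan)
  have "(fact k :: real) = of_nat (fact k)" by simp
  also have "\<dots> = real q ^ e * real k'" unfolding k'(1) by simp
  finally have 4: "(fact k :: real) = real q ^ e * real k'" .
  have "real k' * (((real p / real q) gchoose k) * real q ^ (k + e)) =
      real q ^ k * (fact k * ((real p / real q) gchoose k))"
    unfolding 4 by (simp add: power_add)
  also have "\<dots> = real k' * of_int N" unfolding 3 2 N by simp
  finally have "((real p / real q) gchoose k) * real q ^ (k + e) = of_int N" using k'0 by simp
  with 1 show ?thesis using that unfolding e_def by blast
qed

text \<open>The first \<open>m\<close> factors of the numerator are dominated by those of
  \<open>fact m\<close>, and each further quotient \<open>(s - k) / (k + 1)\<close> has absolute
  value at most 1. Hence the tail of the series stays below a geometric one.\<close>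

lemma abs_gbinomial_le_1:
  fixes s :: real
  assumes "real m - 1 \<le> s" "s \<le> real m" "m \<le> k"
  shows "\<bar>s gchoose k\<bar> \<le> 1"
  using assms(3)
proof (induction k rule: dec_induct)
  case base
  have "(\<Prod>i<m. s - real i) \<le> (\<Prod>i<m. real m - real i)"
    using assms by (intro prod_mono) auto
  also have "\<dots> = fact m"
    using gbinomial_mult_fact[of m "real m"] by (simp add: binomial_gbinomial[symmetric] atLeast0LessThan)
  finally have "(\<Prod>i<m. s - real i) \<le> fact m" .
  moreover have "0 \<le> (\<Prod>i<m. s - real i)" using assms by (intro prod_nonneg) auto
  ultimately show ?case by (simp add: gbinomial_prod_rev atLeast0LessThan)
next
  case (step k)
  have "s gchoose Suc k = (s gchoose k) * ((s - real k) / real (Suc k))"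
    by (simp add: gbinomial_prod_rev field_simps)
  moreover have "\<bar>(s - real k) / real (Suc k)\<bar> \<le> 1" using step assms by (simp add: field_simps)
  moreover have "\<bar>(s gchoose k) * ((s - real k) / real (Suc k))\<bar> \<le> 1"
    unfolding abs_mult using step.IH calculation by (intro mult_le_one) auto
  ultimately show ?case by simp
qed

lemma binomial_series_tail:
  fixes s t :: real
  assumes "real m - 1 \<le> s" "s \<le> real m" "\<bar>t\<bar> < 1"
  shows "\<bar>(1 + t) powr s - (\<Sum>k\<le>m. (s gchoose k) * t ^ k)\<bar> \<le> \<bar>t\<bar> ^ Suc m / (1 - \<bar>t\<bar>)"
proof -
  have "(\<lambda>n. (s gchoose n) * t ^ n) sums (1 + t) powr s" by (rule gen_binomial_real[OF assms(3)])
  hence "(\<lambda>n. (s gchoose (n + Suc m)) * t ^ (n + Suc m)) sums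
      ((1 + t) powr s - (\<Sum>k<Suc m. (s gchoose k) * t ^ k))"
    by (rule sums_split_initial_segment)
  hence *: "(1 + t) powr s - (\<Sum>k\<le>m. (s gchoose k) * t ^ k) =
      suminf (\<lambda>n. (s gchoose (n + Suc m)) * t ^ (n + Suc m))"
    by (simp add: sums_iff lessThan_Suc_atMost del: add_Suc_right)
  have g: "(\<lambda>n. \<bar>t\<bar> ^ Suc m * \<bar>t\<bar> ^ n) sums (\<bar>t\<bar> ^ Suc m * (1 / (1 - \<bar>t\<bar>)))"
    using assms(3) by (intro sums_mult geometric_sums) auto
  have "norm (suminf (\<lambda>n. (s gchoose (n + Suc m)) * t ^ (n + Suc m))) \<le> suminf (\<lambda>n. \<bar>t\<bar> ^ Suc m * \<bar>t\<bar> ^ n)"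
  proof (rule norm_suminf_le)
    fix n
    have "\<bar>s gchoose (n + Suc m)\<bar> * \<bar>t\<bar> ^ (n + Suc m) \<le> 1 * \<bar>t\<bar> ^ (n + Suc m)"
      by (intro mult_right_mono abs_gbinomial_le_1[OF assms(1,2)]) auto
    thus "norm ((s gchoose (n + Suc m)) * t ^ (n + Suc m)) \<le> \<bar>t\<bar> ^ Suc m * \<bar>t\<bar> ^ n"
      by (simp add: abs_mult power_abs power_add mult_ac)
  qed (use g in \<open>auto simp: sums_iff\<close>)
  also have "\<dots> = \<bar>t\<bar> ^ Suc m / (1 - \<bar>t\<bar>)" using g by (simp add: sums_iff)
  finally show ?thesis using * by simp
qed

lemma double_le_power3: "n \<ge> 2 \<Longrightarrow> 2 * Suc n \<le> (3::nat) ^ n"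
  by (induction n rule: dec_induct) auto

section \<open>Cassels' theorem for \<open>q < p\<close>\<close>

context catalan_solution
begin

text \<open>Divisibility of \<open>x\<close> by \<open>q\<close> alone gives too weak a bound. The factor \<open>v\<close> of \<open>x\<close> is \<open>1\<close> modulo
  \<open>q ^ (p - 2)\<close>, because \<open>p\<close> is prime to the order of the unit group.\<close>

lemma x_lower_bound:
  assumes "q < p"
  shows "\<bar>x\<bar> \<ge> int q ^ (p - 1) + int q"
proof -
  interpret s: catalan_solution q p "-y" "-x" by (rule swap)
  have "int q dvd - x" using s.cassels_easy[OF assms] .
  then obtain b v where bv: "- y - 1 = int q ^ (p - 1) * b ^ p"
      "(\<Sum>i<q. (- y) ^ i) = int q * v ^ p" "\<not> int q dvd v" "v > 0"
    using s.dvd_factors by metis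
  define w where "w = - y"
  define S where "S = (\<Sum>i<q. w ^ i)"
  have p4: "p \<ge> 4" using assms q3 by simp
  have q0: "q > 0" using q3 by simp
  have "(- x) ^ p = (int q ^ (p - 1) * b ^ p) * (int q * v ^ p)"
    using s.factorization bv by simp
  also have "\<dots> = (int q ^ (p - 1) * int q) * (b ^ p * v ^ p)" by (simp add: mult_ac)
  also have "int q ^ (p - 1) * int q = int q ^ p" using p4 by (intro power_minus_mult) simp
  finally have xp: "(- x) ^ p = (int q * b * v) ^ p" by (simp add: power_mult_distrib mult_ac)
  hence "\<bar>(- x) ^ p\<bar> = \<bar>(int q * b * v) ^ p\<bar>" by (rule arg_cong)
  hence "\<bar>x\<bar> ^ p = \<bar>int q * b * v\<bar> ^ p" by (simp only: power_abs abs_minus_cancel)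
  from power_eq_imp_eq_base[OF this] have ax: "\<bar>x\<bar> = \<bar>int q * b * v\<bar>" using p4 by simp
  have b0: "b \<noteq> 0" using ax nz by auto
  have w: "w - 1 = int q ^ (p - 1) * b ^ p" using bv by (simp add: w_def)
  have Sv: "S = int q * v ^ p" using bv by (simp add: S_def w_def)
  have pp: "p - 1 = Suc (p - 2)" using p4 by simp
  have "int q ^ (p - 1) dvd S - int q"
    using sum_powers_cong1[of w q] unfolding w S_def[symmetric] by (rule dvd_mult_left)
  also have "S - int q = int q * (v ^ p - 1)" using Sv by (simp add: algebra_simps)
  finally have "int q ^ (p - 2) dvd v ^ p - 1" using q0 unfolding pp by simp
  hence "[v ^ p = 1] (mod int q ^ (p - 2))" by (simp add: cong_iff_dvd_diff)
  hence "[int (nat v ^ p) = int 1] (mod int (q ^ (p - 2)))" using bv(4) by simp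
  hence V: "[nat v ^ p = 1] (mod q ^ (p - 2))" by (simp only: cong_int_iff)
  have cop: "coprime (q ^ (p - 2)) (nat v)"
  proof -
    have "\<not> q dvd nat v" using bv(3,4) by (metis int_dvd_int_iff nat_0_le less_imp_le)
    hence "coprime q (nat v)" using q(1) prime_imp_coprime by blast
    thus ?thesis by simp
  qed
  have "ord (q ^ (p - 2)) (nat v) dvd p" using V by (simp only: ord_divides)
  moreover have "ord (q ^ (p - 2)) (nat v) dvd totient (q ^ (p - 2))"
    using cop by (rule order_divides_totient)
  moreover have "totient (q ^ (p - 2)) = q ^ (p - 3) * (q - 1)"
    using totient_prime_power[OF q(1), of "p - 2"] p4 by (simp add: numeral_3_eq_3 numeral_2_eq_2)
  moreover have "coprime p (q ^ (p - 3) * (q - 1))"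
  proof -
    have "\<not> p dvd q" using assms q0 by (meson dvd_imp_le linorder_not_less)
    moreover have "\<not> p dvd q - 1" using assms q3 by (auto dest!: dvd_imp_le)
    ultimately show ?thesis using p(1) by (simp add: prime_imp_coprime)
  qed
  ultimately have "ord (q ^ (p - 2)) (nat v) dvd 1"
    by (metis coprime_common_divisor)
  hence "[nat v ^ 1 = 1] (mod q ^ (p - 2))" by (simp only: ord_divides)
  hence "[int (nat v) = int 1] (mod int (q ^ (p - 2)))" by (simp only: cong_int_iff power_one_right)
  hence dv: "int q ^ (p - 2) dvd v - 1" using bv(4) by (simp add: cong_iff_dvd_diff)
  \<comment> \<open>A positive \<open>v\<close> that is 1 modulo \<open>q ^ (p - 2)\<close> is
    either 1 or at least \<open>q ^ (p - 2) + 1\<close>. In the first case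
    \<open>w ^ q - 1 = q * (w - 1)\<close>, which fails since \<open>\<bar>w\<bar>\<close> exceeds
    \<open>q + 1\<close>.\<close>
  have v1: "v \<noteq> 1"
  proof
    assume "v = 1"
    hence "w ^ q - 1 = (w - 1) * int q" using power_diff_1_eq[of w q] Sv S_def by simp
    hence "w ^ q = int q * w - int q + 1" by (simp add: algebra_simps)
    hence "\<bar>w\<bar> ^ q = \<bar>int q * w - int q + 1\<bar>" by (simp add: power_abs[symmetric])
    also have "\<dots> \<le> \<bar>int q * w\<bar> + \<bar>1 - int q\<bar>" by linarith
    also have "\<dots> = int q * \<bar>w\<bar> + int q - 1" using q3 by (simp add: abs_mult)
    finally have up: "\<bar>w\<bar> ^ q \<le> int q * \<bar>w\<bar> + int q - 1" .
    have "int q ^ 2 \<le> int q ^ (p - 1)" using q3 p4 by (intro power_increasing) auto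
    moreover have "int q ^ (p - 1) \<le> \<bar>w - 1\<bar>"
      using dvd_imp_le_int[of "w - 1" "int q ^ (p - 1)"] b0 q0 unfolding w by simp
    moreover have "int q ^ 2 \<ge> 3 * int q" using q3 by (simp add: power2_eq_square)
    ultimately have wl: "\<bar>w\<bar> \<ge> int q + 2" using q3 by linarith
    have "\<bar>w\<bar> ^ 2 \<le> \<bar>w\<bar> ^ q" using wl q3 by (intro power_increasing) auto
    moreover have "\<bar>w\<bar> ^ 2 \<ge> (int q + 2) * \<bar>w\<bar>"
      using wl by (simp only: power2_eq_square) (intro mult_right_mono, auto)
    ultimately show False using up wl by (simp add: algebra_simps)
  qed
  have "int q ^ (p - 2) \<le> v - 1" using dv v1 bv(4) by (intro zdvd_imp_le) auto
  hence "int q * (int q ^ (p - 2) + 1) \<le> int q * v" by (intro mult_left_mono) auto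
  also have "\<dots> \<le> int q * v * \<bar>b\<bar>"
    using mult_left_mono[of 1 "\<bar>b\<bar>" "int q * v"] b0 bv(4) by simp
  also have "\<dots> = \<bar>x\<bar>" using ax bv(4) by (simp add: abs_mult mult_ac)
  finally show ?thesis unfolding pp by (simp add: algebra_simps)
qed

text \<open>If \<open>p\<close> does not divide \<open>y\<close>, then \<open>x - 1 = a ^ q\<close>, and \<open>y / a ^ p\<close> is extremely close to
  \<open>(1 + t) powr (p / q)\<close> with \<open>t = 1 / a ^ q\<close>. Truncating the binomial series after \<open>t ^ m\<close>, where
  \<open>m = p div q + 1\<close>, and clearing denominators yields an integer \<open>Z\<close> with \<open>\<bar>Z\<bar> < 1\<close> that is nonzero, since
  only the last term of the truncated series contributes modulo \<open>q\<close>.\<close>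

lemma cassels_hard:
  assumes "q < p"
  shows "int p dvd y"
proof (rule ccontr)
  assume "\<not> int p dvd y"
  then obtain a where a: "x - 1 = a ^ q" using not_dvd_factors by metis
  have p5: "p \<ge> 5"
  proof -
    have "p \<noteq> 4" using p(2) by auto
    thus ?thesis using assms q3 by simp
  qed
  have q0: "q > 0" using q3 by simp
  have "\<not> q dvd p" using p(1) q(1) assms primes_dvd_imp_eq by blast
  define m where "m = p div q + 1"
  define e where "e = (\<lambda>k. multiplicity q (fact k :: nat))"
  define s where "s = real p / real q"
  have m0: "m > 0" by (simp add: m_def)
  have pm: "p mod q > 0" using \<open>\<not> q dvd p\<close> by (simp add: dvd_eq_mod_eq_0)
  have dm: "q * (p div q) + p mod q = p" by simp
  have pq1: "q * (m - 1) < p" using dm pm unfolding m_def add_diff_cancel_right' by linarith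
  have "p mod q < q" using q0 by simp
  moreover have "q * m = q * (p div q) + q" by (simp add: m_def algebra_simps)
  ultimately have pq2: "p < q * m" using dm by linarith
  have "3 * (m - 1) \<le> q * (m - 1)" using q3 by (intro mult_right_mono) auto
  hence m3: "3 * (m - 1) < p" using pq1 by linarith
  have mp: "m + 2 \<le> p" using m3 p5 m0 by linarith
  \<comment> \<open>The final estimate is
    \<open>\<bar>Z\<bar> \<le> 2 * q ^ D * \<bar>t\<bar>\<close> with \<open>D = m + e m\<close>,
    while \<open>\<bar>t\<bar> \<le> 1 / q ^ (p - 1)\<close>. An exponent of at most
    \<open>p - 2\<close> leaves \<open>2 / q < 1\<close>.\<close>
  have em: "m + e m \<le> p - 2"
    using multiplicity_fact_bound[OF q(1) q3 m0] m3 p5 m0 unfolding e_def by linarith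
  have s1: "real m - 1 \<le> s" "s \<le> real m"
  proof -
    have "real (q * (m - 1)) < real p" using pq1 by (simp only: of_nat_less_iff)
    hence "real q * (real m - 1) < real p" using m0 by (simp add: of_nat_diff)
    thus "real m - 1 \<le> s" using q0 by (simp add: s_def field_simps)
    have "real p < real (q * m)" using pq2 by (simp only: of_nat_less_iff)
    thus "s \<le> real m" using q0 by (simp add: s_def field_simps)
  qed
  define h where "h = real_of_int (x - 1)"
  have "\<bar>x - 1\<bar> \<ge> int q ^ (p - 1)" using x_lower_bound[OF assms] q3 by linarith
  hence "real_of_int \<bar>x - 1\<bar> \<ge> real_of_int (int q ^ (p - 1))" by (simp only: of_int_le_iff)
  hence hl: "\<bar>h\<bar> \<ge> real q ^ (p - 1)" by (simp add: h_def)
  have h0: "h \<noteq> 0" using x_neq_1 by (simp add: h_def)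
  have ha: "h = real_of_int a ^ q" using a by (simp add: h_def)
  have a0: "a \<noteq> 0" using h0 ha q0 by (auto simp: zero_power)
  define t where "t = 1 / h"
  have t0: "t \<noteq> 0" using h0 by (simp add: t_def)
  have q3r: "real q \<ge> 3" using q3 by simp
  have tq: "\<bar>t\<bar> * real q ^ (p - 1) \<le> 1"
    using hl h0 by (simp add: t_def field_simps)
  have "2 * Suc (p - 1) \<le> 3 ^ (p - 1)" using p5 by (intro double_le_power3) auto
  hence "real (2 * Suc (p - 1)) \<le> real (3 ^ (p - 1))" by (simp only: of_nat_le_iff)
  hence "2 * real p \<le> 3 ^ (p - 1)" using p5 by simp
  also have "(3::real) ^ (p - 1) \<le> real q ^ (p - 1)" using q3r by (intro power_mono) auto
  finally have "2 * real p \<le> real q ^ (p - 1)" .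
  hence "\<bar>t\<bar> * (2 * real p) \<le> \<bar>t\<bar> * real q ^ (p - 1)" by (intro mult_left_mono) auto
  hence pt: "real p * \<bar>t\<bar> \<le> 1 / 2" using tq by (simp add: mult_ac)
  have "(3::real) ^ 2 \<le> real q ^ 2" using q3r by (intro power_mono) auto
  also have "\<dots> \<le> real q ^ (p - 1)" using q3r p5 by (intro power_increasing) auto
  finally have "\<bar>t\<bar> * 9 \<le> \<bar>t\<bar> * real q ^ (p - 1)" by (intro mult_left_mono) auto
  hence t9: "\<bar>t\<bar> \<le> 1 / 9" using tq by simp
  define B where "B = real_of_int y / real_of_int a ^ p"
  define A where "A = (1 + t) powr s"
  define G where "G = (\<Sum>k\<le>m. (s gchoose k) * t ^ k)"
  have t1: "1 + t > 0" using t9 by linarith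
  \<comment> \<open>The equation in exact form: \<open>B ^ q\<close> misses
    \<open>A ^ q = (1 + t) ^ p\<close> only by \<open>t ^ p\<close>, which is much smaller than the
    first omitted term of the series because \<open>m + 2 \<le> p\<close>.\<close>
  have Bq: "B ^ q = (1 + t) ^ p - t ^ p"
  proof -
    have "real_of_int (x ^ p - y ^ q) = 1" using eq by simp
    hence "real_of_int y ^ q = (h + 1) ^ p - 1" by (simp add: h_def)
    moreover have "(real_of_int a ^ p) ^ q = h ^ p"
      by (simp add: ha power_mult[symmetric] mult.commute)
    ultimately have "B ^ q = ((h + 1) ^ p - 1) / h ^ p" by (simp add: B_def power_divide)
    also have "\<dots> = ((h + 1) / h) ^ p - (1 / h) ^ p" by (simp add: power_divide diff_divide_distrib)
    also have "(h + 1) / h = 1 + t" using h0 by (simp add: t_def field_simps)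
    finally show ?thesis by (simp add: t_def)
  qed
  have A0: "A > 0" using t1 by (simp add: A_def)
  have Aq: "A ^ q = (1 + t) ^ p"
  proof -
    have "A ^ q = A powr real q" using A0 by (simp add: powr_realpow)
    also have "\<dots> = (1 + t) powr (s * real q)" by (simp add: A_def powr_powr)
    also have "s * real q = real p" using q0 by (simp add: s_def)
    finally show ?thesis using t1 by (simp add: powr_realpow)
  qed
  have bern: "(1 + t) ^ p \<ge> 1 / 2"
  proof -
    have "1 + real p * t \<le> (1 + t) ^ p" using t1 by (intro Bernoulli_inequality) auto
    moreover have "real p * t \<ge> - (real p * \<bar>t\<bar>)" by (simp add: abs_if mult_less_0_iff)
    ultimately show ?thesis using pt by linarith
  qed
  have "\<bar>t\<bar> ^ p \<le> \<bar>t\<bar> ^ 1" using t9 p5 by (intro power_decreasing) auto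
  hence "\<bar>t ^ p\<bar> \<le> 1 / 9" using t9 by (simp add: power_abs)
  hence "B ^ q > 0" using Bq bern by linarith
  hence B0: "B > 0" using q(2) q0 by (auto simp: zero_less_power_eq)
  have Aq1: "A ^ (q - 1) \<ge> 1 / 2"
  proof (cases "A \<ge> 1")
    case True
    hence "A ^ (q - 1) \<ge> 1" by simp
    thus ?thesis by linarith
  next
    case False
    hence "A ^ q \<le> A ^ (q - 1)" using A0 by (intro power_decreasing) auto
    thus ?thesis using bern Aq by linarith
  qed
  have AB: "\<bar>A - B\<bar> \<le> 2 * \<bar>t\<bar> ^ p"
  proof -
    define T where "T = (\<Sum>i<q. B ^ (q - Suc i) * A ^ i)"
    have "B ^ (q - Suc (q - 1)) * A ^ (q - 1) \<le> T"
      unfolding T_def using A0 B0 q0 by (intro member_le_sum) auto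
    hence T: "T \<ge> 1 / 2" using Aq1 q0 by simp
    have "t ^ p = (A - B) * T" using power_diff_sumr2[of A q B] Aq Bq by (simp add: T_def)
    hence "\<bar>t\<bar> ^ p = \<bar>A - B\<bar> * T" using T by (simp add: power_abs[symmetric] abs_mult)
    moreover have "\<bar>A - B\<bar> * T \<ge> \<bar>A - B\<bar> * (1 / 2)" using T by (intro mult_left_mono) auto
    ultimately have "\<bar>A - B\<bar> * (1 / 2) \<le> \<bar>t\<bar> ^ p" by simp
    thus ?thesis by simp
  qed
  have BG: "\<bar>B - G\<bar> \<le> 2 * \<bar>t\<bar> ^ Suc m"
  proof -
    have "\<bar>A - G\<bar> \<le> \<bar>t\<bar> ^ Suc m / (1 - \<bar>t\<bar>)"
      unfolding A_def G_def using s1 t9 by (intro binomial_series_tail) auto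
    also have "\<dots> = \<bar>t\<bar> ^ Suc m * (1 / (1 - \<bar>t\<bar>))" by simp
    also have "\<dots> \<le> \<bar>t\<bar> ^ Suc m * (9 / 8)"
      using t9 by (intro mult_left_mono) (auto simp: field_simps)
    finally have 1: "\<bar>A - G\<bar> \<le> \<bar>t\<bar> ^ Suc m * (9 / 8)" .
    have "\<bar>t\<bar> ^ p \<le> \<bar>t\<bar> ^ Suc (Suc m)" using mp t9 by (intro power_decreasing) auto
    also have "\<dots> = \<bar>t\<bar> ^ Suc m * \<bar>t\<bar>" by simp
    also have "\<dots> \<le> \<bar>t\<bar> ^ Suc m * (1 / 9)" using t9 by (intro mult_left_mono) auto
    finally have 2: "\<bar>t\<bar> ^ p \<le> \<bar>t\<bar> ^ Suc m * (1 / 9)" .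
    have "\<bar>B - G\<bar> \<le> \<bar>A - G\<bar> + \<bar>A - B\<bar>" by linarith
    also have "\<dots> \<le> \<bar>t\<bar> ^ Suc m * (9 / 8) + 2 * (\<bar>t\<bar> ^ Suc m * (1 / 9))"
      using 1 2 AB by linarith
    also have "\<dots> \<le> 2 * \<bar>t\<bar> ^ Suc m" by simp
    finally show ?thesis .
  qed
  have "\<forall>k. \<exists>N :: int. \<not> int q dvd N \<and> (s gchoose k) * real q ^ (k + e k) = of_int N"
    using gbinomial_rational_numerator[OF q(1) \<open>\<not> q dvd p\<close>] unfolding s_def e_def by metis
  then obtain N :: "nat \<Rightarrow> int" where N: "\<And>k. \<not> int q dvd N k"
    "\<And>k. (s gchoose k) * real q ^ (k + e k) = of_int (N k)" by metis
  have e_mono: "e k \<le> e l" if "k \<le> l" for k l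
    unfolding e_def using that by (intro dvd_imp_multiplicity_le) (auto simp: fact_dvd)
  define D where "D = m + e m"
  \<comment> \<open>\<open>m\<close> is the least integer above \<open>p / q\<close>, so
    \<open>m * q - p\<close> is positive and \<open>h ^ m\<close> clears the denominator
    \<open>a ^ p\<close> of \<open>B\<close> as well as the powers of \<open>t\<close>;
    \<open>q ^ D\<close> clears the binomial coefficients.\<close>
  define Z where "Z = int q ^ D * (a ^ (m * q - p) * y) -
      (\<Sum>k\<le>m. N k * int q ^ (D - (k + e k)) * (x - 1) ^ (m - k))"
  have ZG: "real_of_int Z = real q ^ D * h ^ m * (B - G)"
  proof -
    have "real_of_int a ^ (m * q - p) * real_of_int a ^ p = h ^ m"
      using pq2 by (simp add: ha power_add[symmetric] power_mult[symmetric] mult.commute)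
    hence 1: "real_of_int a ^ (m * q - p) * y = h ^ m * B"
      using a0 by (simp add: B_def field_simps)
    have 2: "of_int (N k) * real q ^ (D - (k + e k)) * h ^ (m - k) =
        real q ^ D * h ^ m * ((s gchoose k) * t ^ k)" if "k \<le> m" for k
    proof -
      have "real q ^ (D - (k + e k)) * real q ^ (k + e k) = real q ^ D"
        using that e_mono[OF that] by (simp add: power_add[symmetric] D_def)
      moreover have "h ^ (m - k) = h ^ m * t ^ k"
        using that h0 by (simp add: t_def power_diff power_divide)
      ultimately show ?thesis unfolding N(2)[symmetric] by (simp add: mult_ac)
    qed
    have "real_of_int Z = real q ^ D * (real_of_int a ^ (m * q - p) * y) -
        (\<Sum>k\<le>m. of_int (N k) * real q ^ (D - (k + e k)) * h ^ (m - k))"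
      by (simp add: Z_def h_def)
    also have "(\<Sum>k\<le>m. of_int (N k) * real q ^ (D - (k + e k)) * h ^ (m - k)) =
        (\<Sum>k\<le>m. real q ^ D * h ^ m * ((s gchoose k) * t ^ k))"
      by (intro sum.cong refl 2) auto
    also have "\<dots> = real q ^ D * h ^ m * G" by (simp add: G_def sum_distrib_left)
    finally show ?thesis unfolding 1 by (simp add: algebra_simps)
  qed
  have "Z \<noteq> 0"
  proof
    assume "Z = 0"
    have "int q dvd int q ^ D * (a ^ (m * q - p) * y)" using m0 by (simp add: D_def dvd_mult2 dvd_power)
    moreover have "int q dvd N k * int q ^ (D - (k + e k)) * (x - 1) ^ (m - k)" if "k < m" for k
    proof -
      have "D - (k + e k) > 0" using that e_mono[of k m] by (simp add: D_def)
      thus ?thesis by (intro dvd_mult2 dvd_mult) (simp add: dvd_power)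
    qed
    hence "int q dvd (\<Sum>k<m. N k * int q ^ (D - (k + e k)) * (x - 1) ^ (m - k))"
      by (intro dvd_sum) auto
    moreover have "(\<Sum>k\<le>m. N k * int q ^ (D - (k + e k)) * (x - 1) ^ (m - k)) =
      (\<Sum>k<m. N k * int q ^ (D - (k + e k)) * (x - 1) ^ (m - k)) + N m"
      by (simp add: lessThan_Suc_atMost[symmetric] D_def)
    ultimately have "int q dvd N m" using \<open>Z = 0\<close> unfolding Z_def
      by (simp add: dvd_add_right_iff)
    thus False using N(1) by blast
  qed
  hence "\<bar>Z\<bar> \<ge> 1" by linarith
  hence "\<bar>real_of_int Z\<bar> \<ge> 1" by linarith
  moreover have "\<bar>real_of_int Z\<bar> < 1"
  proof -
    have "\<bar>real_of_int Z\<bar> = real q ^ D * \<bar>h\<bar> ^ m * \<bar>B - G\<bar>"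
      unfolding ZG by (simp add: abs_mult power_abs)
    also have "\<dots> \<le> real q ^ D * \<bar>h\<bar> ^ m * (2 * \<bar>t\<bar> ^ Suc m)"
      using BG by (intro mult_left_mono) auto
    also have "\<dots> = 2 * real q ^ D * \<bar>t\<bar>" using h0 by (simp add: t_def field_simps)
    also have "\<dots> \<le> 2 * real q ^ (p - 2) * \<bar>t\<bar>"
      using em q3r unfolding D_def by (intro mult_right_mono mult_left_mono power_increasing) auto
    finally have 1: "\<bar>real_of_int Z\<bar> \<le> 2 * real q ^ (p - 2) * \<bar>t\<bar>" .
    have "p - 1 = Suc (p - 2)" using p5 by simp
    hence 2: "real q * (real q ^ (p - 2) * \<bar>t\<bar>) \<le> 1" using tq by (simp add: mult_ac)
    have "3 * (real q ^ (p - 2) * \<bar>t\<bar>) \<le> real q * (real q ^ (p - 2) * \<bar>t\<bar>)"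
      using q3r by (intro mult_right_mono) auto
    thus ?thesis using 1 2 by linarith
  qed
  ultimately show False by linarith
qed

lemma cassels: "int p dvd y"
  using cassels_easy cassels_hard p_neq_q by (metis nat_neq_iff)

lemma cassels': "int q dvd x"
  using catalan_solution.cassels[OF swap] by simp

end

section \<open>Algebraic integers\<close>

definition int_span :: "('i \<Rightarrow> complex) \<Rightarrow> 'i set \<Rightarrow> complex set" where
  "int_span f I = {\<Sum>j\<in>I. of_int (c j) * f j |c. True}"

lemma int_spanI: "z = (\<Sum>j\<in>I. of_int (c j) * f j) \<Longrightarrow> z \<in> int_span f I"
  by (auto simp: int_span_def)

lemma int_span_add:
  assumes "a \<in> int_span f I" "b \<in> int_span f I"
  shows "a + b \<in> int_span f I"
proof -
  from assms obtain c d where "a = (\<Sum>j\<in>I. of_int (c j) * f j)" "b = (\<Sum>j\<in>I. of_int (d j) * f j)"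
    by (auto simp: int_span_def)
  hence "a + b = (\<Sum>j\<in>I. of_int (c j + d j) * f j)" by (simp add: sum.distrib algebra_simps)
  thus ?thesis by (rule int_spanI)
qed

lemma int_span_zero: "0 \<in> int_span f I"
  unfolding int_span_def by (rule CollectI, rule exI[of _ "\<lambda>_. 0"]) simp

lemma int_span_scale:
  assumes "a \<in> int_span f I"
  shows "of_int k * a \<in> int_span f I"
proof -
  from assms obtain c where "a = (\<Sum>j\<in>I. of_int (c j) * f j)" by (auto simp: int_span_def)
  hence "of_int k * a = (\<Sum>j\<in>I. of_int (k * c j) * f j)" by (simp add: sum_distrib_left mult_ac)
  thus ?thesis by (rule int_spanI)
qed

lemma int_span_sum:
  "(\<And>k. k \<in> J \<Longrightarrow> g k \<in> int_span f I) \<Longrightarrow> (\<Sum>k\<in>J. g k) \<in> int_span f I"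
  by (induction J rule: infinite_finite_induct) (auto intro: int_span_add int_span_zero)

lemma int_span_base:
  assumes "finite I" "i \<in> I"
  shows "f i \<in> int_span f I"
proof (rule int_spanI)
  have "(\<Sum>j\<in>I. of_int (if j = i then 1 else 0) * f j) = (\<Sum>j\<in>I. if j = i then f j else 0)"
    by (intro sum.cong) auto
  thus "f i = (\<Sum>j\<in>I. of_int (if j = i then 1 else 0) * f j)"
    using assms by simp
qed

text \<open>The family spans a module stable under \<open>x\<close>, so \<open>x\<close> is an eigenvalue of an integer matrix.\<close>

lemma algebraic_int_if_stable_span:
  fixes f :: "'i \<Rightarrow> complex"
  assumes fin: "finite I" and nz: "i0 \<in> I" "f i0 \<noteq> 0"
    and st: "\<And>i. i \<in> I \<Longrightarrow> x * f i \<in> int_span f I"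
  shows "algebraic_int x"
proof -
  define n where "n = card I"
  obtain h where h: "bij_betw h {0..<n} I"
    using ex_bij_betw_nat_finite[OF fin] n_def by blast
  have "\<forall>i\<in>I. \<exists>c :: 'i \<Rightarrow> int. x * f i = (\<Sum>j\<in>I. of_int (c j) * f j)"
    using st by (auto simp: int_span_def)
  then obtain c :: "'i \<Rightarrow> 'i \<Rightarrow> int" where c: "\<And>i. i \<in> I \<Longrightarrow> x * f i = (\<Sum>j\<in>I. of_int (c i j) * f j)"
    by metis
  define M where "M = mat n n (\<lambda>(i, j). c (h i) (h j))"
  define v where "v = vec n (\<lambda>i. f (h i))"
  have M: "M \<in> carrier_mat n n" by (simp add: M_def)
  define A where "A = map_mat (of_int :: int \<Rightarrow> complex) M"
  have A: "A \<in> carrier_mat n n" using M by (simp add: A_def)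
  obtain k where k: "k < n" "h k = i0" using h nz(1) by (metis atLeastLessThan_iff bij_betw_iff_bijections)
  have "eigenvector A v x"
    unfolding eigenvector_def
  proof (intro conjI)
    show "v \<in> carrier_vec (dim_row A)" using A by (simp add: v_def)
    have "v $ k \<noteq> 0" using k nz(2) by (simp add: v_def)
    thus "v \<noteq> 0\<^sub>v (dim_row A)" using A k(1) by auto
    show "A *\<^sub>v v = x \<cdot>\<^sub>v v"
    proof (rule eq_vecI)
      show "dim_vec (A *\<^sub>v v) = dim_vec (x \<cdot>\<^sub>v v)" using A by (simp add: v_def)
      fix i assume "i < dim_vec (x \<cdot>\<^sub>v v)"
      hence i: "i < n" by (simp add: v_def)
      hence hi: "h i \<in> I" using h by (auto simp: bij_betw_def)
      have "(A *\<^sub>v v) $ i = (\<Sum>j = 0..<n. of_int (c (h i) (h j)) * f (h j))"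
        using i A by (simp add: A_def M_def v_def scalar_prod_def)
      also have "\<dots> = (\<Sum>j\<in>I. of_int (c (h i) j) * f j)"
        by (rule sum.reindex_bij_betw[OF h])
      also have "\<dots> = x * f (h i)" using c[OF hi] by simp
      finally show "(A *\<^sub>v v) $ i = (x \<cdot>\<^sub>v v) $ i" using i by (simp add: v_def)
    qed
  qed
  hence "eigenvalue A x" by (auto simp: eigenvalue_def)
  hence "poly (char_poly A) x = 0" using eigenvalue_root_char_poly[OF A] by simp
  moreover have "char_poly A = map_poly of_int (char_poly M)"
    unfolding A_def by (rule of_int_hom.char_poly_hom[OF M])
  moreover have "lead_coeff (char_poly M) = 1" using degree_monic_char_poly[OF M] by simp
  ultimately show ?thesis unfolding algebraic_int_altdef_ipoly by metis
qed

text \<open>The monomials \<open>x ^ i * y ^ j\<close> with exponents below the degrees of two monic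
  equations span a module stable under both numbers. One family for both serves sums and products
  alike.\<close>

lemma algebraic_int_stable_family:
  fixes x y :: complex
  assumes "algebraic_int x" "algebraic_int y"
  obtains I :: "(nat \<times> nat) set" and f where "finite I" "(0, 0) \<in> I" "f (0, 0) \<noteq> 0"
    "\<And>i. i \<in> I \<Longrightarrow> x * f i \<in> int_span f I" "\<And>i. i \<in> I \<Longrightarrow> y * f i \<in> int_span f I"
proof -
  have *: "\<exists>n>0. \<exists>a :: nat \<Rightarrow> int. z ^ n = (\<Sum>i<n. of_int (a i) * z ^ i)" if z: "algebraic_int z" for z :: complex
  proof -
    obtain P :: "int poly" where P: "poly (map_poly of_int P) z = 0" "lead_coeff P = 1"
      using z unfolding algebraic_int_altdef_ipoly by blast
    define n where "n = degree P"
    have dm: "degree (map_poly of_int P :: complex poly) = n" by (simp add: n_def)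
    have "n > 0"
    proof (rule ccontr)
      assume "\<not> n > 0"
      then obtain c where "P = [:c:]" by (auto simp: n_def elim: degree_eq_zeroE)
      with P show False by simp
    qed
    have "0 = (\<Sum>i\<le>n. of_int (coeff P i) * z ^ i)"
      using P(1) by (simp add: poly_altdef dm n_def)
    also have "\<dots> = (\<Sum>i<n. of_int (coeff P i) * z ^ i) + z ^ n"
      using P(2) by (simp add: lessThan_Suc_atMost[symmetric] n_def)
    finally have "z ^ n + (\<Sum>i<n. of_int (coeff P i) * z ^ i) = 0" by (simp only: add.commute)
    hence "z ^ n = - (\<Sum>i<n. of_int (coeff P i) * z ^ i)" by (simp only: eq_neg_iff_add_eq_0)
    also have "\<dots> = (\<Sum>i<n. of_int (- coeff P i) * z ^ i)"
      by (simp only: sum_negf of_int_minus mult_minus_left)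
    finally have "z ^ n = (\<Sum>i<n. of_int (- coeff P i) * z ^ i)" .
    with \<open>n > 0\<close> show ?thesis by (intro exI[of _ n] conjI exI[of _ "\<lambda>i. - coeff P i"])
  qed
  obtain n a where n: "n > 0" "x ^ n = (\<Sum>i<n. of_int (a i) * x ^ i)" using *[OF assms(1)] by blast
  obtain m b where m: "m > 0" "y ^ m = (\<Sum>i<m. of_int (b i) * y ^ i)" using *[OF assms(2)] by blast
  define I where "I = {..<n} \<times> {..<m}"
  define f where "f = (\<lambda>(i, j). x ^ i * y ^ j)"
  have fin: "finite I" by (simp add: I_def)
  have base: "f i \<in> int_span f I" if "i \<in> I" for i using int_span_base[OF fin that] .
  show ?thesis
  proof (rule that[of I f])
    show "finite I" by (rule fin)
    show "(0, 0) \<in> I" using n m by (simp add: I_def)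
    show "f (0, 0) \<noteq> 0" by (simp add: f_def)
    fix i assume i: "i \<in> I"
    obtain k l where kl: "i = (k, l)" "k < n" "l < m" using i by (auto simp: I_def)
    show "x * f i \<in> int_span f I"
    proof (cases "Suc k < n")
      case True
      hence "x * f i = f (Suc k, l)" by (simp add: f_def kl)
      thus ?thesis using base[of "(Suc k, l)"] True kl by (simp add: I_def)
    next
      case False
      hence "Suc k = n" using kl by simp
      hence "x * f i = x ^ n * y ^ l" by (auto simp: f_def kl)
      also have "\<dots> = (\<Sum>j<n. of_int (a j) * f (j, l))"
        by (simp add: n(2) f_def sum_distrib_left sum_distrib_right mult_ac)
      finally show ?thesis
        by (simp only:) (intro int_span_sum int_span_scale base, use kl in \<open>auto simp: I_def\<close>)
    qed
    show "y * f i \<in> int_span f I"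
    proof (cases "Suc l < m")
      case True
      hence "y * f i = f (k, Suc l)" by (simp add: f_def kl)
      thus ?thesis using base[of "(k, Suc l)"] True kl by (simp add: I_def)
    next
      case False
      hence "Suc l = m" using kl by simp
      hence "y * f i = x ^ k * y ^ m" by (auto simp: f_def kl)
      also have "\<dots> = (\<Sum>j<m. of_int (b j) * f (k, j))"
        by (simp add: m(2) f_def sum_distrib_left mult_ac)
      finally show ?thesis
        by (simp only:) (intro int_span_sum int_span_scale base, use kl in \<open>auto simp: I_def\<close>)
    qed
  qed
qed

lemma algebraic_int_add_complex:
  fixes x y :: complex
  assumes "algebraic_int x" "algebraic_int y"
  shows "algebraic_int (x + y)"
proof -
  obtain I :: "(nat \<times> nat) set" and f where If: "finite I" "(0, 0) \<in> I" "f (0, 0) \<noteq> 0"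
    "\<And>i. i \<in> I \<Longrightarrow> x * f i \<in> int_span f I" "\<And>i. i \<in> I \<Longrightarrow> y * f i \<in> int_span f I"
    using algebraic_int_stable_family[OF assms] by blast
  show ?thesis
    by (rule algebraic_int_if_stable_span[of I "(0, 0)" f, OF If(1,2,3)])
       (auto simp: distrib_right intro!: int_span_add If)
qed

lemma algebraic_int_mult_complex:
  fixes x y :: complex
  assumes "algebraic_int x" "algebraic_int y"
  shows "algebraic_int (x * y)"
proof -
  obtain I :: "(nat \<times> nat) set" and f where If: "finite I" "(0, 0) \<in> I" "f (0, 0) \<noteq> 0"
    "\<And>i. i \<in> I \<Longrightarrow> x * f i \<in> int_span f I" "\<And>i. i \<in> I \<Longrightarrow> y * f i \<in> int_span f I"
    using algebraic_int_stable_family[OF assms] by blast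
  show ?thesis
  proof (rule algebraic_int_if_stable_span[of I "(0, 0)" f, OF If(1,2,3)])
    fix i assume i: "i \<in> I"
    obtain c where "y * f i = (\<Sum>j\<in>I. of_int (c j) * f j)"
      using If(5)[OF i] unfolding int_span_def by blast
    hence "x * y * f i = (\<Sum>j\<in>I. of_int (c j) * (x * f j))"
      by (simp add: mult.assoc sum_distrib_left mult.left_commute)
    also have "\<dots> \<in> int_span f I" by (intro int_span_sum int_span_scale If)
    finally show "x * y * f i \<in> int_span f I" .
  qed
qed

lemma algebraic_int_power_complex:
  "algebraic_int (x :: complex) \<Longrightarrow> algebraic_int (x ^ n)"
  by (induction n) (auto intro: algebraic_int_mult_complex)

lemma algebraic_int_diff_complex:
  "algebraic_int (x :: complex) \<Longrightarrow> algebraic_int y \<Longrightarrow> algebraic_int (x - y)"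
  using algebraic_int_add_complex[of x "- y"] by simp

lemma algebraic_int_sum_complex:
  "(\<And>i. i \<in> A \<Longrightarrow> algebraic_int (f i :: complex)) \<Longrightarrow> algebraic_int (\<Sum>i\<in>A. f i)"
  by (induction A rule: infinite_finite_induct) (auto intro: algebraic_int_add_complex)

lemma algebraic_int_prod_complex:
  "(\<And>i. i \<in> A \<Longrightarrow> algebraic_int (f i :: complex)) \<Longrightarrow> algebraic_int (\<Prod>i\<in>A. f i)"
  by (induction A rule: infinite_finite_induct) (auto intro: algebraic_int_mult_complex)

lemma algebraic_int_if_power:
  assumes "algebraic_int (x ^ n :: complex)" "n > 0"
  shows "algebraic_int x"
  by (rule algebraic_int_root[OF assms(1), of "Polynomial.monom 1 n"])
     (use assms(2) in \<open>auto simp: poly_monom degree_monom_eq\<close>)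

section \<open>Cyclotomic fields of prime conductor\<close>

text \<open>Field elements are represented by rational polynomials, so that conjugating an element
  means evaluating the same polynomial at another root.\<close>

definition ev :: "rat poly \<Rightarrow> complex \<Rightarrow> complex" where
  "ev f z = poly (map_poly of_rat f) z"

interpretation rat_poly: map_poly_comm_ring_hom "of_rat :: rat \<Rightarrow> complex" ..

lemma ev_add: "ev (f + g) z = ev f z + ev g z"
  and ev_mult: "ev (f * g) z = ev f z * ev g z"
  and ev_minus: "ev (- f) z = - ev f z"
  and ev_const: "ev [:a:] z = of_rat a"
  and ev_0: "ev 0 z = 0"
  and ev_1: "ev 1 z = 1"
  and ev_X: "ev [:0, 1:] z = z"
  by (simp_all add: ev_def map_poly_pCons of_rat_hom.map_poly_pCons_hom rat_poly.hom_add rat_poly.hom_mult rat_poly.hom_uminus)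

lemma ev_sum: "ev (\<Sum>i\<in>A. f i) z = (\<Sum>i\<in>A. ev (f i) z)"
  by (induction A rule: infinite_finite_induct) (simp_all add: ev_0 ev_add)

lemma ev_prod: "ev (\<Prod>i\<in>A. f i) z = (\<Prod>i\<in>A. ev (f i) z)"
  by (induction A rule: infinite_finite_induct) (simp_all add: ev_1 ev_mult)

lemma ev_monom: "ev (Polynomial.monom a n) z = of_rat a * z ^ n"
  by (simp add: ev_def poly_monom)

lemma ev_pcompose: "ev (pcompose f g) z = ev f (ev g z)"
  by (simp add: ev_def of_rat_hom.map_poly_pcompose poly_pcompose)

lemma ev_altdef:
  assumes "degree f < n"
  shows "ev f z = (\<Sum>i<n. of_rat (coeff f i) * z ^ i)"
proof -
  have "f = (\<Sum>i<n. Polynomial.monom (coeff f i) i)"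
    using assms by (intro poly_eqI) (auto simp: coeff_sum coeff_eq_0)
  hence "ev f z = ev (\<Sum>i<n. Polynomial.monom (coeff f i) i) z" by simp
  thus ?thesis by (simp add: ev_sum ev_monom)
qed

lemma cnj_ev: "cnj (ev f z) = ev f (cnj z)"
proof -
  have "cnj (of_rat r) = of_rat r" for r by (cases r) (simp add: of_rat_rat)
  thus ?thesis
    using ev_altdef[of f "Suc (degree f)" z] ev_altdef[of f "Suc (degree f)" "cnj z"] by simp
qed

lemma common_denominator:
  fixes a :: "'i \<Rightarrow> rat"
  assumes "finite I"
  obtains n :: int where "n > 0" "\<And>i. i \<in> I \<Longrightarrow> of_int n * a i \<in> \<int>"
proof -
  from assms have "\<exists>n :: int. n > 0 \<and> (\<forall>i\<in>I. of_int n * a i \<in> \<int>)"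
  proof (induction I)
    case empty
    show ?case by (rule exI[of _ 1]) simp
  next
    case (insert j I)
    then obtain n :: int where n: "n > 0" "\<And>i. i \<in> I \<Longrightarrow> of_int n * a i \<in> \<int>" by blast
    obtain u v :: int where uv: "v > 0" "a j = of_int u / of_int v"
      by (metis quotient_of_denom_pos quotient_of_div surj_pair)
    have "of_int (v * n) * a i \<in> \<int>" if "i \<in> insert j I" for i
    proof (cases "i = j")
      case True
      hence "of_int (v * n) * a i = of_int (n * u)" using uv by simp
      thus ?thesis by (metis Ints_of_int)
    next
      case False
      hence "of_int v * (of_int n * a i) \<in> \<int>"
        using Ints_mult[OF Ints_of_int n(2)[of i]] that by simp
      thus ?thesis by (simp add: mult.assoc)
    qed
    thus ?case using n(1) uv(1) by (intro exI[of _ "v * n"]) auto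
  qed
  thus ?thesis using that by blast
qed

section \<open>Powers of a root of unity of prime order and their linear independence\<close>

locale prime_cyclotomic =
  fixes p :: nat and \<zeta> :: complex
  assumes p: "prime p" "odd p" and prim: "primitive_root_of_unity p \<zeta>"
begin

lemma p3: "p \<ge> 3"
proof -
  have "p \<noteq> 2" using p by auto
  thus ?thesis using prime_ge_2_nat[OF p(1)] by auto
qed

lemma zeta_p: "\<zeta> ^ p = 1" using prim by (simp add: primitive_root_of_unity_def)

lemma zeta_nz: "\<zeta> \<noteq> 0" using zeta_p p3 by (auto simp: zero_power)

lemma zeta_mod: "\<zeta> ^ (k mod p) = \<zeta> ^ k"
proof -
  have "\<zeta> ^ k = \<zeta> ^ (p * (k div p) + k mod p)" by simp
  also have "\<dots> = \<zeta> ^ (k mod p)" by (simp only: power_add power_mult zeta_p power_one mult_1_left)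
  finally show ?thesis ..
qed

lemma zeta_eq_1_iff: "\<zeta> ^ k = 1 \<longleftrightarrow> p dvd k"
proof
  assume "\<zeta> ^ k = 1"
  hence "\<zeta> ^ (k mod p) = 1" by (simp add: zeta_mod)
  moreover have "k mod p < p" using p3 by simp
  moreover have "\<zeta> ^ j \<noteq> 1" if "0 < j" "j < p" for j
    using prim that by (simp add: primitive_root_of_unity_def)
  ultimately have "k mod p = 0" by (cases "k mod p = 0") auto
  thus "p dvd k" by (rule mod_0_imp_dvd)
next
  assume "p dvd k"
  thus "\<zeta> ^ k = 1" by (auto simp: power_mult zeta_p)
qed

lemma zeta_cong: "k mod p = l mod p \<Longrightarrow> \<zeta> ^ k = \<zeta> ^ l"
  by (metis zeta_mod)

lemma zeta_eq_iff: "\<zeta> ^ k = \<zeta> ^ l \<longleftrightarrow> k mod p = l mod p"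
proof
  show "k mod p = l mod p" if "\<zeta> ^ k = \<zeta> ^ l"
    using that
  proof (induction k l rule: linorder_wlog)
    case (le k l)
    have "\<zeta> ^ l = \<zeta> ^ k * \<zeta> ^ (l - k)" using le(1) by (simp add: power_add[symmetric])
    hence "\<zeta> ^ (l - k) = 1" using le(2) zeta_nz by simp
    hence "p dvd l - k" by (simp add: zeta_eq_1_iff)
    thus ?case using le by (metis mod_eq_iff_dvd_symdiff_nat mod_eq_dvd_iff_nat)
  next
    case (sym k l) thus ?case by simp
  qed
qed (rule zeta_cong)

lemma cnj_zeta: "cnj \<zeta> = \<zeta> ^ (p - 1)"
proof -
  have "norm \<zeta> ^ p = 1" using zeta_p by (metis norm_one norm_power)
  hence "norm \<zeta> = 1" using p3 power_eq_imp_eq_base[of "norm \<zeta>" p 1] by simp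
  hence "\<zeta> * cnj \<zeta> = 1" by (simp add: complex_norm_square[symmetric])
  moreover have "\<zeta> * \<zeta> ^ (p - 1) = 1" using p3 zeta_p by (metis power_eq_if not_numeral_le_zero)
  ultimately show ?thesis using zeta_nz by (metis mult_cancel_left)
qed

lemma sum_zeta: "(\<Sum>i<p. \<zeta> ^ (c * i)) = (if p dvd c then of_nat p else 0)"
proof (cases "p dvd c")
  case True
  hence "\<zeta> ^ (c * i) = 1" for i by (simp add: zeta_eq_1_iff)
  thus ?thesis using True by simp
next
  case False
  have "(\<zeta> ^ c) ^ p - 1 = (\<zeta> ^ c - 1) * (\<Sum>i<p. (\<zeta> ^ c) ^ i)" by (rule power_diff_1_eq)
  moreover have "(\<zeta> ^ c) ^ p = 1" by (simp add: power_mult[symmetric] zeta_eq_1_iff)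
  moreover have "\<zeta> ^ c \<noteq> 1" using False by (simp add: zeta_eq_1_iff)
  ultimately show ?thesis using False by (simp add: power_mult)
qed

text \<open>Used twice: at \<open>x = 1\<close> it gives the norm of \<open>1 - \<zeta>\<close>, and
  at the solution \<open>x\<close> the product of all \<open>xi c\<close>.\<close>

lemma prod_roots: "(\<Prod>c\<in>{1..<p}. x - \<zeta> ^ c) = (\<Sum>i<p. x ^ i)"
proof -
  define P :: "complex poly" where "P = [:0, 1:] ^ p - 1"
  have Pm: "P = Polynomial.monom 1 p - 1" by (simp add: P_def monom_altdef)
  have poly_P: "poly P z = z ^ p - 1" for z by (simp add: P_def)
  have dP: "degree P = p"
    unfolding Pm using p3 by (intro antisym degree_le le_degree) (auto simp: coeff_eq_0)
  have lP: "lead_coeff P = 1" unfolding dP using p3 by (simp add: Pm)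
  have "rsquarefree P"
  proof (unfold rsquarefree_roots, intro allI notI)
    fix a assume a: "poly P a = 0 \<and> poly (pderiv P) a = 0"
    have "pderiv P = Polynomial.monom (of_nat p) (p - 1)" by (simp add: Pm pderiv_diff pderiv_monom)
    with a have "of_nat p * a ^ (p - 1) = 0" by (simp add: poly_monom)
    hence "a = 0" using p3 by auto
    thus False using a p3 by (simp add: poly_P zero_power)
  qed
  from complex_poly_decompose_rsquarefree[OF this] lP
  have 1: "(\<Prod>z|poly P z = 0. [:-z, 1:]) = P" by simp
  have inj: "inj_on (\<lambda>c. \<zeta> ^ c) {..<p}" by (auto simp: inj_on_def zeta_eq_iff)
  have sub: "(\<lambda>c. \<zeta> ^ c) ` {..<p} \<subseteq> {z. poly P z = 0}"
    by (auto simp: poly_P power_mult[symmetric] zeta_eq_1_iff)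
  have "P \<noteq> 0" using dP p3 by auto
  hence fin: "finite {z. poly P z = 0}" and "card {z. poly P z = 0} \<le> p"
    using poly_roots_finite poly_roots_degree dP by auto
  hence "(\<lambda>c. \<zeta> ^ c) ` {..<p} = {z. poly P z = 0}"
    using sub fin by (intro card_seteq) (auto simp: card_image[OF inj])
  hence "P = (\<Prod>z\<in>(\<lambda>c. \<zeta> ^ c) ` {..<p}. [:-z, 1:])" using 1 by simp
  also have "\<dots> = (\<Prod>c\<in>{..<p}. [:-(\<zeta> ^ c), 1:])" by (simp add: prod.reindex[OF inj])
  also have "{..<p} = insert 0 {1..<p}" using p3 by auto
  also have "(\<Prod>c\<in>insert 0 {1..<p}. [:-(\<zeta> ^ c), 1:]) = [:-1, 1:] * (\<Prod>c\<in>{1..<p}. [:-(\<zeta> ^ c), 1:])"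
    by (subst prod.insert) auto
  finally have "P = [:-1, 1:] * (\<Prod>c\<in>{1..<p}. [:-(\<zeta> ^ c), 1:])" .
  moreover have "P = ([:0, 1:] - 1) * (\<Sum>i<p. [:0, 1:] ^ i)"
    unfolding P_def by (rule power_diff_1_eq)
  moreover have "[:0, 1:] - 1 = ([:-1, 1:] :: complex poly)" by (simp add: one_pCons)
  ultimately have "[:-1, 1:] * (\<Prod>c\<in>{1..<p}. [:-(\<zeta> ^ c), 1:]) = [:-1, 1:] * (\<Sum>i<p. [:0, 1:] ^ i)"
    by simp
  hence "(\<Prod>c\<in>{1..<p}. [:-(\<zeta> ^ c), 1:]) = (\<Sum>i<p. [:0, 1:] ^ i)"
    by (subst (asm) mult_cancel_left) simp
  hence "poly (\<Prod>c\<in>{1..<p}. [:-(\<zeta> ^ c), 1:]) x = poly (\<Sum>i<p. [:0, 1:] ^ i) x" by simp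
  thus ?thesis by (simp add: poly_prod poly_sum)
qed

lemma algebraic_int_zeta: "algebraic_int \<zeta>"
  by (rule algebraic_int_if_power[of _ p]) (use p3 in \<open>simp_all add: zeta_p\<close>)

lemma algebraic_int_zeta_power: "algebraic_int (\<zeta> ^ k)"
  by (intro algebraic_int_power_complex algebraic_int_zeta)

text \<open>Both quotients are geometric sums. For the second one take \<open>d\<close> inverse to
  \<open>c\<close> modulo \<open>p\<close>; then \<open>\<zeta>\<close> is the \<open>d\<close>-th
  power of \<open>\<zeta> ^ c\<close>.\<close>

lemma cyclotomic_unit:
  assumes "\<not> p dvd c"
  shows "algebraic_int ((1 - \<zeta> ^ c) / (1 - \<zeta>))" "algebraic_int ((1 - \<zeta>) / (1 - \<zeta> ^ c))"
proof -
  have z1: "1 - \<zeta> \<noteq> 0" using zeta_eq_1_iff[of 1] p3 by auto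
  have zc: "1 - \<zeta> ^ c \<noteq> 0" using zeta_eq_1_iff[of c] assms by auto
  have "(1 - \<zeta> ^ c) = (1 - \<zeta>) * (\<Sum>i<c. \<zeta> ^ i)" by (rule one_diff_power_eq)
  hence "(1 - \<zeta> ^ c) / (1 - \<zeta>) = (\<Sum>i<c. \<zeta> ^ i)" using z1 by simp
  thus "algebraic_int ((1 - \<zeta> ^ c) / (1 - \<zeta>))"
    by (simp add: algebraic_int_sum_complex algebraic_int_zeta_power)
  have "coprime c p" using assms p(1) by (metis coprime_commute prime_imp_coprime)
  then obtain d where "[c * d = Suc 0] (mod p)" using cong_solve_coprime_nat by blast
  hence "(c * d) mod p = 1 mod p" by (simp add: unique_euclidean_semiring_class.cong_def)
  hence "\<zeta> ^ (c * d) = \<zeta> ^ 1" by (rule zeta_cong)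
  hence "1 - \<zeta> = 1 - (\<zeta> ^ c) ^ d" by (simp add: power_mult)
  also have "\<dots> = (1 - \<zeta> ^ c) * (\<Sum>i<d. (\<zeta> ^ c) ^ i)" by (rule one_diff_power_eq)
  finally have "(1 - \<zeta>) / (1 - \<zeta> ^ c) = (\<Sum>i<d. (\<zeta> ^ c) ^ i)" using zc by simp
  thus "algebraic_int ((1 - \<zeta>) / (1 - \<zeta> ^ c))"
    by (simp add: algebraic_int_sum_complex algebraic_int_zeta_power power_mult[symmetric])
qed

lemma prod_one_minus_zeta: "(\<Prod>c\<in>{1..<p}. 1 - \<zeta> ^ c) = of_nat p"
  using prod_roots[of 1] by simp

text \<open>The equality of ideals \<open>(p) = (1 - \<zeta>) ^ (p - 1)\<close>, expressed by
  integrality of both quotients: \<open>p\<close> is the product of the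
  \<open>1 - \<zeta> ^ c\<close>, and each of these is associated to
  \<open>1 - \<zeta>\<close>.\<close>

lemma ramification:
  "algebraic_int (of_nat p / (1 - \<zeta>) ^ (p - 1))" "algebraic_int ((1 - \<zeta>) ^ (p - 1) / of_nat p)"
proof -
  have nd: "\<not> p dvd c" if "c \<in> {1..<p}" for c using that by (auto dest: dvd_imp_le)
  have "of_nat p / (1 - \<zeta>) ^ (p - 1) = (\<Prod>c\<in>{1..<p}. (1 - \<zeta> ^ c) / (1 - \<zeta>))"
    unfolding prod_dividef prod_one_minus_zeta by simp
  also have "algebraic_int \<dots>" using nd by (intro algebraic_int_prod_complex cyclotomic_unit) auto
  finally show "algebraic_int (of_nat p / (1 - \<zeta>) ^ (p - 1))" .
  have "(1 - \<zeta>) ^ (p - 1) / of_nat p = (\<Prod>c\<in>{1..<p}. (1 - \<zeta>) / (1 - \<zeta> ^ c))"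
    unfolding prod_dividef prod_one_minus_zeta by simp
  also have "algebraic_int \<dots>" using nd by (intro algebraic_int_prod_complex cyclotomic_unit) auto
  finally show "algebraic_int ((1 - \<zeta>) ^ (p - 1) / of_nat p)" .
qed

lemma int_dvd_if_algebraic_int:
  assumes "algebraic_int (of_int a / of_int b :: complex)" "b \<noteq> 0"
  shows "b dvd a"
proof -
  have "of_int a / of_int b \<in> (\<rat> :: complex set)" by (intro Rats_divide Rats_of_int)
  with assms(1) have "of_int a / of_int b \<in> (\<int> :: complex set)" by (intro rational_algebraic_int_is_int)
  then obtain k where "of_int a / of_int b = (of_int k :: complex)" by (auto elim: Ints_cases)
  hence "of_int a = (of_int (b * k) :: complex)" using assms(2) by (simp add: field_simps)
  hence "a = b * k" by (simp only: of_int_eq_iff)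
  thus ?thesis by simp
qed

text \<open>Comparing the lowest term prime to \<open>p\<close>: the element \<open>1 - \<zeta>\<close> is totally ramified over \<open>p\<close>.\<close>

lemma relation_imp_dvd:
  fixes a :: "nat \<Rightarrow> int"
  assumes "(\<Sum>i<p - 1. of_int (a i) * (1 - \<zeta>) ^ i) = 0" "k < p - 1"
  shows "int p dvd a k"
  using assms(2)
proof (induction k rule: less_induct)
  case (less k)
  define \<pi> where "\<pi> = 1 - \<zeta>"
  have pi0: "\<pi> \<noteq> 0" using zeta_eq_1_iff[of 1] p3 by (auto simp: \<pi>_def)
  have A\<pi>: "algebraic_int (\<pi> ^ j)" for j unfolding \<pi>_def
    by (intro algebraic_int_power_complex algebraic_int_diff_complex algebraic_int_zeta) auto
  have t: "algebraic_int (of_int (a i) * \<pi> ^ i / \<pi> ^ Suc k)" if i: "i < p - 1" "i \<noteq> k" for i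
  proof (cases "i < k")
    case True
    hence "int p dvd a i" using less i by auto
    then obtain b where b: "a i = int p * b" by blast
    have "p - 1 = Suc k + (p - 2 - k)" using less.prems p3 by simp
    hence "\<pi> ^ (p - 1) = \<pi> ^ Suc k * \<pi> ^ (p - 2 - k)" by (metis power_add)
    hence "of_int (a i) * \<pi> ^ i / \<pi> ^ Suc k =
        (of_nat p / \<pi> ^ (p - 1)) * (of_int b * \<pi> ^ i * \<pi> ^ (p - 2 - k))"
      using pi0 by (simp add: b)
    also have "algebraic_int \<dots>"
      using ramification(1) unfolding \<pi>_def[symmetric]
      by (intro algebraic_int_mult_complex A\<pi>) auto
    finally show ?thesis .
  next
    case False
    hence "i = Suc k + (i - Suc k)" using i by simp
    hence "\<pi> ^ i = \<pi> ^ Suc k * \<pi> ^ (i - Suc k)" by (metis power_add)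
    hence "of_int (a i) * \<pi> ^ i / \<pi> ^ Suc k = of_int (a i) * \<pi> ^ (i - Suc k)"
      using pi0 by simp
    also have "algebraic_int \<dots>" by (intro algebraic_int_mult_complex A\<pi>) auto
    finally show ?thesis .
  qed
  have "(\<Sum>i<p - 1. of_int (a i) * \<pi> ^ i / \<pi> ^ Suc k) = 0"
    using assms(1) by (simp add: sum_divide_distrib[symmetric] \<pi>_def)
  also have "(\<Sum>i<p - 1. of_int (a i) * \<pi> ^ i / \<pi> ^ Suc k) =
      of_int (a k) * \<pi> ^ k / \<pi> ^ Suc k + (\<Sum>i\<in>{..<p - 1} - {k}. of_int (a i) * \<pi> ^ i / \<pi> ^ Suc k)"
    using less.prems by (intro sum.remove) auto
  also have "of_int (a k) * \<pi> ^ k / \<pi> ^ Suc k = of_int (a k) / \<pi>" using pi0 by simp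
  finally have "of_int (a k) / \<pi> = - (\<Sum>i\<in>{..<p - 1} - {k}. of_int (a i) * \<pi> ^ i / \<pi> ^ Suc k)"
    by (simp add: add_eq_0_iff)
  also have "algebraic_int \<dots>"
    unfolding algebraic_int_minus_iff by (intro algebraic_int_sum_complex t) auto
  finally have "algebraic_int (of_int (a k) / \<pi>)" .
  \<comment> \<open>Trading \<open>\<pi> ^ (p - 1)\<close> for \<open>p\<close> turns the integral
    quotient \<open>a k / \<pi>\<close> into the rational number \<open>a k ^ (p - 1) / p\<close>,
    which must then be an integer.\<close>
  hence "algebraic_int ((of_int (a k) / \<pi>) ^ (p - 1) * (\<pi> ^ (p - 1) / of_nat p))"
    using ramification(2) unfolding \<pi>_def[symmetric]
    by (intro algebraic_int_mult_complex algebraic_int_power_complex)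
  also have "(of_int (a k) / \<pi>) ^ (p - 1) * (\<pi> ^ (p - 1) / of_nat p) = of_int (a k ^ (p - 1)) / of_int (int p)"
    using pi0 by (simp add: power_divide)
  finally have "int p dvd a k ^ (p - 1)" using p3 by (intro int_dvd_if_algebraic_int) auto
  moreover have "prime (int p)" using p by simp
  ultimately show ?case using prime_dvd_power by blast
qed

text \<open>Descent: dividing a relation by \<open>p\<close> yields another one, so every power of
  \<open>p\<close> divides each coefficient. Total ramification thus takes the place of Eisenstein's
  criterion in fixing the degree \<open>p - 1\<close>.\<close>

lemma int_independent:
  fixes a :: "nat \<Rightarrow> int"
  assumes "(\<Sum>i<p - 1. of_int (a i) * (1 - \<zeta>) ^ i) = 0" "k < p - 1"
  shows "a k = 0"
proof -
  have "\<forall>k<p - 1. int p ^ n dvd a k" for n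
  proof (induction n)
    case 0 show ?case by simp
  next
    case (Suc n)
    define b where "b = (\<lambda>k. a k div int p ^ n)"
    have ab: "a k = int p ^ n * b k" if "k < p - 1" for k using Suc that by (simp add: b_def)
    have "of_nat p ^ n * (\<Sum>i<p - 1. of_int (b i) * (1 - \<zeta>) ^ i) = (\<Sum>i<p - 1. of_int (a i) * (1 - \<zeta>) ^ i)"
      unfolding sum_distrib_left by (intro sum.cong) (auto simp: ab)
    hence "(\<Sum>i<p - 1. of_int (b i) * (1 - \<zeta>) ^ i) = 0" using assms(1) p3 by simp
    hence "int p dvd b k" if "k < p - 1" for k using relation_imp_dvd[of b k] that by simp
    thus ?case using ab by (simp add: mult_dvd_mono mult.commute)
  qed
  hence d: "int p ^ n dvd a k" for n using assms(2) by blast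
  show ?thesis
  proof (rule ccontr)
    assume "a k \<noteq> 0"
    hence "\<bar>int p ^ nat \<bar>a k\<bar>\<bar> \<le> \<bar>a k\<bar>" using d by (intro dvd_imp_le_int) auto
    moreover have "int (nat \<bar>a k\<bar>) < int (p ^ nat \<bar>a k\<bar>)"
      using p3 by (simp only: of_nat_less_iff) (intro power_gt_expt, simp)
    ultimately show False by simp
  qed
qed

text \<open>The substitution of \<open>1 - X\<close> for \<open>X\<close> passes to powers of
  \<open>1 - \<zeta>\<close>; after clearing denominators \<open>int_independent\<close>
  applies.\<close>

lemma rat_poly_independent:
  assumes "ev f \<zeta> = 0" "degree f < p - 1"
  shows "f = 0"
proof -
  define g where "g = pcompose f [:1, -1:]"
  have "degree g = degree f" unfolding g_def by (simp add: degree_pcompose)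
  hence dg: "degree g < p - 1" using assms(2) by simp
  have "ev [:1, -1:] (1 - \<zeta>) = \<zeta>" by (simp add: ev_def map_poly_pCons)
  hence "ev g (1 - \<zeta>) = 0" using assms(1) by (simp add: g_def ev_pcompose)
  hence s: "(\<Sum>i<p - 1. of_rat (coeff g i) * (1 - \<zeta>) ^ i) = 0" using ev_altdef[OF dg] by simp
  obtain n :: int where n: "n > 0" "\<And>i. i \<in> {..<p - 1} \<Longrightarrow> of_int n * coeff g i \<in> \<int>"
    using common_denominator[of "{..<p - 1}" "coeff g"] by auto
  define a where "a = (\<lambda>i. \<lfloor>of_int n * coeff g i\<rfloor>)"
  have a: "of_int (a i) = of_int n * coeff g i" if "i < p - 1" for i
    using n(2)[of i] that by (simp add: a_def)
  have a': "of_int (a i) = of_int n * (of_rat (coeff g i) :: complex)" if "i < p - 1" for i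
    using a[OF that] by (metis of_rat_mult of_rat_of_int_eq)
  have "(\<Sum>i<p - 1. of_int (a i) * (1 - \<zeta>) ^ i) = of_int n * (\<Sum>i<p - 1. of_rat (coeff g i) * (1 - \<zeta>) ^ i)"
    unfolding sum_distrib_left by (intro sum.cong) (auto simp: a')
  hence "(\<Sum>i<p - 1. of_int (a i) * (1 - \<zeta>) ^ i) = 0" using s by simp
  hence "a i = 0" if "i < p - 1" for i using int_independent that by blast
  hence "coeff g i = 0" if "i < p - 1" for i using a[OF that] n(1) that by simp
  hence "g = 0" using dg by (metis leading_coeff_0_iff)
  thus ?thesis unfolding g_def by (simp add: pcompose_eq_0)
qed

text \<open>The remainder of \<open>f\<close> modulo \<open>\<Phi>\<close> vanishes by independence,
  so \<open>\<Phi>\<close> divides \<open>f\<close>, and \<open>\<Phi>\<close> vanishes at every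
  nontrivial power of \<open>\<zeta>\<close>. This is what makes the conjugations well
  defined.\<close>

lemma ev_conjugate_zero:
  assumes "ev f \<zeta> = 0" "\<not> p dvd c"
  shows "ev f (\<zeta> ^ c) = 0"
proof -
  define \<Phi> :: "rat poly" where "\<Phi> = (\<Sum>i<p. Polynomial.monom 1 i)"
  have ev\<Phi>: "ev \<Phi> (\<zeta> ^ c) = 0" if "\<not> p dvd c" for c
    using sum_zeta[of c] that by (simp add: \<Phi>_def ev_sum ev_monom power_mult)
  have c\<Phi>: "coeff \<Phi> i = (if i < p then 1 else 0)" for i by (simp add: \<Phi>_def coeff_sum)
  have d\<Phi>: "degree \<Phi> = p - 1"
    using p3 by (intro antisym degree_le le_degree) (auto simp: c\<Phi>)
  have \<Phi>0: "\<Phi> \<noteq> 0" using d\<Phi> p3 by auto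
  have fd: "f = (f div \<Phi>) * \<Phi> + f mod \<Phi>" by simp
  have "ev f \<zeta> = ev (f div \<Phi>) \<zeta> * ev \<Phi> \<zeta> + ev (f mod \<Phi>) \<zeta>"
    by (subst fd) (simp only: ev_add ev_mult)
  moreover have "ev \<Phi> \<zeta> = 0" using ev\<Phi>[of 1] p3 by simp
  ultimately have "ev (f mod \<Phi>) \<zeta> = 0" using assms(1) by simp
  moreover have "degree (f mod \<Phi>) < p - 1"
    using degree_mod_less'[of \<Phi> f] \<Phi>0 d\<Phi> p3 by (cases "f mod \<Phi> = 0") auto
  ultimately have "f mod \<Phi> = 0" by (rule rat_poly_independent)
  hence "ev f (\<zeta> ^ c) = ev (f div \<Phi>) (\<zeta> ^ c) * ev \<Phi> (\<zeta> ^ c)"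
    by (subst fd) (simp only: ev_add ev_mult ev_0 add_0_right)
  thus ?thesis using ev\<Phi>[OF assms(2)] by simp
qed

end

section \<open>Subfields of the complex numbers generated by one element\<close>

lemma complex_ring_simps [simp]:
  "carrier complex_ring = UNIV" "\<one>\<^bsub>complex_ring\<^esub> = 1" "\<zero>\<^bsub>complex_ring\<^esub> = 0"
  "x \<oplus>\<^bsub>complex_ring\<^esub> y = x + y" "x \<otimes>\<^bsub>complex_ring\<^esub> y = x * y"
  by (simp_all add: ring_of_type_algebra_def)

lemma complex_ring_field: "field complex_ring"
  by (rule field_from_type_algebra)

lemma complex_ring_a_inv [simp]: "\<ominus>\<^bsub>complex_ring\<^esub> x = - x"
proof -
  interpret field complex_ring by (rule complex_ring_field)
  show ?thesis by (rule minus_equality) simp_all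
qed

lemma complex_ring_m_inv: "x \<noteq> 0 \<Longrightarrow> inv\<^bsub>complex_ring\<^esub> x = inverse x"
proof -
  interpret field complex_ring by (rule complex_ring_field)
  assume "x \<noteq> 0"
  thus ?thesis by (intro inv_char) simp_all
qed

lemma
  shows rat_adjoin_1: "1 \<in> rat_adjoin z"
    and rat_adjoin_gen: "z \<in> rat_adjoin z"
    and rat_adjoin_minus: "x \<in> rat_adjoin z \<Longrightarrow> - x \<in> rat_adjoin z"
    and rat_adjoin_inverse: "x \<in> rat_adjoin z \<Longrightarrow> inverse x \<in> rat_adjoin z"
    and rat_adjoin_add: "x \<in> rat_adjoin z \<Longrightarrow> y \<in> rat_adjoin z \<Longrightarrow> x + y \<in> rat_adjoin z"
    and rat_adjoin_mult: "x \<in> rat_adjoin z \<Longrightarrow> y \<in> rat_adjoin z \<Longrightarrow> x * y \<in> rat_adjoin z"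
proof -
  show "1 \<in> rat_adjoin z" using generate_field.one[of complex_ring "{z}"] by (simp add: rat_adjoin_def)
  show "z \<in> rat_adjoin z" using generate_field.incl[of z "{z}" complex_ring] by (simp add: rat_adjoin_def)
  show "- x \<in> rat_adjoin z" if "x \<in> rat_adjoin z"
    using generate_field.a_inv[of x complex_ring "{z}"] that by (simp add: rat_adjoin_def)
  show "inverse x \<in> rat_adjoin z" if "x \<in> rat_adjoin z"
    using generate_field.m_inv[of x complex_ring "{z}"] that
    by (cases "x = 0") (simp_all add: rat_adjoin_def complex_ring_m_inv)
  show "x + y \<in> rat_adjoin z" if "x \<in> rat_adjoin z" "y \<in> rat_adjoin z"
    using generate_field.eng_add[of x complex_ring "{z}" y] that by (simp add: rat_adjoin_def)
  show "x * y \<in> rat_adjoin z" if "x \<in> rat_adjoin z" "y \<in> rat_adjoin z"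
    using generate_field.eng_mult[of x complex_ring "{z}" y] that by (simp add: rat_adjoin_def)
qed

lemma rat_adjoin_0: "0 \<in> rat_adjoin z"
  using rat_adjoin_add[OF rat_adjoin_1 rat_adjoin_minus[OF rat_adjoin_1]] by simp

lemma rat_adjoin_of_nat: "of_nat n \<in> rat_adjoin z"
  by (induction n) (auto intro: rat_adjoin_0 rat_adjoin_1 rat_adjoin_add)

lemma rat_adjoin_of_int: "of_int n \<in> rat_adjoin z"
  by (cases n) (auto intro: rat_adjoin_of_nat rat_adjoin_minus simp del: of_nat_Suc)

lemma rat_adjoin_of_rat: "of_rat r \<in> rat_adjoin z"
  by (cases r) (auto simp: of_rat_rat divide_inverse intro!: rat_adjoin_mult rat_adjoin_inverse rat_adjoin_of_int)

lemma rat_adjoin_power: "x \<in> rat_adjoin z \<Longrightarrow> x ^ n \<in> rat_adjoin z"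
  by (induction n) (auto intro: rat_adjoin_1 rat_adjoin_mult)

lemma rat_adjoin_sum: "(\<And>i. i \<in> A \<Longrightarrow> f i \<in> rat_adjoin z) \<Longrightarrow> (\<Sum>i\<in>A. f i) \<in> rat_adjoin z"
  by (induction A rule: infinite_finite_induct) (auto intro: rat_adjoin_0 rat_adjoin_add)

lemma rat_adjoin_diff: "x \<in> rat_adjoin z \<Longrightarrow> y \<in> rat_adjoin z \<Longrightarrow> x - y \<in> rat_adjoin z"
  using rat_adjoin_add[of x z "- y"] rat_adjoin_minus[of y z] by simp

lemma rat_adjoin_divide: "x \<in> rat_adjoin z \<Longrightarrow> y \<in> rat_adjoin z \<Longrightarrow> x / y \<in> rat_adjoin z"
  by (simp add: divide_inverse rat_adjoin_mult rat_adjoin_inverse)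

lemma rat_adjoin_induct [consumes 1, case_names one gen minus inverse add mult]:
  assumes "x \<in> rat_adjoin z" "P 1" "P z"
    "\<And>x. x \<in> rat_adjoin z \<Longrightarrow> P x \<Longrightarrow> P (- x)"
    "\<And>x. x \<in> rat_adjoin z \<Longrightarrow> x \<noteq> 0 \<Longrightarrow> P x \<Longrightarrow> P (inverse x)"
    "\<And>x y. x \<in> rat_adjoin z \<Longrightarrow> y \<in> rat_adjoin z \<Longrightarrow> P x \<Longrightarrow> P y \<Longrightarrow> P (x + y)"
    "\<And>x y. x \<in> rat_adjoin z \<Longrightarrow> y \<in> rat_adjoin z \<Longrightarrow> P x \<Longrightarrow> P y \<Longrightarrow> P (x * y)"
  shows "P x"
  using assms(1) unfolding rat_adjoin_def
proof (induction rule: generate_field.induct)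
  case (m_inv h)
  thus ?case using assms(5)[of h] by (simp add: rat_adjoin_def complex_ring_m_inv)
qed (use assms in \<open>auto simp: rat_adjoin_def\<close>)

section \<open>Galois action, trace and norm\<close>

context prime_cyclotomic
begin

text \<open>Representatives of the units modulo \<open>p\<close>, hence indices of the Galois
  group.\<close>

definition G :: "nat set" where "G = {1..<p}"

lemma finite_G: "finite G" by (simp add: G_def)

lemma G_not_dvd: "c \<in> G \<Longrightarrow> \<not> p dvd c" by (auto simp: G_def dest: dvd_imp_le)

lemma G_one: "1 \<in> G" using p3 by (simp add: G_def)

lemma mult_not_dvd: "\<not> p dvd c \<Longrightarrow> \<not> p dvd d \<Longrightarrow> \<not> p dvd c * d"
  using p(1) prime_dvd_mult_iff by blast

lemma bij_mult_G:
  assumes "\<not> p dvd d"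
  shows "bij_betw (\<lambda>c. (c * d) mod p) G G"
proof -
  have cop: "coprime d p" using assms p(1) by (metis coprime_commute prime_imp_coprime)
  have inj: "inj_on (\<lambda>c. (c * d) mod p) G"
  proof (rule inj_onI)
    fix c e assume ce: "c \<in> G" "e \<in> G" "(c * d) mod p = (e * d) mod p"
    hence "[c * d = e * d] (mod p)" by (simp add: unique_euclidean_semiring_class.cong_def)
    hence "[c = e] (mod p)" using cop by (simp add: cong_mult_rcancel_nat)
    thus "c = e" using ce(1,2) by (simp add: G_def unique_euclidean_semiring_class.cong_def)
  qed
  have "(\<lambda>c. (c * d) mod p) ` G \<subseteq> G"
  proof
    fix x assume "x \<in> (\<lambda>c. (c * d) mod p) ` G"
    then obtain c where c: "c \<in> G" "x = (c * d) mod p" by auto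
    hence "\<not> p dvd c * d" using mult_not_dvd G_not_dvd assms by blast
    hence "x \<noteq> 0" using c(2) by (metis mod_0_imp_dvd)
    thus "x \<in> G" using c p3 by (simp add: G_def)
  qed
  hence "(\<lambda>c. (c * d) mod p) ` G = G"
    using finite_G inj by (intro endo_inj_surj) auto
  thus ?thesis using inj by (simp add: bij_betw_def)
qed

lemma sum_zeta_G_rat: "(\<Sum>c\<in>G. \<zeta> ^ (c * i)) \<in> \<rat>"
proof -
  have "{..<p} = insert 0 G" using p3 by (auto simp: G_def)
  hence "(\<Sum>c<p. \<zeta> ^ (i * c)) = 1 + (\<Sum>c\<in>G. \<zeta> ^ (c * i))"
    by (simp add: finite_G G_def mult.commute)
  moreover have "(\<Sum>c<p. \<zeta> ^ (i * c)) \<in> \<rat>" by (simp add: sum_zeta)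
  ultimately have "1 + (\<Sum>c\<in>G. \<zeta> ^ (c * i)) \<in> \<rat>" by simp
  hence "(1 + (\<Sum>c\<in>G. \<zeta> ^ (c * i))) - 1 \<in> \<rat>" by (intro Rats_diff) auto
  thus ?thesis by simp
qed

lemma trace_ev_rat: "(\<Sum>c\<in>G. ev f (\<zeta> ^ c)) \<in> \<rat>"
proof -
  define n where "n = Suc (degree f)"
  have "(\<Sum>c\<in>G. ev f (\<zeta> ^ c)) = (\<Sum>c\<in>G. \<Sum>i<n. of_rat (coeff f i) * \<zeta> ^ (c * i))"
    by (intro sum.cong refl) (simp add: ev_altdef[of f n] n_def power_mult)
  also have "\<dots> = (\<Sum>i<n. of_rat (coeff f i) * (\<Sum>c\<in>G. \<zeta> ^ (c * i)))"
    by (subst sum.swap) (simp add: sum_distrib_left)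
  also have "\<dots> \<in> \<rat>" by (intro Rats_sum Rats_mult sum_zeta_G_rat) auto
  finally show ?thesis .
qed

text \<open>A value fixed by all conjugations equals its average over them, and the sum of all
  conjugates is rational.\<close>

lemma ev_rational_if_fixed:
  assumes "\<And>c. c \<in> G \<Longrightarrow> ev f (\<zeta> ^ c) = ev f \<zeta>"
  shows "ev f \<zeta> \<in> \<rat>"
proof -
  have "(\<Sum>c\<in>G. ev f (\<zeta> ^ c)) = of_nat (card G) * ev f \<zeta>" using assms by simp
  moreover have "card G \<noteq> 0" using p3 by (simp add: G_def)
  ultimately have "ev f \<zeta> = (\<Sum>c\<in>G. ev f (\<zeta> ^ c)) / of_nat (card G)" by simp
  also have "\<dots> \<in> \<rat>" by (intro Rats_divide trace_ev_rat) auto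
  finally show ?thesis .
qed

lemma prod_shift_G:
  assumes "\<not> p dvd d"
  shows "(\<Prod>c\<in>G. g (\<zeta> ^ (c * d))) = (\<Prod>c\<in>G. g (\<zeta> ^ c))"
proof -
  have "(\<Prod>c\<in>G. g (\<zeta> ^ (c * d))) = (\<Prod>c\<in>G. g (\<zeta> ^ ((c * d) mod p)))" by (simp add: zeta_mod)
  also have "\<dots> = (\<Prod>c\<in>G. g (\<zeta> ^ c))"
    by (rule prod.reindex_bij_betw[OF bij_mult_G[OF assms]])
  finally show ?thesis .
qed

lemma ev_diff: "ev (f - g) z = ev f z - ev g z"
  using ev_add[of f "- g"] by (simp add: ev_minus)

lemma ev_smult: "ev (Polynomial.smult a f) z = of_rat a * ev f z"
  using ev_mult[of "[:a:]" f] by (simp add: ev_const)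

lemma ev_zeta_power: "ev (pcompose f (Polynomial.monom 1 c)) z = ev f (z ^ c)"
  by (simp add: ev_pcompose ev_monom)

lemma norm_ev_rat: "(\<Prod>c\<in>G. ev f (\<zeta> ^ c)) \<in> \<rat>"
proof -
  define g where "g = (\<Prod>c\<in>G. pcompose f (Polynomial.monom 1 c))"
  have g: "ev g z = (\<Prod>c\<in>G. ev f (z ^ c))" for z by (simp add: g_def ev_prod ev_zeta_power)
  have "ev g \<zeta> \<in> \<rat>"
  proof (rule ev_rational_if_fixed)
    fix d assume "d \<in> G"
    have "ev g (\<zeta> ^ d) = (\<Prod>c\<in>G. ev f (\<zeta> ^ (c * d)))"
      by (simp add: g power_mult[symmetric] mult.commute)
    also have "\<dots> = ev g \<zeta>" unfolding g by (rule prod_shift_G[OF G_not_dvd[OF \<open>d \<in> G\<close>]])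
    finally show "ev g (\<zeta> ^ d) = ev g \<zeta>" .
  qed
  thus ?thesis by (simp add: g)
qed

definition K :: "complex set" where "K = rat_adjoin \<zeta>"

text \<open>The inverse is the product of the other conjugates divided by the norm, and the norm is
  rational. Hence the polynomial values at \<open>\<zeta>\<close> already form a field.\<close>

lemma inverse_ev: "\<exists>g. inverse (ev f \<zeta>) = ev g \<zeta>"
proof (cases "ev f \<zeta> = 0")
  case True
  thus ?thesis by (intro exI[of _ 0]) (simp add: ev_0)
next
  case False
  define N where "N = (\<Prod>c\<in>G. ev f (\<zeta> ^ c))"
  obtain r where r: "N = of_rat r" using norm_ev_rat[of f] by (auto simp: N_def Rats_def)
  have N: "N = ev f \<zeta> * (\<Prod>c\<in>G - {1}. ev f (\<zeta> ^ c))"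
    unfolding N_def using prod.remove[OF finite_G G_one, of "\<lambda>c. ev f (\<zeta> ^ c)"] by simp
  \<comment> \<open>If a conjugate vanished, conjugating back with the inverse of \<open>c\<close>
    modulo \<open>p\<close> would make \<open>ev f \<zeta>\<close> vanish.\<close>
  have nz: "ev f (\<zeta> ^ c) \<noteq> 0" if "c \<in> G" for c
  proof
    assume "ev f (\<zeta> ^ c) = 0"
    hence z: "ev (pcompose f (Polynomial.monom 1 c)) \<zeta> = 0" by (simp add: ev_zeta_power)
    have "coprime c p" using G_not_dvd[OF that] p(1) by (metis coprime_commute prime_imp_coprime)
    then obtain d where "[c * d = Suc 0] (mod p)" using cong_solve_coprime_nat by blast
    hence d: "(c * d) mod p = 1 mod p" by (simp add: unique_euclidean_semiring_class.cong_def)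
    hence "\<not> p dvd d" using p3 by auto
    from ev_conjugate_zero[OF z this] have "ev f ((\<zeta> ^ d) ^ c) = 0" by (simp add: ev_zeta_power)
    moreover have "(\<zeta> ^ d) ^ c = \<zeta> ^ (c * d)" by (simp add: power_mult[symmetric] mult.commute)
    moreover have "\<dots> = \<zeta> ^ 1" using d by (rule zeta_cong)
    ultimately show False using False by simp
  qed
  have N0: "N \<noteq> 0" unfolding N_def using nz by (simp add: finite_G)
  define g where "g = [:inverse r:] * (\<Prod>c\<in>G - {1}. pcompose f (Polynomial.monom 1 c))"
  have "ev g \<zeta> = inverse N * (\<Prod>c\<in>G - {1}. ev f (\<zeta> ^ c))"
    by (simp add: g_def ev_smult ev_prod ev_zeta_power r of_rat_inverse)
  also have "\<dots> = inverse (ev f \<zeta>)" using N N0 False by (simp add: field_simps)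
  finally show ?thesis by metis
qed

lemma ev_in_K: "ev f \<zeta> \<in> K"
  unfolding K_def using ev_altdef[of f "Suc (degree f)" \<zeta>]
  by (auto intro!: rat_adjoin_add rat_adjoin_sum rat_adjoin_mult rat_adjoin_of_rat rat_adjoin_power rat_adjoin_gen)

lemma K_ev: "x \<in> K \<Longrightarrow> \<exists>f. x = ev f \<zeta>"
  unfolding K_def
proof (induction rule: rat_adjoin_induct)
  case one show ?case by (intro exI[of _ 1]) (simp add: ev_1)
next
  case gen show ?case by (intro exI[of _ "[:0, 1:]"]) (simp add: ev_X)
next
  case (minus x) thus ?case by (metis ev_minus)
next
  case (inverse x) thus ?case using inverse_ev by metis
next
  case (add x y) thus ?case by (metis ev_add)
next
  case (mult x y) thus ?case by (metis ev_mult)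
qed

text \<open>The automorphism with \<open>\<zeta>\<close> mapped to \<open>\<zeta> ^ c\<close>.
  \<open>SOME\<close> picks any representing polynomial; by \<open>ev_conjugate_zero\<close> the
  choice does not matter when \<open>p\<close> does not divide \<open>c\<close>.\<close>

definition \<sigma> :: "nat \<Rightarrow> complex \<Rightarrow> complex" where
  "\<sigma> c x = ev (SOME f. x = ev f \<zeta>) (\<zeta> ^ c)"

lemma \<sigma>_ev:
  assumes "\<not> p dvd c"
  shows "\<sigma> c (ev f \<zeta>) = ev f (\<zeta> ^ c)"
proof -
  define g where "g = (SOME g. ev f \<zeta> = ev g \<zeta>)"
  have "ev f \<zeta> = ev g \<zeta>" unfolding g_def by (rule someI[of _ f]) simp
  hence "ev (f - g) \<zeta> = 0" by (simp add: ev_diff)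
  from ev_conjugate_zero[OF this assms] have "ev f (\<zeta> ^ c) = ev g (\<zeta> ^ c)"
    by (simp add: ev_diff)
  thus ?thesis by (simp add: \<sigma>_def g_def)
qed

lemmas K_closed = rat_adjoin_0[of \<zeta>, folded K_def] rat_adjoin_1[of \<zeta>, folded K_def]
  rat_adjoin_of_nat[of _ \<zeta>, folded K_def] rat_adjoin_of_int[of _ \<zeta>, folded K_def]
  rat_adjoin_of_rat[of _ \<zeta>, folded K_def] rat_adjoin_minus[of _ \<zeta>, folded K_def]
  rat_adjoin_add[of _ \<zeta>, folded K_def] rat_adjoin_diff[of _ \<zeta>, folded K_def]
  rat_adjoin_mult[of _ \<zeta>, folded K_def] rat_adjoin_inverse[of _ \<zeta>, folded K_def]
  rat_adjoin_divide[of _ \<zeta>, folded K_def] rat_adjoin_power[of _ \<zeta>, folded K_def]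
  rat_adjoin_sum[of _ _ \<zeta>, folded K_def] rat_adjoin_gen[of \<zeta>, folded K_def]

lemma K_zeta: "\<zeta> ^ k \<in> K" by (intro K_closed)

lemma K_prod: "(\<And>i. i \<in> A \<Longrightarrow> f i \<in> K) \<Longrightarrow> (\<Prod>i\<in>A. f i) \<in> K"
  by (induction A rule: infinite_finite_induct) (auto intro: K_closed)

lemma \<sigma>_add: "\<not> p dvd c \<Longrightarrow> x \<in> K \<Longrightarrow> y \<in> K \<Longrightarrow> \<sigma> c (x + y) = \<sigma> c x + \<sigma> c y"
  by (auto dest!: K_ev simp: ev_add[symmetric] \<sigma>_ev) 

lemma \<sigma>_mult: "\<not> p dvd c \<Longrightarrow> x \<in> K \<Longrightarrow> y \<in> K \<Longrightarrow> \<sigma> c (x * y) = \<sigma> c x * \<sigma> c y"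
  by (auto dest!: K_ev simp: ev_mult[symmetric] \<sigma>_ev)

lemma \<sigma>_of_rat: "\<not> p dvd c \<Longrightarrow> \<sigma> c (of_rat r) = of_rat r"
  using \<sigma>_ev[of c "[:r:]"] by (simp add: ev_const)

lemma \<sigma>_of_int: "\<not> p dvd c \<Longrightarrow> \<sigma> c (of_int r) = of_int r"
  using \<sigma>_of_rat[of c "of_int r"] by simp

lemma \<sigma>_of_nat: "\<not> p dvd c \<Longrightarrow> \<sigma> c (of_nat r) = of_nat r"
  using \<sigma>_of_int[of c "int r"] by simp

lemma \<sigma>_0: "\<not> p dvd c \<Longrightarrow> \<sigma> c 0 = 0" and \<sigma>_1': "\<not> p dvd c \<Longrightarrow> \<sigma> c 1 = 1"
  using \<sigma>_of_nat[of c 0] \<sigma>_of_nat[of c 1] by simp_all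

lemma \<sigma>_minus: "\<not> p dvd c \<Longrightarrow> x \<in> K \<Longrightarrow> \<sigma> c (- x) = - \<sigma> c x"
  by (auto dest!: K_ev simp: ev_minus[symmetric] \<sigma>_ev)

lemma \<sigma>_diff: "\<not> p dvd c \<Longrightarrow> x \<in> K \<Longrightarrow> y \<in> K \<Longrightarrow> \<sigma> c (x - y) = \<sigma> c x - \<sigma> c y"
  using \<sigma>_add[of c x "- y"] \<sigma>_minus[of c y] by (simp add: K_closed)

lemma \<sigma>_zeta: "\<not> p dvd c \<Longrightarrow> \<sigma> c (\<zeta> ^ k) = \<zeta> ^ (c * k)"
  using \<sigma>_ev[of c "Polynomial.monom 1 k"] by (simp add: ev_monom power_mult)

lemma \<sigma>_in_K: "\<not> p dvd c \<Longrightarrow> x \<in> K \<Longrightarrow> \<sigma> c x \<in> K"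
  by (auto dest!: K_ev simp: \<sigma>_ev ev_zeta_power[symmetric] ev_in_K)

lemma \<sigma>_comp: "\<not> p dvd c \<Longrightarrow> \<not> p dvd d \<Longrightarrow> x \<in> K \<Longrightarrow> \<sigma> c (\<sigma> d x) = \<sigma> (c * d) x"
proof -
  assume cd: "\<not> p dvd c" "\<not> p dvd d" and "x \<in> K"
  then obtain f where f: "x = ev f \<zeta>" using K_ev by blast
  have "\<sigma> c (\<sigma> d x) = \<sigma> c (ev (pcompose f (Polynomial.monom 1 d)) \<zeta>)"
    by (simp only: f \<sigma>_ev[OF cd(2)] ev_zeta_power)
  also have "\<dots> = ev (pcompose f (Polynomial.monom 1 d)) (\<zeta> ^ c)" by (rule \<sigma>_ev[OF cd(1)])
  also have "\<dots> = ev f ((\<zeta> ^ c) ^ d)" by (rule ev_zeta_power)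
  also have "\<dots> = \<sigma> (c * d) x" using mult_not_dvd[OF cd] by (simp add: f \<sigma>_ev power_mult)
  finally show ?thesis .
qed

lemma \<sigma>_cong: "c mod p = d mod p \<Longrightarrow> \<sigma> c x = \<sigma> d x"
  unfolding \<sigma>_def using zeta_cong by metis

lemma \<sigma>_1: "x \<in> K \<Longrightarrow> \<sigma> 1 x = x"
  using p3 by (auto dest!: K_ev simp: \<sigma>_ev)

lemma inverse_mod:
  assumes "\<not> p dvd c"
  obtains d where "\<not> p dvd d" "(c * d) mod p = 1 mod p"
proof -
  have "coprime c p" using assms p(1) by (metis coprime_commute prime_imp_coprime)
  then obtain d where "[c * d = Suc 0] (mod p)" using cong_solve_coprime_nat by blast
  hence d: "(c * d) mod p = 1 mod p" by (simp add: unique_euclidean_semiring_class.cong_def)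
  hence "\<not> p dvd d" using p3 by auto
  thus ?thesis using d that by blast
qed

lemma \<sigma>_inv: 
  assumes "\<not> p dvd c"
  obtains d where "\<not> p dvd d" "\<And>x. x \<in> K \<Longrightarrow> \<sigma> d (\<sigma> c x) = x" "\<And>x. x \<in> K \<Longrightarrow> \<sigma> c (\<sigma> d x) = x"
proof -
  obtain d where d: "\<not> p dvd d" "(c * d) mod p = 1 mod p" using inverse_mod[OF assms] .
  have "\<sigma> (c * d) x = x" if "x \<in> K" for x using \<sigma>_cong[OF d(2)] \<sigma>_1[OF that] by simp
  thus ?thesis using that[of d] d(1) assms by (simp add: \<sigma>_comp mult.commute)
qed

lemma \<sigma>_nonzero:
  assumes "\<not> p dvd c" "x \<in> K" "x \<noteq> 0"
  shows "\<sigma> c x \<noteq> 0"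
  using \<sigma>_inv[OF assms(1)] \<sigma>_0 assms by metis

lemma \<sigma>_sum: "\<not> p dvd c \<Longrightarrow> (\<And>i. i \<in> A \<Longrightarrow> f i \<in> K) \<Longrightarrow> \<sigma> c (\<Sum>i\<in>A. f i) = (\<Sum>i\<in>A. \<sigma> c (f i))"
proof (induction A rule: infinite_finite_induct)
  case (insert x F)
  thus ?case by (simp add: \<sigma>_add K_closed)
qed (simp_all add: \<sigma>_0)

lemma \<sigma>_power: "\<not> p dvd c \<Longrightarrow> x \<in> K \<Longrightarrow> \<sigma> c (x ^ n) = \<sigma> c x ^ n"
  by (induction n) (simp_all add: \<sigma>_1' \<sigma>_mult K_closed)

lemma cnj_K: "x \<in> K \<Longrightarrow> cnj x = \<sigma> (p - 1) x"
proof -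
  assume "x \<in> K"
  then obtain f where f: "x = ev f \<zeta>" using K_ev by blast
  have "\<not> p dvd p - 1" using p3 by (auto dest: dvd_imp_le)
  thus ?thesis by (simp add: f cnj_ev cnj_zeta \<sigma>_ev)
qed

lemma p_minus_1: "\<not> p dvd p - 1" using p3 by (auto dest: dvd_imp_le)

lemma cnj_in_K: "x \<in> K \<Longrightarrow> cnj x \<in> K"
  using cnj_K[of x] \<sigma>_in_K[OF p_minus_1, of x] by simp

text \<open>Complex conjugation is the automorphism with index \<open>p - 1\<close>, and indices
  multiply commutatively. Hence \<open>e / cnj e\<close> has absolute value 1 under every
  conjugation, as \<open>kronecker\<close> requires.\<close>

lemma \<sigma>_cnj: "\<not> p dvd c \<Longrightarrow> x \<in> K \<Longrightarrow> \<sigma> c (cnj x) = cnj (\<sigma> c x)"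
  using \<sigma>_comp[OF _ p_minus_1, of c x] \<sigma>_comp[OF p_minus_1, of c x] cnj_K[of x] cnj_K[of "\<sigma> c x"]
  by (simp add: \<sigma>_in_K mult.commute)

definition Tr :: "complex \<Rightarrow> complex" where "Tr x = (\<Sum>c\<in>G. \<sigma> c x)"
definition Nm :: "complex \<Rightarrow> complex" where "Nm x = (\<Prod>c\<in>G. \<sigma> c x)"

lemma Tr_rat: "x \<in> K \<Longrightarrow> Tr x \<in> \<rat>"
  using trace_ev_rat by (auto dest!: K_ev simp: Tr_def \<sigma>_ev G_not_dvd)

lemma Nm_rat: "x \<in> K \<Longrightarrow> Nm x \<in> \<rat>"
  using norm_ev_rat by (auto dest!: K_ev simp: Nm_def \<sigma>_ev G_not_dvd)

lemma Nm_mult: "x \<in> K \<Longrightarrow> y \<in> K \<Longrightarrow> Nm (x * y) = Nm x * Nm y"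
  by (simp add: Nm_def \<sigma>_mult G_not_dvd prod.distrib)

lemma Nm_nonzero: "x \<in> K \<Longrightarrow> x \<noteq> 0 \<Longrightarrow> Nm x \<noteq> 0"
  by (simp add: Nm_def finite_G \<sigma>_nonzero G_not_dvd)

lemma Tr_add: "x \<in> K \<Longrightarrow> y \<in> K \<Longrightarrow> Tr (x + y) = Tr x + Tr y"
  by (simp add: Tr_def \<sigma>_add G_not_dvd sum.distrib)

lemma Tr_diff: "x \<in> K \<Longrightarrow> y \<in> K \<Longrightarrow> Tr (x - y) = Tr x - Tr y"
  by (simp add: Tr_def \<sigma>_diff G_not_dvd sum_subtractf)

lemma Tr_scale: "x \<in> K \<Longrightarrow> Tr (of_int n * x) = of_int n * Tr x"
  by (simp add: Tr_def \<sigma>_mult \<sigma>_of_int G_not_dvd K_closed sum_distrib_left)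

lemma \<sigma>_algebraic_int:
  assumes "\<not> p dvd c" "x \<in> K" "algebraic_int x"
  shows "algebraic_int (\<sigma> c x)"
proof -
  obtain P :: "int poly" where P: "poly (map_poly of_int P) x = 0" "lead_coeff P = 1"
    using assms(3) unfolding algebraic_int_altdef_ipoly by blast
  define n where "n = Suc (degree P)"
  have e: "poly (map_poly of_int P) z = (\<Sum>i<n. of_int (coeff P i) * z ^ i)" for z :: complex
    by (simp add: poly_altdef lessThan_Suc_atMost n_def)
  have "\<sigma> c (poly (map_poly of_int P) x) = poly (map_poly of_int P) (\<sigma> c x)"
    unfolding e using assms(1,2) by (simp add: \<sigma>_sum K_closed \<sigma>_mult \<sigma>_of_int \<sigma>_power)
  hence "poly (map_poly of_int P) (\<sigma> c x) = 0" using P(1) \<sigma>_0[OF assms(1)] by simp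
  thus ?thesis using P(2) unfolding algebraic_int_altdef_ipoly by blast
qed

definition OK :: "complex set" where "OK = ring_of_integers K"

lemma OK_iff: "x \<in> OK \<longleftrightarrow> x \<in> K \<and> algebraic_int x"
  by (simp add: OK_def ring_of_integers_def)

lemma OK_K: "x \<in> OK \<Longrightarrow> x \<in> K" by (simp add: OK_iff)

lemma OK_closed:
  "0 \<in> OK" "1 \<in> OK" "of_int k \<in> OK" "of_nat m \<in> OK" "\<zeta> ^ j \<in> OK"
  "x \<in> OK \<Longrightarrow> - x \<in> OK"
  "x \<in> OK \<Longrightarrow> y \<in> OK \<Longrightarrow> x + y \<in> OK"
  "x \<in> OK \<Longrightarrow> y \<in> OK \<Longrightarrow> x - y \<in> OK"
  "x \<in> OK \<Longrightarrow> y \<in> OK \<Longrightarrow> x * y \<in> OK"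
  "x \<in> OK \<Longrightarrow> x ^ n \<in> OK"
  by (auto simp: OK_iff algebraic_int_zeta_power
      intro!: K_closed algebraic_int_add_complex algebraic_int_diff_complex
        algebraic_int_mult_complex algebraic_int_power_complex)

lemma OK_sum: "(\<And>i. i \<in> A \<Longrightarrow> f i \<in> OK) \<Longrightarrow> (\<Sum>i\<in>A. f i) \<in> OK"
  by (induction A rule: infinite_finite_induct) (auto intro: OK_closed)

lemma OK_prod: "(\<And>i. i \<in> A \<Longrightarrow> f i \<in> OK) \<Longrightarrow> (\<Prod>i\<in>A. f i) \<in> OK"
  by (induction A rule: infinite_finite_induct) (auto intro: OK_closed)

lemma OK_\<sigma>: "\<not> p dvd c \<Longrightarrow> x \<in> OK \<Longrightarrow> \<sigma> c x \<in> OK"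
  by (simp add: OK_iff \<sigma>_in_K \<sigma>_algebraic_int)

lemma OK_cnj: "x \<in> OK \<Longrightarrow> cnj x \<in> OK"
  by (simp add: OK_iff cnj_in_K)

lemma Tr_int: "x \<in> OK \<Longrightarrow> Tr x \<in> \<int>"
  by (intro rational_algebraic_int_is_int Tr_rat OK_K)
     (auto simp: Tr_def OK_iff intro!: algebraic_int_sum_complex \<sigma>_algebraic_int G_not_dvd)

lemma Nm_int: "x \<in> OK \<Longrightarrow> Nm x \<in> \<int>"
  by (intro rational_algebraic_int_is_int Nm_rat OK_K)
     (auto simp: Nm_def OK_iff intro!: algebraic_int_prod_complex \<sigma>_algebraic_int G_not_dvd)

text \<open>Discrete Fourier inversion: in the double sum only the index \<open>c = 1\<close>
  survives the summation over \<open>k\<close>. For integral \<open>x\<close> it provides integer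
  coordinates of \<open>p * x\<close> and so replaces an integral basis.\<close>

lemma trace_expansion:
  assumes "x \<in> K"
  shows "of_nat p * x = (\<Sum>k<p. Tr (x * \<zeta> ^ (p - k)) * \<zeta> ^ k)"
proof -
  \<comment> \<open>\<open>p - k\<close> stands for \<open>- k\<close> and \<open>p + 1 - c\<close>
    for \<open>1 - c\<close>, so that all exponents remain natural numbers.\<close>
  have e: "\<zeta> ^ (c * (p - k) + k) = \<zeta> ^ ((p + 1 - c) * k)" if "c \<in> G" "k < p" for c k
  proof -
    have "c * (p - k) + c * k = c * p"
      using that(2) by (simp add: distrib_left[symmetric])
    hence "(c * (p - k) + k) + c * k = p * c + k" by (simp add: mult.commute)
    moreover have "(p + 1 - c) * k + c * k = p * k + k"
      using that(1) by (simp add: G_def distrib_right[symmetric])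
    ultimately have "\<zeta> ^ (c * (p - k) + k) * \<zeta> ^ (c * k) = \<zeta> ^ ((p + 1 - c) * k) * \<zeta> ^ (c * k)"
      by (simp only: power_add[symmetric]) (simp add: power_add power_mult zeta_p)
    thus ?thesis using zeta_nz by simp
  qed
  have "(\<Sum>k<p. Tr (x * \<zeta> ^ (p - k)) * \<zeta> ^ k) = (\<Sum>k<p. \<Sum>c\<in>G. \<sigma> c x * \<zeta> ^ (c * (p - k) + k))"
    by (simp add: Tr_def \<sigma>_mult \<sigma>_zeta G_not_dvd assms K_zeta sum_distrib_right power_add mult.assoc)
  also have "\<dots> = (\<Sum>k<p. \<Sum>c\<in>G. \<sigma> c x * \<zeta> ^ ((p + 1 - c) * k))"
    by (intro sum.cong refl) (simp add: e)
  also have "\<dots> = (\<Sum>c\<in>G. \<sigma> c x * (\<Sum>k<p. \<zeta> ^ ((p + 1 - c) * k)))"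
    by (subst sum.swap) (simp add: sum_distrib_left)
  also have "\<dots> = (\<Sum>c\<in>G. if c = 1 then \<sigma> c x * of_nat p else 0)"
  proof (intro sum.cong refl)
    fix c assume c: "c \<in> G"
    have "p dvd p + 1 - c \<longleftrightarrow> c = 1"
    proof
      assume d: "p dvd p + 1 - c"
      show "c = 1"
      proof (rule ccontr)
        assume "c \<noteq> 1"
        hence "0 < p + 1 - c" "p + 1 - c < p" using c by (auto simp: G_def)
        thus False using d by (auto dest: dvd_imp_le)
      qed
    qed auto
    thus "\<sigma> c x * (\<Sum>k<p. \<zeta> ^ ((p + 1 - c) * k)) = (if c = 1 then \<sigma> c x * of_nat p else 0)"
      by (simp add: sum_zeta)
  qed
  also have "\<dots> = of_nat p * x" using G_one finite_G by (simp add: \<sigma>_1[OF assms] \<sigma>_1[OF assms, simplified])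
  finally show ?thesis ..
qed

end

section \<open>Ideals and finiteness of the class number\<close>

abbreviation ip :: "complex set \<Rightarrow> complex set \<Rightarrow> complex set" where
  "ip I J \<equiv> ideal_prod complex_ring I J"

abbreviation sc :: "complex \<Rightarrow> complex set \<Rightarrow> complex set" where
  "sc a I \<equiv> (\<lambda>x. a * x) ` I"

lemma ip_mem: "i \<in> I \<Longrightarrow> j \<in> J \<Longrightarrow> i * j \<in> ip I J"
  using ideal_prod.prod[of i I j J complex_ring] by simp

lemma ip_add: "x \<in> ip I J \<Longrightarrow> y \<in> ip I J \<Longrightarrow> x + y \<in> ip I J"
  using ideal_prod.sum[of x complex_ring I J y] by simp

lemma ip_induct [consumes 1, case_names prod add]:
  assumes "x \<in> ip I J" "\<And>i j. i \<in> I \<Longrightarrow> j \<in> J \<Longrightarrow> P (i * j)"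
    "\<And>x y. x \<in> ip I J \<Longrightarrow> y \<in> ip I J \<Longrightarrow> P x \<Longrightarrow> P y \<Longrightarrow> P (x + y)"
  shows "P x"
  using assms(1) by (induction rule: ideal_prod.induct) (use assms(2,3) in auto)

lemma ip_subset:
  assumes "\<And>i j. i \<in> I \<Longrightarrow> j \<in> J \<Longrightarrow> i * j \<in> M" "\<And>x y. x \<in> M \<Longrightarrow> y \<in> M \<Longrightarrow> x + y \<in> M"
  shows "ip I J \<subseteq> M"
proof
  fix x assume "x \<in> ip I J"
  thus "x \<in> M" by (induction rule: ip_induct) (use assms in auto)
qed

lemma ip_mem': "i \<in> I \<Longrightarrow> j \<in> J \<Longrightarrow> i * j \<in> ip J I"
  using ip_mem[of j J i I] by (simp add: mult.commute)

lemma ip_commute: "ip I J = ip J I"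
  by (intro equalityI ip_subset ip_add ip_mem')

lemma ip_assoc: "ip (ip I J) L = ip I (ip J L)"
proof (intro equalityI ip_subset ip_add)
  fix x l assume x: "x \<in> ip I J" and l: "l \<in> L"
  show "x * l \<in> ip I (ip J L)"
    using x
  proof (induction rule: ip_induct)
    case (prod i j)
    thus ?case using l by (simp add: mult.assoc ip_mem)
  next
    case (add x y)
    thus ?case by (simp add: distrib_right ip_add)
  qed
next
  fix i x assume i: "i \<in> I" and x: "x \<in> ip J L"
  show "i * x \<in> ip (ip I J) L"
    using x
  proof (induction rule: ip_induct)
    case (prod j l)
    thus ?case using i by (simp add: mult.assoc[symmetric] ip_mem)
  next
    case (add x y)
    thus ?case by (simp add: distrib_left ip_add)
  qed
qed auto

lemma ip_sc_left: "ip (sc a I) J = sc a (ip I J)"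
proof
  show "ip (sc a I) J \<subseteq> sc a (ip I J)"
  proof (rule ip_subset)
    fix i j assume "i \<in> sc a I" "j \<in> J"
    thus "i * j \<in> sc a (ip I J)" by (auto simp: mult.assoc intro!: imageI ip_mem)
  next
    fix x y assume "x \<in> sc a (ip I J)" "y \<in> sc a (ip I J)"
    thus "x + y \<in> sc a (ip I J)" by (auto simp: distrib_left[symmetric] intro!: imageI ip_add)
  qed
  show "sc a (ip I J) \<subseteq> ip (sc a I) J"
  proof
    fix y assume "y \<in> sc a (ip I J)"
    then obtain x where x: "x \<in> ip I J" "y = a * x" by auto
    from x(1) have "a * x \<in> ip (sc a I) J"
    proof (induction rule: ip_induct)
      case (prod i j)
      thus ?case using ip_mem[OF imageI[OF prod(1), of "\<lambda>x. a * x"] prod(2)] by (simp add: mult.assoc)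
    next
      case (add x y)
      thus ?case by (simp add: distrib_left ip_add)
    qed
    thus "y \<in> ip (sc a I) J" by (simp add: x)
  qed
qed

lemma ip_sc_right: "ip I (sc a J) = sc a (ip I J)"
  by (metis ip_commute ip_sc_left)

lemma sc_sc: "sc a (sc b I) = sc (a * b) I"
  by (simp add: image_image mult.assoc)

lemma sc_1: "sc 1 I = I"
  by simp

section \<open>Modules over the ring of integers, their residues and generators\<close>

context prime_cyclotomic
begin

text \<open>Neither containment in \<open>K\<close> nor a denominator is demanded, so that a set can
  be multiplied and scaled before it is known to be a fractional ideal.\<close>

definition OK_module :: "complex set \<Rightarrow> bool" where
  "OK_module I \<longleftrightarrow> 0 \<in> I \<and> (\<forall>x\<in>I. \<forall>y\<in>I. x + y \<in> I) \<and> (\<forall>a\<in>OK. \<forall>x\<in>I. a * x \<in> I)"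

lemma OK_moduleD:
  assumes "OK_module I"
  shows "0 \<in> I" "x \<in> I \<Longrightarrow> y \<in> I \<Longrightarrow> x + y \<in> I" "a \<in> OK \<Longrightarrow> x \<in> I \<Longrightarrow> a * x \<in> I"
  using assms by (auto simp: OK_module_def)

lemma OK_module_minus: "OK_module I \<Longrightarrow> x \<in> I \<Longrightarrow> - x \<in> I"
  using OK_moduleD(3)[of I "-1" x] OK_closed(6)[OF OK_closed(2)] by simp

lemma OK_module_diff: "OK_module I \<Longrightarrow> x \<in> I \<Longrightarrow> y \<in> I \<Longrightarrow> x - y \<in> I"
  using OK_moduleD(2)[of I x "- y"] OK_module_minus[of I y] by simp

lemma OK_module_sum: "OK_module I \<Longrightarrow> (\<And>i. i \<in> A \<Longrightarrow> f i \<in> I) \<Longrightarrow> (\<Sum>i\<in>A. f i) \<in> I"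
  by (induction A rule: infinite_finite_induct) (auto intro: OK_moduleD)

lemma OK_module_OK: "OK_module OK"
  by (auto simp: OK_module_def intro: OK_closed)

lemma OK_module_sc: "OK_module I \<Longrightarrow> OK_module (sc a I)"
proof -
  assume I: "OK_module I"
  have "0 \<in> sc a I" using OK_moduleD(1)[OF I] by force
  moreover have "x + y \<in> sc a I" if "x \<in> sc a I" "y \<in> sc a I" for x y
    using that by (auto simp: distrib_left[symmetric] intro!: imageI OK_moduleD(2)[OF I])
  moreover have "b * x \<in> sc a I" if bx: "b \<in> OK" "x \<in> sc a I" for b x
  proof -
    obtain y where "y \<in> I" "x = a * y" using bx(2) by blast
    hence "b * x = a * (b * y)" "b * y \<in> I" using OK_moduleD(3)[OF I bx(1)] by auto
    thus ?thesis by auto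
  qed
  ultimately show ?thesis by (auto simp: OK_module_def)
qed

lemma OK_module_ip: "OK_module I \<Longrightarrow> OK_module J \<Longrightarrow> OK_module (ip I J)"
proof -
  assume I: "OK_module I" and J: "OK_module J"
  have "0 \<in> ip I J" using ip_mem[OF OK_moduleD(1)[OF I] OK_moduleD(1)[OF J]] by simp
  moreover have "a * x \<in> ip I J" if a: "a \<in> OK" and x: "x \<in> ip I J" for a x
    using x
  proof (induction rule: ip_induct)
    case (prod i j)
    thus ?case using OK_moduleD(3)[OF I a] by (simp add: mult.assoc[symmetric] ip_mem)
  next
    case (add x y)
    thus ?case by (simp add: distrib_left ip_add)
  qed
  ultimately show ?thesis by (auto simp: OK_module_def ip_add)
qed

lemma ip_OK: "OK_module I \<Longrightarrow> ip OK I = I"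
proof
  assume I: "OK_module I"
  show "ip OK I \<subseteq> I" by (intro ip_subset OK_moduleD[OF I]) auto
  show "I \<subseteq> ip OK I" using ip_mem[OF OK_closed(2)] by force
qed

definition nz_ideal :: "complex set \<Rightarrow> bool" where
  "nz_ideal I \<longleftrightarrow> OK_module I \<and> I \<noteq> {0} \<and> I \<subseteq> OK"

definition frac_ideal :: "complex set \<Rightarrow> bool" where
  "frac_ideal I \<longleftrightarrow> OK_module I \<and> I \<noteq> {0} \<and> (\<exists>d\<in>OK. d \<noteq> 0 \<and> sc d I \<subseteq> OK)"

lemma nz_ideal_frac_ideal: "nz_ideal I \<Longrightarrow> frac_ideal I"
  unfolding nz_ideal_def frac_ideal_def using OK_closed(2) by (intro conjI bexI[of _ 1]) auto

lemma frac_ideal_nonzero_elem: "frac_ideal I \<Longrightarrow> \<exists>x\<in>I. x \<noteq> 0"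
  by (auto simp: frac_ideal_def dest: OK_moduleD(1))

lemma nz_ideal_ip: "nz_ideal I \<Longrightarrow> nz_ideal J \<Longrightarrow> nz_ideal (ip I J)"
proof -
  assume IJ: "nz_ideal I" "nz_ideal J"
  obtain x y where "x \<in> I" "x \<noteq> 0" "y \<in> J" "y \<noteq> 0"
    using frac_ideal_nonzero_elem[OF nz_ideal_frac_ideal[OF IJ(1)]] frac_ideal_nonzero_elem[OF nz_ideal_frac_ideal[OF IJ(2)]] by blast
  hence "x * y \<in> ip I J" "x * y \<noteq> 0" by (simp_all add: ip_mem)
  hence "ip I J \<noteq> {0}" by (metis singletonD)
  moreover have "ip I J \<subseteq> OK" using IJ by (intro ip_subset) (auto simp: nz_ideal_def intro: OK_closed)
  ultimately show ?thesis using IJ by (auto simp: nz_ideal_def OK_module_ip)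
qed

lemma nz_ideal_OK: "nz_ideal OK"
proof -
  have "OK \<noteq> {0}" using OK_closed(2) by (metis one_neq_zero singletonD)
  thus ?thesis by (simp add: nz_ideal_def OK_module_OK)
qed

lemma frac_ideal_K: "frac_ideal I \<Longrightarrow> x \<in> I \<Longrightarrow> x \<in> K"
proof -
  assume "frac_ideal I" "x \<in> I"
  then obtain d where d: "d \<in> OK" "d \<noteq> 0" "d * x \<in> OK" by (auto simp: frac_ideal_def)
  hence "(d * x) / d \<in> K" by (intro K_closed OK_K) auto
  thus ?thesis using d by simp
qed

lemma Nm_dvd:
  assumes "x \<in> OK"
  obtains y where "y \<in> OK" "Nm x = x * y"
proof
  show "(\<Prod>c\<in>G - {1}. \<sigma> c x) \<in> OK" using assms by (intro OK_prod OK_\<sigma>) (auto dest: G_not_dvd)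
  show "Nm x = x * (\<Prod>c\<in>G - {1}. \<sigma> c x)"
    unfolding Nm_def using prod.remove[OF finite_G G_one, of "\<lambda>c. \<sigma> c x"] \<sigma>_1[OF OK_K[OF assms]] by simp
qed

text \<open>The trace coordinates are rational; a common denominator of them, times the factor
  \<open>p\<close> from \<open>trace_expansion\<close>, makes \<open>x\<close> integral.\<close>

lemma OK_denominator:
  assumes "x \<in> K"
  obtains n :: nat where "n > 0" "of_nat n * x \<in> OK"
proof -
  have "\<forall>k<p. \<exists>r. Tr (x * \<zeta> ^ (p - k)) = of_rat r"
    using Tr_rat[of "x * \<zeta> ^ (p - k)" for k] assms K_zeta K_closed by (metis Rats_cases)
  then obtain r where r: "\<And>k. k < p \<Longrightarrow> Tr (x * \<zeta> ^ (p - k)) = of_rat (r k)" by metis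
  obtain n :: int where n: "n > 0" "\<And>k. k \<in> {..<p} \<Longrightarrow> of_int n * r k \<in> \<int>"
    using common_denominator[of "{..<p}" r] by auto
  have ri: "of_int n * (of_rat (r k) :: complex) \<in> OK" if "k < p" for k
  proof -
    obtain m :: int where "of_int n * r k = of_int m" using n(2)[of k] \<open>k < p\<close> by (auto elim: Ints_cases)
    hence "of_rat (of_int n * r k) = (of_int m :: complex)" by simp
    hence "of_int n * (of_rat (r k) :: complex) = of_int m" by (simp add: of_rat_mult)
    thus ?thesis by (simp add: OK_closed)
  qed
  have "of_nat (p * nat n) * x = of_int n * (of_nat p * x)" using n(1) by simp
  also have "\<dots> = (\<Sum>k<p. of_int n * of_rat (r k) * \<zeta> ^ k)"
    unfolding trace_expansion[OF assms] sum_distrib_left by (intro sum.cong refl) (simp add: r)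
  also have "\<dots> \<in> OK" by (intro OK_sum OK_closed(9)[OF ri OK_closed(5)]) simp
  finally show ?thesis using that[of "p * nat n"] n(1) p3 by simp
qed

lemma frac_ideal_sc: "frac_ideal I \<Longrightarrow> a \<in> K \<Longrightarrow> a \<noteq> 0 \<Longrightarrow> frac_ideal (sc a I)"
proof -
  assume I: "frac_ideal I" and a: "a \<in> K" "a \<noteq> 0"
  obtain d where d: "d \<in> OK" "d \<noteq> 0" "sc d I \<subseteq> OK" using I by (auto simp: frac_ideal_def)
  obtain n where n: "n > 0" "of_nat n * a \<in> OK" using OK_denominator[OF a(1)] .
  obtain x where x: "x \<in> I" "x \<noteq> 0" using frac_ideal_nonzero_elem[OF I] by auto
  have "sc a I \<noteq> {0}" using imageI[OF x(1), of "\<lambda>x. a * x"] x(2) a(2) by (metis mult_eq_0_iff singletonD)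
  moreover have "sc (d * of_nat n) (sc a I) \<subseteq> OK"
  proof
    fix y assume "y \<in> sc (d * of_nat n) (sc a I)"
    then obtain z where z: "z \<in> I" "y = (of_nat n * a) * (d * z)" by auto
    moreover have "d * z \<in> OK" using d z by auto
    ultimately show "y \<in> OK" using n OK_closed(9) by auto
  qed
  moreover have "d * of_nat n \<in> OK" "d * of_nat n \<noteq> 0" using d n by (auto intro: OK_closed)
  ultimately show ?thesis using I OK_module_sc unfolding frac_ideal_def by blast
qed

lemma frac_ideal_nz_ideal:
  assumes "frac_ideal I"
  obtains d where "d \<in> OK" "d \<noteq> 0" "nz_ideal (sc d I)"
proof -
  obtain d where d: "d \<in> OK" "d \<noteq> 0" "sc d I \<subseteq> OK" using assms by (auto simp: frac_ideal_def)
  moreover obtain x where x: "x \<in> I" "x \<noteq> 0" using frac_ideal_nonzero_elem[OF assms] by auto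
  have "sc d I \<noteq> {0}"
    using imageI[OF x(1), of "\<lambda>x. d * x"] x(2) d(2) by (metis mult_eq_0_iff singletonD)
  ultimately have "nz_ideal (sc d I)" using assms OK_module_sc by (auto simp: nz_ideal_def frac_ideal_def)
  thus ?thesis using that d by blast
qed

text \<open>The norm of a nonzero element is a nonzero integer and, by \<open>Nm_dvd\<close>, an
  integral multiple of that element.\<close>

lemma nz_ideal_pos_int:
  assumes "nz_ideal I"
  obtains n :: nat where "n > 0" "of_nat n \<in> I"
proof -
  obtain x where x: "x \<in> I" "x \<noteq> 0" using frac_ideal_nonzero_elem[OF nz_ideal_frac_ideal[OF assms]] by auto
  hence xO: "x \<in> OK" using assms by (auto simp: nz_ideal_def)
  obtain y where y: "y \<in> OK" "Nm x = x * y" using Nm_dvd[OF xO] .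
  have I: "OK_module I" using assms by (simp add: nz_ideal_def)
  have "Nm x \<in> I" using y x OK_moduleD(3)[OF I, of y x] by (simp add: mult.commute)
  moreover obtain k where k: "Nm x = of_int k" using Nm_int[OF xO] by (auto elim: Ints_cases)
  moreover have "k \<noteq> 0" using k Nm_nonzero[OF OK_K[OF xO] x(2)] by auto
  ultimately have "(of_nat (nat \<bar>k\<bar>) :: complex) \<in> I"
    using OK_module_minus[OF I, of "of_int k"] by (cases "k \<ge> 0") auto
  thus ?thesis using that[of "nat \<bar>k\<bar>"] \<open>k \<noteq> 0\<close> by simp
qed

text \<open>For integral \<open>x\<close> this trace is already a rational integer;
  \<open>Re\<close> and the floor only change its type.\<close>

definition trace_coord :: "nat \<Rightarrow> complex \<Rightarrow> int" where
  "trace_coord k x = \<lfloor>Re (Tr (x * \<zeta> ^ (p - k)))\<rfloor>"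

lemma trace_coord: "x \<in> OK \<Longrightarrow> of_int (trace_coord k x) = Tr (x * \<zeta> ^ (p - k))"
proof -
  assume "x \<in> OK"
  hence "Tr (x * \<zeta> ^ (p - k)) \<in> \<int>" by (intro Tr_int OK_closed)
  thus ?thesis by (auto elim!: Ints_cases simp: trace_coord_def)
qed

lemma trace_coord_expansion: "x \<in> OK \<Longrightarrow> of_nat p * x = (\<Sum>k<p. of_int (trace_coord k x) * \<zeta> ^ k)"
  by (simp add: trace_coord trace_expansion[OF OK_K])

lemma trace_coord_diff: "x \<in> OK \<Longrightarrow> y \<in> OK \<Longrightarrow> trace_coord k (x - y) = trace_coord k x - trace_coord k y"
proof -
  assume xy: "x \<in> OK" "y \<in> OK"
  have "(of_int (trace_coord k (x - y)) :: complex) = of_int (trace_coord k x - trace_coord k y)"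
    using xy by (simp add: trace_coord OK_closed left_diff_distrib Tr_diff OK_K K_closed K_zeta)
  thus ?thesis by (simp only: of_int_eq_iff)
qed

lemma trace_coord_cong:
  assumes "x \<in> OK" "y \<in> OK" "n > 0"
    and "\<And>k. k < p \<Longrightarrow> trace_coord k x mod int (p * n) = trace_coord k y mod int (p * n)"
  obtains e :: "nat \<Rightarrow> int" where "x - y = of_nat n * (\<Sum>k<p. of_int (e k) * \<zeta> ^ k)"
proof -
  define e where "e = (\<lambda>k. (trace_coord k x - trace_coord k y) div int (p * n))"
  have e: "trace_coord k x - trace_coord k y = int (p * n) * e k" if "k < p" for k
    using assms(4)[OF that] by (simp add: e_def mod_eq_dvd_iff)
  have "of_nat p * (x - y) = (\<Sum>k<p. of_int (trace_coord k x - trace_coord k y) * \<zeta> ^ k)"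
    using trace_coord_expansion[of "x - y"] assms(1,2) by (simp add: OK_closed trace_coord_diff)
  also have "\<dots> = (\<Sum>k<p. of_nat p * (of_nat n * (of_int (e k) * \<zeta> ^ k)))"
    by (intro sum.cong refl) (subst e, auto)
  also have "\<dots> = of_nat p * (of_nat n * (\<Sum>k<p. of_int (e k) * \<zeta> ^ k))"
    by (simp only: sum_distrib_left)
  finally have "x - y = of_nat n * (\<Sum>k<p. of_int (e k) * \<zeta> ^ k)" using p3 by simp
  thus ?thesis using that by blast
qed

lemma int_comb_OK: "(\<Sum>k<p. of_int (e k) * \<zeta> ^ k) \<in> OK"
  by (intro OK_sum OK_closed)

text \<open>The modulus is \<open>p * n\<close> and not \<open>n\<close>, because the coordinates
  describe \<open>p * x\<close>; equal residues then give a difference divisible by \<open>n\<close>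
  itself.\<close>

definition res :: "nat \<Rightarrow> complex \<Rightarrow> nat \<Rightarrow> int" where
  "res n x = (\<lambda>k\<in>{..<p}. trace_coord k x mod int (p * n))"

lemma res_range: "n > 0 \<Longrightarrow> res n x \<in> (\<Pi>\<^sub>E k\<in>{..<p}. {0..<int (p * n)})"
  using p3 by (auto simp: res_def)

lemma finite_res_range: "finite (\<Pi>\<^sub>E k\<in>{..<p}. {0..<int (p * n)})"
  by (intro finite_PiE) auto

lemma res_eq:
  assumes "x \<in> OK" "y \<in> OK" "n > 0" "res n x = res n y"
  obtains e :: "nat \<Rightarrow> int" where "x - y = of_nat n * (\<Sum>k<p. of_int (e k) * \<zeta> ^ k)"
proof (rule trace_coord_cong[OF assms(1-3)])
  fix k assume "k < p"
  thus "trace_coord k x mod int (p * n) = trace_coord k y mod int (p * n)"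
    using fun_cong[OF assms(4), of k] by (simp add: res_def)
qed

text \<open>An ideal containing \<open>n\<close> contains with an element everything of the same
  residue, so it is determined by its set of residues, a subset of a finite set.\<close>

lemma finite_ideals_containing:
  assumes "n > 0"
  shows "finite {I. nz_ideal I \<and> of_nat n \<in> I}"
proof (rule finite_imageD)
  define P where "P = (\<Pi>\<^sub>E k\<in>{..<p}. {0..<int (p * n)})"
  have "res n x \<in> P" for x using res_range[OF assms] by (simp add: P_def)
  hence "(\<lambda>I. res n ` I) ` {I. nz_ideal I \<and> of_nat n \<in> I} \<subseteq> Pow P" by blast
  moreover have "finite P" unfolding P_def by (rule finite_res_range)
  ultimately show "finite ((\<lambda>I. res n ` I) ` {I. nz_ideal I \<and> of_nat n \<in> I})"
    by (meson finite_Pow_iff finite_subset)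
  have sub: "I \<subseteq> J" if I: "nz_ideal I" and J: "nz_ideal J" "of_nat n \<in> J" and e: "res n ` I = res n ` J" for I J
  proof
    fix x assume x: "x \<in> I"
    then obtain y where y: "y \<in> J" "res n x = res n y" using e by (metis imageE imageI)
    have "x \<in> OK" "y \<in> OK" using x y I J by (auto simp: nz_ideal_def)
    then obtain e :: "nat \<Rightarrow> int" where e: "x - y = of_nat n * (\<Sum>k<p. of_int (e k) * \<zeta> ^ k)"
      using res_eq[OF _ _ assms y(2)] by blast
    have om: "OK_module J" using J by (simp add: nz_ideal_def)
    have "x - y \<in> J" unfolding e
      using OK_moduleD(3)[OF om int_comb_OK[of e] J(2)] by (simp add: mult.commute)
    hence "(x - y) + y \<in> J" using y(1) OK_moduleD(2)[OF om] by blast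
    thus "x \<in> J" by simp
  qed
  show "inj_on (\<lambda>I. res n ` I) {I. nz_ideal I \<and> of_nat n \<in> I}"
  proof (rule inj_onI)
    fix I J assume "I \<in> {I. nz_ideal I \<and> of_nat n \<in> I}" "J \<in> {I. nz_ideal I \<and> of_nat n \<in> I}"
      "res n ` I = res n ` J"
    thus "I = J" by (intro equalityI sub) simp_all
  qed
qed

text \<open>Elements of equal residue differ by \<open>n\<close> times an integer combination of
  powers of \<open>\<zeta>\<close>. One representative of each occurring residue together with the
  \<open>n * \<zeta> ^ k\<close> therefore generates the ideal over the integers.\<close>

lemma nz_ideal_generators:
  assumes "nz_ideal I" "n > 0" "of_nat n \<in> I"
  obtains T where "finite T" "T \<subseteq> I" "of_nat n \<in> T" "\<And>x. x \<in> I \<Longrightarrow> x \<in> int_span (\<lambda>t. t) T"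
proof -
  have om: "OK_module I" and IO: "I \<subseteq> OK" using assms by (auto simp: nz_ideal_def)
  define R where "R = res n ` I"
  have "R \<subseteq> (\<Pi>\<^sub>E k\<in>{..<p}. {0..<int (p * n)})"
    unfolding R_def using res_range[OF assms(2)] by (rule image_subsetI)
  hence finR: "finite R" using finite_res_range finite_subset by blast
  have "\<forall>r\<in>R. \<exists>x\<in>I. res n x = r" by (auto simp: R_def)
  then obtain g where g: "\<And>r. r \<in> R \<Longrightarrow> g r \<in> I \<and> res n (g r) = r" by metis
  define T where "T = g ` R \<union> (\<lambda>k. of_nat n * \<zeta> ^ k) ` {..<p}"
  have finT: "finite T" by (simp add: T_def finR)
  have nz: "of_nat n * \<zeta> ^ k \<in> I" for k
    using OK_moduleD(3)[OF om OK_closed(5) assms(3)] by (simp add: mult.commute)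
  have base: "t \<in> int_span (\<lambda>t. t) T" if "t \<in> T" for t using int_span_base[OF finT that] .
  show ?thesis
  proof (rule that[of T])
    show "finite T" by (rule finT)
    show "T \<subseteq> I" using g nz by (auto simp: T_def)
    have "of_nat n * \<zeta> ^ 0 \<in> T" using p3 unfolding T_def by (intro UnI2 imageI) auto
    thus "of_nat n \<in> T" by simp
    fix x assume x: "x \<in> I"
    define r where "r = res n x"
    have r: "r \<in> R" using x by (simp add: r_def R_def)
    have a: "x \<in> OK" "g r \<in> OK" "res n x = res n (g r)"
      using g[OF r] x IO by (auto simp: r_def)
    obtain e :: "nat \<Rightarrow> int" where "x - g r = of_nat n * (\<Sum>k<p. of_int (e k) * \<zeta> ^ k)"
      using res_eq[OF a(1,2) assms(2) a(3)] .
    hence "x = g r + (\<Sum>k<p. of_int (e k) * (of_nat n * \<zeta> ^ k))"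
      by (simp add: sum_distrib_left mult_ac algebra_simps)
    also have "\<dots> \<in> int_span (\<lambda>t. t) T"
      by (intro int_span_add int_span_sum int_span_scale base) (use r in \<open>auto simp: T_def\<close>)
    finally show "x \<in> int_span (\<lambda>t. t) T" .
  qed
qed

lemma stabilizer_integral:
  assumes "nz_ideal I" "\<And>x. x \<in> I \<Longrightarrow> \<theta> * x \<in> I"
  shows "algebraic_int \<theta>"
proof -
  obtain n where n: "n > 0" "of_nat n \<in> I" using nz_ideal_pos_int[OF assms(1)] .
  obtain T where T: "finite T" "T \<subseteq> I" "of_nat n \<in> T" "\<And>x. x \<in> I \<Longrightarrow> x \<in> int_span (\<lambda>t. t) T"
    using nz_ideal_generators[OF assms(1) n] by blast
  show ?thesis
    by (rule algebraic_int_if_stable_span[of T "of_nat n" "\<lambda>t. t"]) (use T n assms(2) in auto)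
qed

primrec lspan :: "complex list \<Rightarrow> complex set" where
  "lspan [] = {0}"
| "lspan (g # gs) = {a * g + y |a y. a \<in> OK \<and> y \<in> lspan gs}"

lemma lspanI: "a \<in> OK \<Longrightarrow> y \<in> lspan gs \<Longrightarrow> a * g + y \<in> lspan (g # gs)"
  by auto

lemma OK_module_lspan: "OK_module (lspan gs)"
proof (induction gs)
  case Nil
  show ?case by (simp add: OK_module_def)
next
  case (Cons g gs)
  have "0 * g + 0 \<in> lspan (g # gs)" by (intro lspanI OK_closed OK_moduleD(1)[OF Cons])
  moreover have "x + y \<in> lspan (g # gs)" if xy: "x \<in> lspan (g # gs)" "y \<in> lspan (g # gs)" for x y
  proof -
    obtain a b u v where ab: "x = a * g + u" "y = b * g + v" "a \<in> OK" "b \<in> OK" "u \<in> lspan gs" "v \<in> lspan gs"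
      using xy by auto
    hence "x + y = (a + b) * g + (u + v)" by (simp add: algebra_simps)
    also have "\<dots> \<in> lspan (g # gs)" by (intro lspanI OK_closed(7) OK_moduleD(2)[OF Cons] ab)
    finally show ?thesis .
  qed
  moreover have "c * x \<in> lspan (g # gs)" if cx: "c \<in> OK" "x \<in> lspan (g # gs)" for c x
  proof -
    obtain a u where ab: "x = a * g + u" "a \<in> OK" "u \<in> lspan gs" using cx(2) by auto
    hence "c * x = (c * a) * g + c * u" by (simp add: algebra_simps)
    also have "\<dots> \<in> lspan (g # gs)" by (intro lspanI OK_closed(9) OK_moduleD(3)[OF Cons] ab cx)
    finally show ?thesis .
  qed
  ultimately show ?case by (simp add: OK_module_def)
qed

lemma set_subset_lspan: "set gs \<subseteq> lspan gs"
proof (induction gs)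
  case (Cons g gs)
  have "g \<in> lspan (g # gs)" using lspanI[OF OK_closed(2) OK_moduleD(1)[OF OK_module_lspan], of g gs] by simp
  moreover have "y \<in> lspan (g # gs)" if "y \<in> lspan gs" for y
    using lspanI[OF OK_closed(1) that, of g] by simp
  ultimately show ?case using Cons by auto
qed simp

text \<open>The generators are eliminated one after the other (Nakayama's lemma without determinants).\<close>

lemma nakayama:
  assumes I: "nz_ideal I" and B: "OK_module B" "B \<subseteq> OK" and sub: "I \<subseteq> ip B I"
  shows "1 \<in> B"
proof -
  obtain n where n: "n > 0" "of_nat n \<in> I" using nz_ideal_pos_int[OF I] .
  obtain T where T: "finite T" "T \<subseteq> I" "of_nat n \<in> T" "\<And>x. x \<in> I \<Longrightarrow> x \<in> int_span (\<lambda>t. t) T"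
    using nz_ideal_generators[OF I n] by blast
  obtain gs where gs: "set gs = T" using T(1) finite_list by blast
  have "I \<subseteq> lspan gs"
  proof
    fix x assume "x \<in> I"
    then obtain c where "x = (\<Sum>j\<in>T. of_int (c j) * j)" using T(4) unfolding int_span_def by blast
    moreover have "(\<Sum>j\<in>T. of_int (c j) * j) \<in> lspan gs"
      by (intro OK_module_sum OK_module_lspan OK_moduleD(3)[OF OK_module_lspan] OK_closed) (use set_subset_lspan gs in auto)
    ultimately show "x \<in> lspan gs" by simp
  qed
  have "\<exists>b\<in>B. \<forall>x\<in>I. (1 - b) * x \<in> lspan (drop k gs)" if "k \<le> length gs" for k
    using that
  proof (induction k)
    case 0
    show ?case using \<open>I \<subseteq> lspan gs\<close> OK_moduleD(1)[OF B(1)] by (intro bexI[of _ 0]) auto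
  next
    case (Suc k)
    then obtain b where b: "b \<in> B" "\<And>x. x \<in> I \<Longrightarrow> (1 - b) * x \<in> lspan (drop k gs)" by auto
    define g where "g = gs ! k"
    define vs where "vs = drop (Suc k) gs"
    have dk: "drop k gs = g # vs" using Suc.prems by (simp add: g_def vs_def Cons_nth_drop_Suc)
    have "g \<in> I" using gs T(2) Suc.prems by (auto simp: g_def)
    have "(1 - b) * x \<in> {\<beta> * g + y |\<beta> y. \<beta> \<in> B \<and> y \<in> lspan vs}" if xB: "x \<in> ip B I" for x
      using xB
    proof (induction rule: ip_induct)
      case (prod c j)
      obtain a y where ay: "(1 - b) * j = a * g + y" "a \<in> OK" "y \<in> lspan vs"
        using b(2)[OF prod(2)] unfolding dk by auto
      have "(1 - b) * (c * j) = c * ((1 - b) * j)" by (simp add: mult_ac)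
      also have "\<dots> = (a * c) * g + c * y" unfolding ay by (simp add: algebra_simps)
      finally have "(1 - b) * (c * j) = (a * c) * g + c * y" .
      moreover have "a * c \<in> B" using prod ay OK_moduleD(3)[OF B(1)] by blast
      moreover have "c * y \<in> lspan vs" using prod ay B(2) OK_moduleD(3)[OF OK_module_lspan] by blast
      ultimately show ?case by blast
    next
      case (add x y)
      then obtain c d u v where cd: "(1 - b) * x = c * g + u" "(1 - b) * y = d * g + v"
        "c \<in> B" "d \<in> B" "u \<in> lspan vs" "v \<in> lspan vs" by auto
      have "(1 - b) * (x + y) = (c + d) * g + (u + v)" unfolding distrib_left cd(1,2) by (simp add: algebra_simps)
      moreover have "c + d \<in> B" using cd OK_moduleD(2)[OF B(1)] by blast
      moreover have "u + v \<in> lspan vs" using cd OK_moduleD(2)[OF OK_module_lspan] by blast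
      ultimately show ?case by blast
    qed
    from this[OF subsetD[OF sub \<open>g \<in> I\<close>]]
    obtain \<beta> y where y: "(1 - b) * g = \<beta> * g + y" "\<beta> \<in> B" "y \<in> lspan vs"
      by blast
    define e where "e = 1 - b - \<beta>"
    have "e * g = (1 - b) * g - \<beta> * g" by (simp add: e_def algebra_simps)
    hence eg: "e * g = y" using y(1) by simp
    have bO: "1 - b \<in> OK" by (rule OK_closed(8)[OF OK_closed(2) subsetD[OF B(2) b(1)]])
    have eO: "e \<in> OK" unfolding e_def by (rule OK_closed(8)[OF bO subsetD[OF B(2) y(2)]])
    \<comment> \<open>The equation for \<open>g\<close> reads \<open>e * g = y\<close> with
      \<open>y\<close> in the span of the remaining generators. Multiplying by \<open>e\<close> once
      more removes \<open>g\<close>, and the expansion \<open>b'e\<close> shows that the complement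
      of \<open>e * (1 - b)\<close> still lies in \<open>B\<close>.\<close>
    define b' where "b' = 1 - e * (1 - b)"
    have b'e: "b' = b + (1 - b) * b + (1 - b) * \<beta>" by (simp add: b'_def e_def algebra_simps)
    have "b' \<in> B" unfolding b'e by (intro OK_moduleD(2)[OF B(1)] OK_moduleD(3)[OF B(1) bO] b(1) y(2))
    moreover have "(1 - b') * x \<in> lspan vs" if xI: "x \<in> I" for x
    proof -
      obtain a w where w: "(1 - b) * x = a * g + w" "a \<in> OK" "w \<in> lspan vs"
        using b(2)[OF xI] unfolding dk by auto
      have "(1 - b') * x = e * ((1 - b) * x)" by (simp add: b'_def)
      also have "\<dots> = a * y + e * w" unfolding w eg[symmetric] by (simp add: algebra_simps)
      also have "\<dots> \<in> lspan vs" by (intro OK_moduleD(2)[OF OK_module_lspan] OK_moduleD(3)[OF OK_module_lspan] w y eO)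
      finally show ?thesis .
    qed
    ultimately show ?case unfolding vs_def by blast
  qed
  \<comment> \<open>With no generator left, \<open>1 - b\<close> annihilates \<open>I\<close>, in
    particular the nonzero \<open>n\<close>.\<close>
  from this[of "length gs"] obtain b where b: "b \<in> B" "\<And>x. x \<in> I \<Longrightarrow> (1 - b) * x = 0" by auto
  from b(2)[OF n(2)] n(1) have "1 - b = 0" by simp
  thus ?thesis using b(1) by simp
qed

end

section \<open>Hurwitz's division and finiteness of the class number\<close>

lemma norm_of_rat_complex: "norm (of_rat r :: complex) = of_rat \<bar>r\<bar>"
proof -
  have "(of_rat r :: complex) = of_real (of_rat r)" by (cases r) (simp add: of_rat_rat)
  hence "norm (of_rat r :: complex) = \<bar>of_rat r\<bar>" by (metis norm_of_real)
  thus ?thesis by (simp add: abs_if of_rat_minus)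
qed

lemma abs_diff_less_if_floor_eq:
  fixes a b :: rat
  assumes "\<lfloor>of_nat n * a\<rfloor> = \<lfloor>of_nat n * b\<rfloor>" "n > 0"
  shows "\<bar>a - b\<bar> < 1 / of_nat n"
proof -
  have "\<bar>of_nat n * a - of_nat n * b\<bar> < 1" using assms(1) by linarith
  hence "of_nat n * \<bar>a - b\<bar> < 1" by (simp add: right_diff_distrib[symmetric] abs_mult)
  thus ?thesis using assms(2) by (simp add: field_simps)
qed

context prime_cyclotomic
begin

lemma norm_zeta_power: "norm (\<zeta> ^ k) = 1"
proof -
  have "norm \<zeta> ^ p = 1" using zeta_p by (metis norm_one norm_power)
  hence "norm \<zeta> = 1" using p3 power_eq_imp_eq_base[of "norm \<zeta>" p 1] by simp
  thus ?thesis by (simp add: norm_power)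
qed

lemma K_coords:
  assumes "x \<in> K"
  obtains r :: "nat \<Rightarrow> rat" where "x = (\<Sum>k<p. of_rat (r k) * \<zeta> ^ k)"
proof -
  have "\<forall>k. \<exists>r. Tr (x * \<zeta> ^ (p - k)) = of_rat r"
    using Tr_rat[of "x * \<zeta> ^ (p - k)" for k] assms K_zeta K_closed by (metis Rats_cases)
  then obtain s where s: "\<And>k. Tr (x * \<zeta> ^ (p - k)) = of_rat (s k)" by metis
  have "of_nat p * x = (\<Sum>k<p. of_rat (s k) * \<zeta> ^ k)" using trace_expansion[OF assms] by (simp add: s)
  hence "x = (\<Sum>k<p. of_rat (s k) * \<zeta> ^ k) / of_nat p" using p3 by (simp add: field_simps)
  also have "\<dots> = (\<Sum>k<p. of_rat (s k / of_nat p) * \<zeta> ^ k)"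
    by (simp add: sum_divide_distrib of_rat_divide)
  finally show ?thesis by (rule that)
qed

text \<open>Each conjugate is a sum of \<open>p\<close> terms of absolute value at most
  \<open>1 / (2 * p)\<close>, hence at most \<open>1 / 2\<close>; the norm is a product of at least
  one such factor.\<close>

lemma small_norm:
  assumes "y = (\<Sum>k<p. of_rat (d k) * \<zeta> ^ k)" "\<And>k. k < p \<Longrightarrow> \<bar>d k\<bar> < 1 / of_nat (2 * p)"
  shows "norm (Nm y) < 1"
proof -
  have le: "norm (\<sigma> c y) \<le> 1 / 2" if c: "c \<in> G" for c
  proof -
    have nc: "\<not> p dvd c" using G_not_dvd c by blast
    have "\<sigma> c y = (\<Sum>k<p. of_rat (d k) * \<zeta> ^ (c * k))"
      unfolding assms(1) using nc by (simp add: \<sigma>_sum \<sigma>_mult \<sigma>_of_rat \<sigma>_zeta K_closed)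
    also have "norm \<dots> \<le> (\<Sum>k<p. norm (of_rat (d k) * \<zeta> ^ (c * k)))" by (rule norm_sum)
    also have "\<dots> \<le> (\<Sum>k<p. 1 / (2 * real p))"
    proof (rule sum_mono)
      fix k assume "k \<in> {..<p}"
      hence "\<bar>d k\<bar> \<le> 1 / of_nat (2 * p)" using assms(2)[of k] by simp
      hence "real_of_rat \<bar>d k\<bar> \<le> real_of_rat (1 / of_nat (2 * p))" by (simp only: of_rat_less_eq)
      thus "norm (of_rat (d k) * \<zeta> ^ (c * k)) \<le> 1 / (2 * real p)"
        by (simp add: norm_mult norm_zeta_power norm_of_rat_complex of_rat_divide of_rat_mult)
    qed
    also have "\<dots> = 1 / 2" using p3 by simp
    finally show ?thesis .
  qed
  have "norm (Nm y) = (\<Prod>c\<in>G. norm (\<sigma> c y))" by (simp add: Nm_def prod_norm)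
  also have "\<dots> \<le> (\<Prod>c\<in>G. 1 / 2)" using le by (intro prod_mono) auto
  also have "\<dots> = (1 / 2) ^ card G" by simp
  also have "\<dots> \<le> (1 / 2) ^ 1" using p3 by (intro power_decreasing) (auto simp: G_def)
  finally show ?thesis by simp
qed

text \<open>Pigeonhole on the fractional parts of the coordinates of the multiples of \<open>x\<close>.\<close>

lemma hurwitz:
  obtains M :: nat where "M > 0"
    "\<And>x. x \<in> K \<Longrightarrow> \<exists>t\<in>{1..M}. \<exists>w\<in>OK. norm (Nm (of_nat t * x - w)) < 1"
proof
  \<comment> \<open>Boxes of side \<open>1 / (2 * p)\<close> are what \<open>small_norm\<close> asks
    for. There are \<open>n ^ p\<close> of them, against the \<open>n ^ p + 1\<close> multiples with
    factors from 0 to \<open>n ^ p\<close>.\<close>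
  define n where "n = 2 * p"
  have n0: "n > 0" using p3 by (simp add: n_def)
  show "n ^ p > 0" using n0 by simp
  fix x assume x: "x \<in> K"
  obtain r :: "nat \<Rightarrow> rat" where r: "x = (\<Sum>k<p. of_rat (r k) * \<zeta> ^ k)" using K_coords[OF x] .
  define \<phi> where "\<phi> t = (\<lambda>k\<in>{..<p}. \<lfloor>of_nat n * frac (of_nat t * r k)\<rfloor>)" for t :: nat
  define B where "B = (\<Pi>\<^sub>E k\<in>{..<p}. {0..<int n})"
  have finB: "finite B" unfolding B_def by (intro finite_PiE) auto
  have "\<phi> t \<in> B" for t
  proof -
    have "0 \<le> \<lfloor>of_nat n * frac (of_nat t * r k)\<rfloor> \<and> \<lfloor>of_nat n * frac (of_nat t * r k)\<rfloor> < int n" for k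
    proof -
      have "of_nat n * frac (of_nat t * r k) < of_nat n * 1"
        using n0 frac_lt_1 by (intro mult_strict_left_mono) auto
      moreover have "0 \<le> of_nat n * frac (of_nat t * r k)" by simp
      ultimately show ?thesis by (simp add: floor_less_iff)
    qed
    thus ?thesis by (auto simp: \<phi>_def B_def)
  qed
  hence "card (\<phi> ` {0..n ^ p}) \<le> card B" using finB by (intro card_mono) auto
  also have "card B = n ^ p" by (simp add: B_def card_PiE)
  finally have "\<not> inj_on \<phi> {0..n ^ p}" by (intro pigeonhole) simp
  then obtain a b where ab: "a \<in> {0..n ^ p}" "b \<in> {0..n ^ p}" "\<phi> a = \<phi> b" "a \<noteq> b"
    by (auto simp: inj_on_def)
  define s where "s = min a b"
  define t where "t = max a b"
  have st: "s < t" "t \<le> n ^ p" "\<phi> t = \<phi> s" using ab by (auto simp: s_def t_def min_def max_def)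
  define d where "d k = frac (of_nat t * r k) - frac (of_nat s * r k)" for k
  define w where "w = (\<Sum>k<p. of_int (\<lfloor>of_nat t * r k\<rfloor> - \<lfloor>of_nat s * r k\<rfloor>) * \<zeta> ^ k)"
  have w: "w \<in> OK" unfolding w_def by (rule int_comb_OK)
  have dk: "\<bar>d k\<bar> < 1 / of_nat (2 * p)" if "k < p" for k
  proof -
    have "\<lfloor>of_nat n * frac (of_nat t * r k)\<rfloor> = \<lfloor>of_nat n * frac (of_nat s * r k)\<rfloor>"
      using fun_cong[OF st(3), of k] that by (simp add: \<phi>_def)
    from abs_diff_less_if_floor_eq[OF this n0] show ?thesis by (simp add: d_def n_def)
  qed
  have e: "of_nat (t - s) * of_rat (r k) - of_int (\<lfloor>of_nat t * r k\<rfloor> - \<lfloor>of_nat s * r k\<rfloor>) =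
      (of_rat (d k) :: complex)" for k
  proof -
    have "of_nat (t - s) * r k - of_int (\<lfloor>of_nat t * r k\<rfloor> - \<lfloor>of_nat s * r k\<rfloor>) = d k"
      using st(1) by (simp add: d_def frac_def of_nat_diff left_diff_distrib)
    hence "(of_rat (of_nat (t - s) * r k - of_int (\<lfloor>of_nat t * r k\<rfloor> - \<lfloor>of_nat s * r k\<rfloor>)) :: complex) = of_rat (d k)"
      by simp
    thus ?thesis by (simp only: of_rat_diff of_rat_mult of_rat_of_nat_eq of_rat_of_int_eq)
  qed
  have "of_nat (t - s) * x - w = (\<Sum>k<p. of_rat (d k) * \<zeta> ^ k)"
    unfolding r w_def sum_distrib_left sum_subtractf[symmetric]
    by (intro sum.cong refl) (simp only: e[symmetric] left_diff_distrib mult.assoc)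
  from small_norm[OF this dk] have "norm (Nm (of_nat (t - s) * x - w)) < 1" .
  moreover have "t - s \<in> {1..n ^ p}" using st by auto
  ultimately show "\<exists>t\<in>{1..n ^ p}. \<exists>w\<in>OK. norm (Nm (of_nat t * x - w)) < 1" using w by blast
qed

text \<open>Euclidean division with a multiplier. For \<open>b\<close> of least norm the remainder
  \<open>t * x - w * b\<close> has smaller norm and so vanishes. Taking \<open>F = fact M\<close>, a
  multiple of every possible \<open>t\<close>, makes the multiplier independent of \<open>x\<close>
  and of the ideal.\<close>

lemma hurwitz_ideal:
  obtains F :: nat where "F > 0"
    "\<And>I. nz_ideal I \<Longrightarrow> \<exists>b\<in>I. b \<noteq> 0 \<and> (\<forall>x\<in>I. \<exists>w\<in>OK. of_nat F * x = w * b)"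
proof -
  obtain M :: nat where M: "M > 0"
    "\<And>x. x \<in> K \<Longrightarrow> \<exists>t\<in>{1..M}. \<exists>w\<in>OK. norm (Nm (of_nat t * x - w)) < 1"
    using hurwitz by blast
  have "\<exists>b\<in>I. b \<noteq> 0 \<and> (\<forall>x\<in>I. \<exists>w\<in>OK. of_nat (fact M) * x = w * b)" if I: "nz_ideal I" for I
  proof -
    have om: "OK_module I" and IO: "I \<subseteq> OK" using I by (auto simp: nz_ideal_def)
    define nn where "nn b = nat \<lfloor>norm (Nm b)\<rfloor>" for b
    have nn: "real (nn b) = norm (Nm b)" if "b \<in> OK" for b
    proof -
      obtain k where "Nm b = of_int k" using Nm_int[OF \<open>b \<in> OK\<close>] by (auto elim: Ints_cases)
      thus ?thesis by (simp add: nn_def)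
    qed
    obtain b0 where "b0 \<in> I \<and> b0 \<noteq> 0" using frac_ideal_nonzero_elem[OF nz_ideal_frac_ideal[OF I]] by auto
    then obtain b where b: "b \<in> I" "b \<noteq> 0" "\<And>y. y \<in> I \<Longrightarrow> y \<noteq> 0 \<Longrightarrow> nn b \<le> nn y"
      using ex_has_least_nat[of "\<lambda>b. b \<in> I \<and> b \<noteq> 0" b0 nn] by blast
    have bO: "b \<in> OK" using b IO by auto
    have "\<exists>w\<in>OK. of_nat (fact M) * x = w * b" if x: "x \<in> I" for x
    proof -
      have xO: "x \<in> OK" using x IO by auto
      obtain t w where tw: "t \<in> {1..M}" "w \<in> OK" "norm (Nm (of_nat t * (x / b) - w)) < 1"
        using M(2)[of "x / b"] K_closed(11)[OF OK_K[OF xO] OK_K[OF bO]] by blast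
      define y where "y = of_nat t * x - w * b"
      have yI: "y \<in> I" unfolding y_def
        by (intro OK_module_diff om OK_moduleD(3)[OF om] x b OK_closed tw)
      have yb: "y = (of_nat t * (x / b) - w) * b" using b(2) by (simp add: y_def field_simps)
      have zK: "of_nat t * (x / b) - w \<in> K"
        by (intro K_closed OK_K xO bO tw)
      have "y = 0"
      proof (rule ccontr)
        assume "y \<noteq> 0"
        hence "nn b \<le> nn y" using b(3) yI by blast
        hence "norm (Nm b) \<le> norm (Nm y)" using nn[of b] nn[of y] bO yI IO by fastforce
        also have "norm (Nm y) = norm (Nm (of_nat t * (x / b) - w)) * norm (Nm b)"
          unfolding yb Nm_mult[OF zK OK_K[OF bO]] by (rule norm_mult)
        also have "\<dots> < 1 * norm (Nm b)"
          using tw(3) Nm_nonzero[OF OK_K[OF bO] b(2)] by (intro mult_strict_right_mono) auto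
        finally show False by simp
      qed
      hence tx: "of_nat t * x = w * b" by (simp add: y_def)
      have "t dvd fact M" using tw(1) by (intro dvd_fact) auto
      then obtain k where "fact M = t * k" by blast
      hence "of_nat (fact M) * x = of_nat k * (of_nat t * x)" by (simp del: of_nat_fact)
      also have "\<dots> = (of_nat k * w) * b" by (simp add: tx)
      finally show ?thesis using tw(2) OK_closed(4,9) by blast
    qed
    thus ?thesis using b by blast
  qed
  moreover have "(fact M :: nat) > 0" by simp
  ultimately show ?thesis using that by blast
qed

text \<open>An integral multiple of the ideal, scaled by \<open>F / b\<close>, stays in
  \<open>OK\<close> and contains \<open>F\<close>; only finitely many ideals contain
  \<open>F\<close>.\<close>

lemma finite_class_representatives:
  obtains S where "finite S" "\<And>J. J \<in> S \<Longrightarrow> nz_ideal J"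
    "\<And>I. frac_ideal I \<Longrightarrow> \<exists>a\<in>K. a \<noteq> 0 \<and> sc a I \<in> S"
proof -
  obtain F :: nat where F: "F > 0"
    "\<And>I. nz_ideal I \<Longrightarrow> \<exists>b\<in>I. b \<noteq> 0 \<and> (\<forall>x\<in>I. \<exists>w\<in>OK. of_nat F * x = w * b)"
    using hurwitz_ideal by blast
  define S where "S = {J. nz_ideal J \<and> of_nat F \<in> J}"
  have rep: "\<exists>a\<in>K. a \<noteq> 0 \<and> sc a I \<in> S" if fI: "frac_ideal I" for I
  proof -
    obtain d where d: "d \<in> OK" "d \<noteq> 0" "nz_ideal (sc d I)" using frac_ideal_nz_ideal[OF fI] .
    define I' where "I' = sc d I"
    have I': "nz_ideal I'" using d by (simp add: I'_def)
    obtain b where b: "b \<in> I'" "b \<noteq> 0" "\<And>x. x \<in> I' \<Longrightarrow> \<exists>w\<in>OK. of_nat F * x = w * b"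
      using F(2)[OF I'] by blast
    have bK: "b \<in> K" using b(1) I' by (auto simp: nz_ideal_def OK_K)
    define a where "a = of_nat F / b"
    have a: "a \<in> K" "a \<noteq> 0" using bK b(2) F(1) by (auto simp: a_def intro: K_closed)
    have sub: "sc a I' \<subseteq> OK"
    proof
      fix y assume "y \<in> sc a I'"
      then obtain x where x: "x \<in> I'" "y = a * x" by blast
      then obtain w where "w \<in> OK" "of_nat F * x = w * b" using b(3) by blast
      thus "y \<in> OK" using x b(2) by (simp add: a_def)
    qed
    have F': "of_nat F \<in> sc a I'" using imageI[OF b(1), of "\<lambda>x. a * x"] b(2) by (simp add: a_def)
    have "frac_ideal (sc a I')" using frac_ideal_sc[OF nz_ideal_frac_ideal[OF I'] a] .
    hence "sc a I' \<in> S" using sub F' by (simp add: S_def nz_ideal_def frac_ideal_def)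
    hence "sc (a * d) I \<in> S" by (simp add: I'_def sc_sc)
    thus ?thesis using a d by (intro bexI[of _ "a * d"]) (auto intro: K_closed OK_K)
  qed
  show ?thesis
  proof (rule that[of S])
    show "finite S" unfolding S_def by (rule finite_ideals_containing[OF F(1)])
    show "nz_ideal J" if "J \<in> S" for J using that by (simp add: S_def)
    show "\<exists>a\<in>K. a \<noteq> 0 \<and> sc a I \<in> S" if "frac_ideal I" for I by (rule rep[OF that])
  qed
qed

section \<open>Invertibility of fractional ideals\<close>

primrec ideal_pow :: "complex set \<Rightarrow> nat \<Rightarrow> complex set" where
  "ideal_pow I 0 = OK"
| "ideal_pow I (Suc n) = ip I (ideal_pow I n)"

lemma OK_module_ideal_pow: "OK_module I \<Longrightarrow> OK_module (ideal_pow I n)"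
  by (induction n) (auto intro: OK_module_OK OK_module_ip)

lemma nz_ideal_ideal_pow: "nz_ideal I \<Longrightarrow> nz_ideal (ideal_pow I n)"
  by (induction n) (auto intro: nz_ideal_OK nz_ideal_ip)

lemma ideal_pow_add: "OK_module I \<Longrightarrow> ideal_pow I (m + n) = ip (ideal_pow I m) (ideal_pow I n)"
  by (induction m) (auto simp: ip_OK OK_module_ideal_pow ip_assoc)

text \<open>By finiteness two powers of \<open>A\<close> lie in the same class, say
  \<open>c * A ^ l = A ^ k\<close>. Then \<open>D = c * A ^ (l - k)\<close> satisfies
  \<open>D * A ^ k = A ^ k\<close>: its elements stabilize an ideal, so they are integral, and
  \<open>nakayama\<close> puts 1 into \<open>D\<close>. Thus \<open>D = OK\<close>, and splitting
  off one factor \<open>A\<close> exhibits its inverse.\<close>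

lemma nz_ideal_inverse:
  assumes A: "nz_ideal A"
  obtains B where "frac_ideal B" "ip A B = OK"
proof -
  have om: "OK_module A" using A by (simp add: nz_ideal_def)
  obtain S where S: "finite S" "\<And>J. J \<in> S \<Longrightarrow> nz_ideal J"
    "\<And>I. frac_ideal I \<Longrightarrow> \<exists>a\<in>K. a \<noteq> 0 \<and> sc a I \<in> S"
    using finite_class_representatives by blast
  have "\<forall>k. \<exists>a. a \<in> K \<and> a \<noteq> 0 \<and> sc a (ideal_pow A k) \<in> S"
    using S(3)[OF nz_ideal_frac_ideal[OF nz_ideal_ideal_pow[OF A]]] by blast
  then obtain a where a: "\<And>k. a k \<in> K" "\<And>k. a k \<noteq> 0" "\<And>k. sc (a k) (ideal_pow A k) \<in> S" by metis
  define g where "g k = sc (a k) (ideal_pow A k)" for k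
  have "range g \<subseteq> S" using a(3) by (auto simp: g_def)
  hence "finite (range g)" using S(1) finite_subset by blast
  hence "\<not> inj g" using finite_imageD infinite_UNIV_nat by blast
  then obtain i j where ij: "g i = g j" "i \<noteq> j" by (auto simp: inj_on_def)
  define k where "k = min i j"
  define l where "l = max i j"
  have kl: "k < l" "g l = g k" using ij by (auto simp: k_def l_def min_def max_def)
  \<comment> \<open>One factor \<open>A\<close> is reserved, so that
    \<open>sc c (ideal_pow A m)\<close> becomes the inverse.\<close>
  define m where "m = l - k - 1"
  have lkm: "l = k + Suc m" using kl(1) by (simp add: m_def)
  define c where "c = a l / a k"
  have c: "c \<in> K" "c \<noteq> 0" using a by (auto simp: c_def intro: K_closed)
  have "sc (inverse (a k)) (sc (a l) (ideal_pow A l)) = sc (inverse (a k)) (sc (a k) (ideal_pow A k))"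
    using kl(2) by (simp add: g_def)
  hence ck: "sc c (ideal_pow A l) = ideal_pow A k"
    unfolding sc_sc using a(2) by (simp add: c_def divide_inverse mult.commute)
  define C where "C = ideal_pow A k"
  have C: "nz_ideal C" using nz_ideal_ideal_pow[OF A] by (simp add: C_def)
  define D where "D = sc c (ideal_pow A (Suc m))"
  have omD: "OK_module D" unfolding D_def by (intro OK_module_sc OK_module_ideal_pow om)
  have CD: "ip D C = C"
  proof -
    have "ip D C = sc c (ip (ideal_pow A k) (ideal_pow A (Suc m)))"
      unfolding D_def C_def ip_sc_left by (simp only: ip_commute)
    also have "\<dots> = sc c (ideal_pow A l)" unfolding lkm by (simp only: ideal_pow_add[OF om])
    finally show ?thesis using ck by (simp add: C_def)
  qed
  have "D \<subseteq> OK"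
  proof
    fix d assume d: "d \<in> D"
    have "d * x \<in> C" if "x \<in> C" for x using ip_mem[OF d that] CD by simp
    hence "algebraic_int d" using stabilizer_integral[OF C] by blast
    moreover have "d \<in> K"
      using d frac_ideal_K[OF frac_ideal_sc[OF nz_ideal_frac_ideal[OF nz_ideal_ideal_pow[OF A]] c]] unfolding D_def by blast
    ultimately show "d \<in> OK" by (simp add: OK_iff)
  qed
  hence "1 \<in> D" using nakayama[OF C omD] CD by simp
  hence "OK \<subseteq> D" using OK_moduleD(3)[OF omD, of _ 1] by auto
  with \<open>D \<subseteq> OK\<close> have "D = OK" by simp
  hence "ip A (sc c (ideal_pow A m)) = OK" by (simp add: D_def ip_sc_right)
  moreover have "frac_ideal (sc c (ideal_pow A m))" by (intro frac_ideal_sc c nz_ideal_frac_ideal nz_ideal_ideal_pow A)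
  ultimately show ?thesis using that by blast
qed

lemma frac_ideal_inverse:
  assumes "frac_ideal I"
  obtains J where "frac_ideal J" "ip I J = OK"
proof -
  obtain d where d: "d \<in> OK" "d \<noteq> 0" "nz_ideal (sc d I)" using frac_ideal_nz_ideal[OF assms] .
  obtain B where B: "frac_ideal B" "ip (sc d I) B = OK" using nz_ideal_inverse[OF d(3)] .
  have "ip I (sc d B) = OK" using B(2) by (simp add: ip_sc_left ip_sc_right)
  moreover have "frac_ideal (sc d B)" using frac_ideal_sc[OF B(1) OK_K[OF d(1)] d(2)] .
  ultimately show ?thesis using that by blast
qed

lemma frac_ideal_ip:
  assumes "frac_ideal I" "frac_ideal J"
  shows "frac_ideal (ip I J)"
proof -
  obtain d where d: "d \<in> OK" "d \<noteq> 0" "nz_ideal (sc d I)" using frac_ideal_nz_ideal[OF assms(1)] .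
  obtain e where e: "e \<in> OK" "e \<noteq> 0" "nz_ideal (sc e J)" using frac_ideal_nz_ideal[OF assms(2)] .
  have "frac_ideal (ip (sc d I) (sc e J))" using nz_ideal_frac_ideal[OF nz_ideal_ip[OF d(3) e(3)]] .
  also have "ip (sc d I) (sc e J) = sc (d * e) (ip I J)" by (simp only: ip_sc_left ip_sc_right sc_sc mult.commute[of e d])
  finally have 1: "frac_ideal (sc (d * e) (ip I J))" .
  have 2: "inverse (d * e) \<in> K" by (intro K_closed(10) OK_K OK_closed(9) d e)
  have 3: "inverse (d * e) \<noteq> 0" using d e by simp
  have "inverse (d * e) * (d * e) = 1" using d e by (intro left_inverse) simp
  with frac_ideal_sc[OF 1 2 3] show ?thesis by (simp only: sc_sc sc_1)
qed

end

section \<open>Units and powers modulo \<open>q\<close>\<close>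

context prime_cyclotomic
begin

text \<open>Congruences modulo \<open>m\<close> in the ring of integers are written as
  \<open>odvd m\<close> of a difference.\<close>

definition odvd :: "complex \<Rightarrow> complex \<Rightarrow> bool" where
  "odvd m a \<longleftrightarrow> (\<exists>w\<in>OK. a = m * w)"

lemma odvdI: "w \<in> OK \<Longrightarrow> a = m * w \<Longrightarrow> odvd m a"
  by (auto simp: odvd_def)

lemma odvd_0: "odvd m 0"
  by (rule odvdI[OF OK_closed(1)]) simp

lemma odvd_self: "w \<in> OK \<Longrightarrow> odvd m (m * w)"
  by (rule odvdI) auto

lemma odvd_add: "odvd m a \<Longrightarrow> odvd m b \<Longrightarrow> odvd m (a + b)"
  unfolding odvd_def by (metis OK_closed(7) distrib_left)

lemma odvd_minus: "odvd m a \<Longrightarrow> odvd m (- a)"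
  unfolding odvd_def by (metis OK_closed(6) mult_minus_right)

lemma odvd_diff: "odvd m a \<Longrightarrow> odvd m b \<Longrightarrow> odvd m (a - b)"
  using odvd_add[of m a "- b"] odvd_minus[of m b] by simp

lemma odvd_mult: "odvd m a \<Longrightarrow> b \<in> OK \<Longrightarrow> odvd m (a * b)"
  unfolding odvd_def by (metis OK_closed(9) mult.assoc)

lemma odvd_mult': "odvd m a \<Longrightarrow> b \<in> OK \<Longrightarrow> odvd m (b * a)"
  using odvd_mult by (simp add: mult.commute)

lemma odvd_sum: "(\<And>i. i \<in> A \<Longrightarrow> odvd m (f i)) \<Longrightarrow> odvd m (\<Sum>i\<in>A. f i)"
  by (induction A rule: infinite_finite_induct) (auto intro: odvd_0 odvd_add)

lemma odvd_trans: "odvd m a \<Longrightarrow> odvd a b \<Longrightarrow> odvd m b"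
  unfolding odvd_def by (metis OK_closed(9) mult.assoc)

lemma odvd_\<sigma>: "odvd (of_nat n) a \<Longrightarrow> \<not> p dvd c \<Longrightarrow> odvd (of_nat n) (\<sigma> c a)"
  unfolding odvd_def using OK_\<sigma> by (auto simp: \<sigma>_mult \<sigma>_of_nat K_closed OK_K)

lemma odvd_int: "int n dvd k \<Longrightarrow> odvd (of_nat n) (of_int k)"
  by (rule odvdI[of "of_int (k div int n)"]) (auto intro: OK_closed)

lemma odvd_int_cancel:
  assumes "odvd (of_nat n) (of_int k)" "n > 0"
  shows "int n dvd k"
proof -
  obtain w where w: "w \<in> OK" "of_int k = of_nat n * w" using assms(1) by (auto simp: odvd_def)
  hence "of_int k / of_int (int n) = w" using assms(2) by simp
  moreover have "algebraic_int w" using w by (simp add: OK_iff)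
  ultimately show ?thesis using assms(2) by (intro int_dvd_if_algebraic_int) auto
qed

lemma odvd_coprime_cancel:
  assumes "odvd (of_nat n) (of_int k * a)" "coprime (int n) k" "a \<in> OK"
  shows "odvd (of_nat n) a"
proof -
  obtain u v where uv: "u * int n + v * k = 1" using bezout_int[of "int n" k] assms(2) by auto
  have "a = of_int (u * int n + v * k) * a" by (simp add: uv)
  also have "\<dots> = of_nat n * (of_int u * a) + of_int v * (of_int k * a)" by (simp add: algebra_simps)
  also have "odvd (of_nat n) \<dots>"
    by (intro odvd_add odvd_self odvd_mult' assms OK_closed)
  finally show ?thesis .
qed

lemma freshman:
  assumes "prime q" "a \<in> OK" "b \<in> OK"
  shows "odvd (of_nat q) ((a + b) ^ q - (a ^ q + b ^ q))"
proof -
  have q: "q \<ge> 2" using assms(1) prime_ge_2_nat by blast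
  have "(a + b) ^ q = (\<Sum>k\<le>q. of_nat (q choose k) * a ^ k * b ^ (q - k))" by (rule binomial_ring)
  also have "{..q} = insert 0 (insert q {1..<q})" using q by auto
  also have "(\<Sum>k\<in>\<dots>. of_nat (q choose k) * a ^ k * b ^ (q - k)) =
      b ^ q + (a ^ q + (\<Sum>k\<in>{1..<q}. of_nat (q choose k) * a ^ k * b ^ (q - k)))"
    using q by (subst sum.insert; simp)+
  finally have "(a + b) ^ q - (a ^ q + b ^ q) = (\<Sum>k\<in>{1..<q}. of_nat (q choose k) * a ^ k * b ^ (q - k))"
    by simp
  moreover have "odvd (of_nat q) (\<Sum>k\<in>{1..<q}. of_nat (q choose k) * a ^ k * b ^ (q - k))"
  proof (rule odvd_sum)
    fix k assume that: "k \<in> {1..<q}"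
    have "q dvd q choose k" using that assms(1) by (intro dvd_choose_prime) auto
    hence "odvd (of_nat q) (of_nat (q choose k))" using odvd_int[of q "int (q choose k)"] by simp
    thus "odvd (of_nat q) (of_nat (q choose k) * a ^ k * b ^ (q - k))"
      using assms by (intro odvd_mult OK_closed)
  qed
  ultimately show ?thesis by (simp only:)
qed

lemma freshman_sum:
  assumes "prime q" "finite A" "\<And>i. i \<in> A \<Longrightarrow> f i \<in> OK"
  shows "odvd (of_nat q) ((\<Sum>i\<in>A. f i) ^ q - (\<Sum>i\<in>A. f i ^ q))"
  using assms(2,3)
proof (induction A)
  case empty
  have "q > 0" using assms(1) prime_gt_0_nat by blast
  thus ?case by (simp add: odvd_0 zero_power)
next
  case (insert i A)
  have "odvd (of_nat q) (((f i + sum f A) ^ q - (f i ^ q + sum f A ^ q)) + (sum f A ^ q - (\<Sum>i\<in>A. f i ^ q)))"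
    using insert by (intro odvd_add freshman assms(1) OK_sum) auto
  thus ?case using insert by (simp add: algebra_simps)
qed

text \<open>\<open>OK\<close> modulo \<open>q\<close> is reduced, that is, \<open>q\<close> is
  unramified. On \<open>w = p * z\<close>, which has integer coordinates, the \<open>q\<close>-th
  power agrees modulo \<open>q\<close> with the automorphism \<open>\<sigma> q\<close>; so
  \<open>q\<close> divides \<open>\<sigma> q w\<close>, and applying the inverse automorphism gives
  \<open>w\<close>. Finally \<open>p\<close> is invertible modulo \<open>q\<close>.\<close>

lemma reduced_mod_prime:
  assumes q: "prime q" "q \<noteq> p" and z: "z \<in> OK" "odvd (of_nat q) (z ^ q)"
  shows "odvd (of_nat q) z"
proof -
  define w where "w = of_nat p * z"
  have qp: "\<not> p dvd q" using q p(1) primes_dvd_imp_eq by blast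
  have wt: "w = (\<Sum>k<p. of_int (trace_coord k z) * \<zeta> ^ k)" unfolding w_def by (rule trace_coord_expansion[OF z(1)])
  have wO: "w \<in> OK" unfolding wt by (rule int_comb_OK)
  have "odvd (of_nat q) (w ^ q)"
    unfolding w_def power_mult_distrib by (intro odvd_mult' z OK_closed)
  moreover have "odvd (of_nat q) (w ^ q - (\<Sum>k<p. (of_int (trace_coord k z) * \<zeta> ^ k) ^ q))"
    unfolding wt by (intro freshman_sum q OK_closed) auto
  ultimately have "odvd (of_nat q) (w ^ q - (w ^ q - (\<Sum>k<p. (of_int (trace_coord k z) * \<zeta> ^ k) ^ q)))"
    by (rule odvd_diff)
  moreover have "odvd (of_nat q) ((\<Sum>k<p. (of_int (trace_coord k z) * \<zeta> ^ k) ^ q) - \<sigma> q w)"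
  proof -
    have "\<sigma> q w = (\<Sum>k<p. of_int (trace_coord k z) * \<zeta> ^ (q * k))"
      unfolding wt using qp by (simp add: \<sigma>_sum \<sigma>_mult \<sigma>_of_int \<sigma>_zeta K_closed)
    moreover have "(\<Sum>k<p. (of_int (trace_coord k z) * \<zeta> ^ k) ^ q) = (\<Sum>k<p. of_int (trace_coord k z ^ q) * \<zeta> ^ (q * k))"
      by (simp add: power_mult_distrib power_mult[symmetric] mult.commute)
    ultimately have "(\<Sum>k<p. (of_int (trace_coord k z) * \<zeta> ^ k) ^ q) - \<sigma> q w =
        (\<Sum>k<p. of_int (trace_coord k z ^ q - trace_coord k z) * \<zeta> ^ (q * k))"
      by (simp add: sum_subtractf left_diff_distrib)
    also have "odvd (of_nat q) \<dots>"
      by (intro odvd_sum odvd_mult odvd_int int_fermat q OK_closed)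
    finally show ?thesis .
  qed
  ultimately have "odvd (of_nat q) ((w ^ q - (w ^ q - (\<Sum>k<p. (of_int (trace_coord k z) * \<zeta> ^ k) ^ q))) -
      ((\<Sum>k<p. (of_int (trace_coord k z) * \<zeta> ^ k) ^ q) - \<sigma> q w))"
    by (rule odvd_diff)
  hence "odvd (of_nat q) (\<sigma> q w)" by simp
  moreover obtain d where d: "\<not> p dvd d" "\<And>x. x \<in> K \<Longrightarrow> \<sigma> d (\<sigma> q x) = x"
    using \<sigma>_inv[OF qp] by metis
  ultimately have "odvd (of_nat q) w" using odvd_\<sigma>[of q "\<sigma> q w" d] OK_K[OF wO] by simp
  hence "odvd (of_nat q) (of_int (int p) * z)" by (simp add: w_def)
  moreover have "coprime (int q) (int p)"
    using q p(1) by (simp add: primes_coprime)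
  ultimately show ?thesis using z(1) by (rule odvd_coprime_cancel)
qed

text \<open>The middle binomial coefficients contain \<open>q\<close>, and \<open>q \<ge> 3\<close>
  puts \<open>q ^ 3\<close> into the last term. The factor \<open>v\<close> stays in front so that
  \<open>(1 + q * v) ^ q = 1\<close> forces \<open>v = 0\<close>.\<close>

lemma one_plus_power_prime:
  assumes q: "prime q" "odd q" and v: "v \<in> OK"
  shows "\<exists>u\<in>OK. (1 + of_nat q * v) ^ q = 1 + of_nat q ^ 2 * v * (1 + of_nat q * u)"
proof -
  have q3: "q \<ge> 3"
  proof -
    have "q \<noteq> 2" using q by auto
    thus ?thesis using prime_ge_2_nat[OF q(1)] by auto
  qed
  define y where "y = of_nat q * v"
  have yO: "y \<in> OK" using v by (auto simp: y_def intro: OK_closed)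
  have "(y + 1) ^ q = (\<Sum>k\<le>q. of_nat (q choose k) * y ^ k * 1 ^ (q - k))" by (rule binomial_ring)
  also have "\<dots> = (\<Sum>k\<le>q. of_nat (q choose k) * y ^ k)" by simp
  also have "{..q} = insert 0 (insert 1 (insert q {2..<q}))" using q3 by auto
  also have "(\<Sum>k\<in>\<dots>. of_nat (q choose k) * y ^ k) =
      1 + (of_nat q * y + (y ^ q + (\<Sum>k\<in>{2..<q}. of_nat (q choose k) * y ^ k)))"
    using q3 by (subst sum.insert; simp)+
  also have "(\<Sum>k\<in>{2..<q}. of_nat (q choose k) * y ^ k) =
      (\<Sum>k\<in>{2..<q}. (of_nat q * y ^ 2) * (of_nat ((q choose k) div q) * y ^ (k - 2)))"
  proof (intro sum.cong refl)
    fix k assume k: "k \<in> {2..<q}"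
    have "q dvd q choose k" using k q(1) by (intro dvd_choose_prime) auto
    hence "(of_nat (q choose k) :: complex) = of_nat q * of_nat ((q choose k) div q)"
      by (metis dvd_mult_div_cancel of_nat_mult)
    moreover have "k = 2 + (k - 2)" using k by (intro le_add_diff_inverse[symmetric]) simp
    hence "y ^ k = y ^ 2 * y ^ (k - 2)" by (metis power_add)
    ultimately show "of_nat (q choose k) * y ^ k =
        (of_nat q * y ^ 2) * (of_nat ((q choose k) div q) * y ^ (k - 2))" by simp
  qed
  also have "\<dots> = (of_nat q * y ^ 2) * (\<Sum>k\<in>{2..<q}. of_nat ((q choose k) div q) * y ^ (k - 2))"
    by (simp only: sum_distrib_left)
  finally have e: "(1 + y) ^ q = 1 + of_nat q * y + y ^ q +
      (of_nat q * y ^ 2) * (\<Sum>k\<in>{2..<q}. of_nat ((q choose k) div q) * y ^ (k - 2))"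
    by (simp add: add.assoc add.commute[of y])
  define w where "w = (\<Sum>k\<in>{2..<q}. of_nat ((q choose k) div q) * y ^ (k - 2))"
  have wO: "w \<in> OK" unfolding w_def by (intro OK_sum OK_closed yO)
  define u where "u = of_nat q ^ (q - 3) * v ^ (q - 1) + v * w"
  have uO: "u \<in> OK" unfolding u_def by (intro OK_closed v wO)
  have "y ^ q = of_nat q ^ 3 * of_nat q ^ (q - 3) * (v * v ^ (q - 1))"
    using q3 by (simp add: y_def power_mult_distrib power_add[symmetric] power_Suc[symmetric] del: power_Suc)
  hence "(1 + y) ^ q = 1 + of_nat q ^ 2 * v * (1 + of_nat q * u)"
    unfolding e w_def[symmetric] u_def
    by (simp add: y_def algebra_simps power2_eq_square power3_eq_cube)
  thus ?thesis using uO by (auto simp: y_def)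
qed

lemma not_unit_prime:
  assumes "u \<in> OK" "of_nat q * u = 1"
  shows "q = 1"
proof -
  have "odvd (of_nat q) (of_int 1)" using assms by (intro odvdI[of u]) auto
  moreover have "q > 0" using assms(2) by (cases q) auto
  ultimately have "int q dvd 1" by (rule odvd_int_cancel)
  thus ?thesis by simp
qed

text \<open>Modulo \<open>q\<close> the \<open>q\<close>-th power of \<open>w - 1\<close> vanishes,
  so \<open>w = 1 + q * v\<close> by reducedness. Expanding \<open>w ^ q = 1\<close> leaves
  \<open>v * (1 + q * u) = 0\<close>, and the second factor is nonzero because \<open>q\<close> is
  not a unit.\<close>

lemma no_root_of_unity:
  assumes q: "prime q" "odd q" "q \<noteq> p" and w: "w \<in> K" "w ^ q = 1"
  shows "w = 1"
proof -
  have q0: "q > 0" using q(1) prime_gt_0_nat by blast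
  have wO: "w \<in> OK" using w algebraic_int_if_power[of w q] q0 by (simp add: OK_iff)
  have "odvd (of_nat q) ((w + (- 1)) ^ q - (w ^ q + (- 1) ^ q))"
    by (intro freshman q wO OK_closed)
  hence "odvd (of_nat q) ((w - 1) ^ q)" using w(2) q(2) by simp
  hence "odvd (of_nat q) (w - 1)"
    by (rule reduced_mod_prime[OF q(1,3) OK_closed(8)[OF wO OK_closed(2)]])
  then obtain v where v: "v \<in> OK" "w - 1 = of_nat q * v" by (auto simp: odvd_def)
  hence wv: "w = 1 + of_nat q * v" by (simp add: algebra_simps)
  obtain u where u: "u \<in> OK" "(1 + of_nat q * v) ^ q = 1 + of_nat q ^ 2 * v * (1 + of_nat q * u)"
    using one_plus_power_prime[OF q(1,2) v(1)] by blast
  have "of_nat q ^ 2 * v * (1 + of_nat q * u) = 0" using u(2) w(2) wv by simp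
  moreover have "1 + of_nat q * u \<noteq> 0"
  proof
    assume "1 + of_nat q * u = 0"
    hence "of_nat q * (- u) = 1" by (simp add: algebra_simps add_eq_0_iff)
    hence "q = 1" using not_unit_prime[of "- u" q] u(1) OK_closed(6) by blast
    thus False using q(1) by auto
  qed
  ultimately have "v = 0" using q0 by simp
  thus ?thesis using wv by simp
qed

section \<open>Kronecker's theorem and units modulo conjugation\<close>

lemma norm_\<sigma>_sum_bound:
  assumes "x \<in> K" "\<And>c. c \<in> G \<Longrightarrow> norm (\<sigma> c x) = 1"
  shows "norm (Tr (x * \<zeta> ^ k)) \<le> real p"
proof -
  have "Tr (x * \<zeta> ^ k) = (\<Sum>c\<in>G. \<sigma> c x * \<zeta> ^ (c * k))"
    unfolding Tr_def using assms(1) by (intro sum.cong refl) (simp add: \<sigma>_mult \<sigma>_zeta G_not_dvd K_zeta)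
  also have "norm \<dots> \<le> (\<Sum>c\<in>G. norm (\<sigma> c x * \<zeta> ^ (c * k)))" by (rule norm_sum)
  also have "\<dots> = real (card G)" by (simp add: norm_mult norm_zeta_power assms(2))
  also have "\<dots> \<le> real p" by (simp add: G_def)
  finally show ?thesis .
qed

text \<open>All powers of \<open>x\<close> have conjugates of absolute value 1, so their trace
  coordinates are integers bounded by \<open>p\<close>. Two powers share all coordinates and hence
  coincide.\<close>

lemma kronecker:
  assumes x: "x \<in> OK" "\<And>c. c \<in> G \<Longrightarrow> norm (\<sigma> c x) = 1"
  obtains N where "N > 0" "x ^ N = 1"
proof -
  define g where "g n = (\<lambda>k\<in>{..<p}. trace_coord k (x ^ n))" for n
  define B where "B = (\<Pi>\<^sub>E k\<in>{..<p}. {- int p..int p})"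
  have "finite B" unfolding B_def by (intro finite_PiE) auto
  have "g n \<in> B" for n
  proof -
    have "trace_coord k (x ^ n) \<in> {- int p..int p}" for k
    proof -
      have xn: "x ^ n \<in> OK" using x(1) by (rule OK_closed)
      have "norm (Tr (x ^ n * \<zeta> ^ (p - k))) \<le> real p"
      proof (rule norm_\<sigma>_sum_bound)
        show "x ^ n \<in> K" using xn by (rule OK_K)
        show "norm (\<sigma> c (x ^ n)) = 1" if "c \<in> G" for c
          using x(2)[OF that] OK_K[OF x(1)] G_not_dvd[OF that] by (simp add: \<sigma>_power norm_power)
      qed
      hence "norm (of_int (trace_coord k (x ^ n)) :: complex) \<le> real p" by (simp only: trace_coord[OF xn])
      hence "\<bar>real_of_int (trace_coord k (x ^ n))\<bar> \<le> real p" by simp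
      thus ?thesis by auto
    qed
    thus ?thesis by (auto simp: g_def B_def)
  qed
  hence "range g \<subseteq> B" by blast
  hence "finite (range g)" using \<open>finite B\<close> finite_subset by blast
  hence "\<not> inj g" using finite_imageD infinite_UNIV_nat by blast
  then obtain a b where ab: "g a = g b" "a \<noteq> b" by (auto simp: inj_on_def)
  define i where "i = min a b"
  define j where "j = max a b"
  have ij: "i < j" "g i = g j" using ab by (auto simp: i_def j_def min_def max_def)
  have "trace_coord k (x ^ i) = trace_coord k (x ^ j)" if "k < p" for k
    using fun_cong[OF ij(2), of k] that by (simp add: g_def)
  hence "of_nat p * x ^ i = of_nat p * x ^ j"
    using trace_coord_expansion[OF OK_closed(10)[OF x(1)], of i] trace_coord_expansion[OF OK_closed(10)[OF x(1)], of j] by simp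
  hence "x ^ i = x ^ j" using p3 by simp
  also have "x ^ j = x ^ i * x ^ (j - i)" using ij by (simp add: power_add[symmetric])
  finally have "x ^ i * x ^ (j - i) = x ^ i * 1" by simp
  moreover have "x \<noteq> 0"
  proof
    assume "x = 0"
    thus False using x(2)[OF G_one] \<sigma>_0[OF G_not_dvd[OF G_one]] by simp
  qed
  ultimately have "x ^ (j - i) = 1" by simp
  thus ?thesis using that[of "j - i"] ij by simp
qed

text \<open>\<open>e / cnj e\<close> is a root of unity. Its order \<open>N\<close> is prime to
  \<open>q\<close>, because otherwise the power with exponent \<open>N / q\<close> would be a
  nontrivial \<open>q\<close>-th root of 1 in \<open>K\<close>; so raising to the
  \<open>q\<close>-th power is invertible on the group it generates.\<close>

lemma unit_over_conjugate:
  assumes q: "prime q" "odd q" "q \<noteq> p" and e: "e \<in> OK" "inverse e \<in> OK" "e \<noteq> 0"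
  obtains r where "r \<in> K" "e / cnj e = r ^ q"
proof -
  define d where "d = e / cnj e"
  have dO: "d \<in> OK"
    using OK_closed(9)[OF e(1) OK_cnj[OF e(2)]] by (simp add: d_def divide_inverse)
  have n1: "norm (\<sigma> c d) = 1" if "c \<in> G" for c
  proof -
    have nc: "\<not> p dvd c" using that by (rule G_not_dvd)
    have eK: "e \<in> K" "cnj e \<in> K" "d \<in> K" using e(1) dO by (auto intro: OK_K cnj_in_K)
    have "d * cnj e = e" using e(3) by (simp add: d_def)
    hence "\<sigma> c d * cnj (\<sigma> c e) = \<sigma> c e"
      using \<sigma>_mult[OF nc eK(3,2)] \<sigma>_cnj[OF nc eK(1)] by simp
    hence "norm (\<sigma> c d) * norm (\<sigma> c e) = norm (\<sigma> c e)" by (metis norm_mult complex_mod_cnj)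
    thus ?thesis using \<sigma>_nonzero[OF nc eK(1) e(3)] by simp
  qed
  obtain N0 where "N0 > 0 \<and> d ^ N0 = 1" using kronecker[OF dO n1] by metis
  define N where "N = (LEAST N. N > 0 \<and> d ^ N = 1)"
  have N: "N > 0" "d ^ N = 1"
    using LeastI[of "\<lambda>N. N > 0 \<and> d ^ N = 1" N0] \<open>N0 > 0 \<and> d ^ N0 = 1\<close> by (auto simp: N_def)
  have least: "N \<le> k" if "k > 0" "d ^ k = 1" for k
    unfolding N_def using that by (intro Least_le) auto
  have "\<not> q dvd N"
  proof
    assume "q dvd N"
    then obtain k where k: "N = q * k" by blast
    have "(d ^ k) ^ q = 1" using N(2) by (simp add: k power_mult[symmetric] mult.commute)
    hence "d ^ k = 1" by (rule no_root_of_unity[OF q OK_K[OF OK_closed(10)[OF dO]]])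
    moreover have "k > 0" using N(1) k by (cases k) auto
    ultimately have "N \<le> k" by (intro least)
    moreover have "q \<ge> 2" using q(1) prime_ge_2_nat by blast
    hence "2 * k \<le> N" unfolding k by (intro mult_right_mono) auto
    ultimately show False using \<open>k > 0\<close> by linarith
  qed
  hence "coprime q N" using q(1) prime_imp_coprime by blast
  then obtain v where "[q * v = Suc 0] (mod N)" using cong_solve_coprime_nat by blast
  hence v: "(q * v) mod N = 1 mod N" by (simp add: unique_euclidean_semiring_class.cong_def)
  have dm: "d ^ (k mod N) = d ^ k" for k
  proof -
    have "d ^ k = d ^ (N * (k div N) + k mod N)" by simp
    also have "\<dots> = d ^ (k mod N)" by (simp only: power_add power_mult N(2) power_one mult_1_left)
    finally show ?thesis ..
  qed
  have "d = d ^ (1 mod N)" using dm[of 1] by simp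
  also have "\<dots> = d ^ (q * v)" unfolding v[symmetric] dm ..
  also have "\<dots> = (d ^ v) ^ q" by (simp add: power_mult[symmetric] mult.commute)
  finally have dd: "d = (d ^ v) ^ q" .
  show ?thesis
  proof (rule that)
    show "d ^ v \<in> K" by (rule OK_K[OF OK_closed(10)[OF dO]])
    show "e / cnj e = (d ^ v) ^ q" unfolding d_def[symmetric] by (rule dd)
  qed
qed

section \<open>Linear terms of relations between \<open>q\<close>-th powers\<close>

lemma prod_one_minus_expand:
  assumes "finite A" "\<And>c. c \<in> A \<Longrightarrow> a c \<in> OK"
  shows "odvd (of_int x ^ 2) ((\<Prod>c\<in>A. (1 - of_int x * a c) ^ e c) - (1 - of_int x * (\<Sum>c\<in>A. of_nat (e c) * a c)))"
  using assms
proof (induction A)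
  case empty
  show ?case by (simp add: odvd_0)
next
  case (insert b A)
  define xx where "xx = (of_int x :: complex)"
  have xO: "xx \<in> OK" by (auto simp: xx_def intro: OK_closed)
  have mult_step: "odvd (xx\<^sup>2) (P * Q - (1 - xx * (s + t)))"
    if "odvd (xx\<^sup>2) (P - (1 - xx * s))" "odvd (xx\<^sup>2) (Q - (1 - xx * t))" "P \<in> OK" "s \<in> OK" "t \<in> OK" for P Q s t
  proof -
    have "P * Q - (1 - xx * (s + t)) = P * (Q - (1 - xx * t)) + (P - (1 - xx * s)) * (1 - xx * t) + xx\<^sup>2 * (s * t)"
      by (simp add: algebra_simps power2_eq_square)
    also have "odvd (xx\<^sup>2) \<dots>"
      using that xO by (intro odvd_add odvd_mult odvd_mult' odvd_self OK_closed)
    finally show ?thesis .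
  qed
  have b: "a b \<in> OK" using insert by auto
  have pw: "odvd (xx\<^sup>2) ((1 - xx * a b) ^ n - (1 - xx * (of_nat n * a b)))" for n
  proof (induction n)
    case 0
    show ?case by (simp add: odvd_0)
  next
    case (Suc n)
    have "odvd (xx\<^sup>2) ((1 - xx * a b) - (1 - xx * a b))" by (simp add: odvd_0)
    from mult_step[OF this Suc _ b] have
      "odvd (xx\<^sup>2) ((1 - xx * a b) * (1 - xx * a b) ^ n - (1 - xx * (a b + of_nat n * a b)))"
      using b xO by (auto intro: OK_closed)
    thus ?case by (simp add: algebra_simps)
  qed
  have "odvd (xx\<^sup>2) ((1 - xx * a b) ^ e b * (\<Prod>c\<in>A. (1 - xx * a c) ^ e c) -
      (1 - xx * (of_nat (e b) * a b + (\<Sum>c\<in>A. of_nat (e c) * a c))))"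
    using insert b xO by (intro mult_step pw) (auto simp: xx_def intro!: OK_closed OK_sum)
  thus ?case using insert(1,2) by (simp add: xx_def)
qed

lemma Tr_zeta: "Tr (\<zeta> ^ k) = (if p dvd k then of_nat p else 0) - 1"
proof -
  have "{..<p} = insert 0 G" using p3 by (auto simp: G_def)
  hence "(\<Sum>c<p. \<zeta> ^ (k * c)) = 1 + (\<Sum>c\<in>G. \<zeta> ^ (c * k))"
    by (simp add: finite_G G_def mult.commute)
  moreover have "Tr (\<zeta> ^ k) = (\<Sum>c\<in>G. \<zeta> ^ (c * k))"
    by (simp add: Tr_def \<sigma>_zeta G_not_dvd)
  ultimately show ?thesis using sum_zeta[of k] by (simp add: algebra_simps)
qed

text \<open>The trace against \<open>\<zeta> ^ (p - d)\<close> equals \<open>p * f d\<close> minus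
  the sum of all \<open>f c\<close>. That sum is 0, and \<open>p\<close> is invertible modulo
  \<open>n\<close>.\<close>

lemma zeta_comb_dvd:
  assumes "odvd (of_nat n) (\<Sum>c\<in>G. of_int (f c) * \<zeta> ^ c)" "n > 0" "coprime n p"
    "(\<Sum>c\<in>G. f c) = 0" "d \<in> G"
  shows "int n dvd f d"
proof -
  define y where "y = (\<Sum>c\<in>G. of_int (f c) * \<zeta> ^ c) * \<zeta> ^ (p - d)"
  obtain w where w: "w \<in> OK" "(\<Sum>c\<in>G. of_int (f c) * \<zeta> ^ c) = of_nat n * w"
    using assms(1) by (auto simp: odvd_def)
  have wz: "w * \<zeta> ^ (p - d) \<in> OK" using w(1) by (intro OK_closed)
  have "Tr y = Tr (of_int (int n) * (w * \<zeta> ^ (p - d)))" by (simp add: y_def w mult.assoc)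
  also have "\<dots> = of_int (int n) * Tr (w * \<zeta> ^ (p - d))" using wz by (intro Tr_scale OK_K)
  finally have 1: "Tr y = of_nat n * Tr (w * \<zeta> ^ (p - d))" by simp
  have "Tr (w * \<zeta> ^ (p - d)) \<in> \<int>" using wz by (rule Tr_int)
  then obtain m where m: "Tr (w * \<zeta> ^ (p - d)) = of_int m" by (auto elim: Ints_cases)
  have Trsum: "Tr (\<Sum>c\<in>A. of_int (f c) * \<zeta> ^ (c + (p - d))) = (\<Sum>c\<in>A. of_int (f c) * Tr (\<zeta> ^ (c + (p - d))))"
    if "finite A" for A
    using that
  proof (induction A)
    case empty
    have "Tr 0 = 0" by (simp add: Tr_def \<sigma>_0 G_not_dvd)
    thus ?case by simp
  next
    case (insert c A)
    have "(\<Sum>c\<in>A. of_int (f c) * \<zeta> ^ (c + (p - d))) \<in> K" by (intro K_closed)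
    moreover have "of_int (f c) * \<zeta> ^ (c + (p - d)) \<in> K" by (intro K_closed)
    ultimately show ?case using insert by (simp add: Tr_add Tr_scale K_zeta)
  qed
  have "Tr y = (\<Sum>c\<in>G. of_int (f c) * Tr (\<zeta> ^ (c + (p - d))))"
    using Trsum[OF finite_G] by (simp add: y_def sum_distrib_right power_add mult.assoc)
  also have "\<dots> = (\<Sum>c\<in>G. of_int (f c) * ((if c = d then of_nat p else 0) - 1))"
  proof (intro sum.cong refl)
    fix c assume c: "c \<in> G"
    have "p dvd c + (p - d) \<longleftrightarrow> c = d"
    proof
      assume "p dvd c + (p - d)"
      then obtain k where k: "c + (p - d) = p * k" by blast
      have "0 < c + (p - d)" "c + (p - d) < 2 * p" using c assms(5) by (auto simp: G_def)
      hence "0 < p * k" "p * k < p * 2" using k by auto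
      hence "0 < k" "k < 2" by auto
      hence "k = 1" by simp
      thus "c = d" using k assms(5) by (auto simp: G_def)
    qed (use assms(5) in \<open>auto simp: G_def\<close>)
    thus "of_int (f c) * Tr (\<zeta> ^ (c + (p - d))) = of_int (f c) * ((if c = d then of_nat p else 0) - 1)"
      by (simp add: Tr_zeta)
  qed
  also have "\<dots> = (\<Sum>c\<in>G. (if c = d then of_int (f c) * of_nat p else 0)) - (\<Sum>c\<in>G. of_int (f c))"
    unfolding sum_subtractf[symmetric] by (intro sum.cong refl) (simp add: algebra_simps)
  also have "\<dots> = of_int (f d) * of_nat p - of_int (\<Sum>c\<in>G. f c)"
    using assms(5) finite_G by simp
  finally have "Tr y = of_int (f d * int p)" using assms(4) by simp
  hence "of_int (f d * int p) = (of_int (int n * m) :: complex)" using 1 m by simp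
  hence "f d * int p = int n * m" by (simp only: of_int_eq_iff)
  hence "int n dvd f d * int p" by simp
  moreover have "coprime (int n) (int p)" using assms(3) by simp
  ultimately show ?thesis using coprime_dvd_mult_left_iff by blast
qed

lemma bij_minus_G: "bij_betw (\<lambda>c. p - c) G G"
  by (rule bij_betwI[where g = "\<lambda>c. p - c"]) (auto simp: G_def)

text \<open>Modulo \<open>q\<close> both products are \<open>1\<close>, so \<open>U * V ^ (q - 1)\<close> is the \<open>q\<close>-th power of an element that is
  \<open>1\<close> modulo \<open>q\<close>, hence \<open>1\<close> modulo \<open>q\<^sup>2\<close>. The linear terms in \<open>x\<close> then give the exponents.\<close>

lemma qth_power_relation:
  assumes q: "prime q" "odd q" "q \<noteq> p" and qx: "int q dvd x"
    and U: "U = (\<Prod>c\<in>G. (1 - of_int x * \<zeta> ^ c) ^ e c)"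
    and V: "V = (\<Prod>c\<in>G. (1 - of_int x * \<zeta> ^ (p - c)) ^ e c)"
    and t: "t \<in> K" "U = V * t ^ q"
    and nd: "\<not> int q ^ 2 dvd x" and d: "d \<in> G"
  shows "int q dvd int (e d) - int (e (p - d))"
proof -
  define xx where "xx = (of_int x :: complex)"
  define Q where "Q = (of_nat q :: complex)"
  have q0: "q > 0" using q(1) prime_gt_0_nat by blast
  have Q0: "Q \<noteq> 0" using q0 by (simp add: Q_def)
  have xO: "xx \<in> OK" "Q \<in> OK" by (auto simp: xx_def Q_def intro: OK_closed)
  obtain x' where x': "x = int q * x'" using qx by blast
  have xxq: "xx = Q * of_int x'" by (simp add: xx_def Q_def x')
  define S where "S = (\<Sum>c\<in>G. of_nat (e c) * \<zeta> ^ c)"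
  define S' where "S' = (\<Sum>c\<in>G. of_nat (e c) * \<zeta> ^ (p - c))"
  have SO: "S \<in> OK" "S' \<in> OK" unfolding S_def S'_def by (intro OK_sum OK_closed)+
  have UVO: "U \<in> OK" "V \<in> OK" unfolding U V by (intro OK_prod OK_closed)+
  have Q2X2: "odvd (Q\<^sup>2) (xx\<^sup>2)"
    by (rule odvdI[of "of_int x' ^ 2"]) (auto simp: xxq power_mult_distrib intro: OK_closed)
  have "odvd (xx\<^sup>2) (U - (1 - xx * S))" "odvd (xx\<^sup>2) (V - (1 - xx * S'))"
    unfolding U V S_def S'_def xx_def
    by (intro prod_one_minus_expand finite_G OK_closed)+
  hence U2: "odvd (Q\<^sup>2) (U - (1 - xx * S))" and V2: "odvd (Q\<^sup>2) (V - (1 - xx * S'))"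
    using Q2X2 odvd_trans by blast+
  have "odvd Q xx" by (rule odvdI[of "of_int x'"]) (auto simp: xxq intro: OK_closed)
  have QQ2: "odvd Q (Q\<^sup>2)" by (rule odvdI[of Q]) (auto simp: power2_eq_square xO)
  have U1: "odvd Q (U - 1)"
  proof -
    have "odvd Q ((U - (1 - xx * S)) - xx * S)"
      by (rule odvd_diff[OF odvd_trans[OF QQ2 U2] odvd_mult[OF \<open>odvd Q xx\<close> SO(1)]])
    thus ?thesis by simp
  qed
  have V1: "odvd Q (V - 1)"
  proof -
    have "odvd Q ((V - (1 - xx * S')) - xx * S')"
      by (rule odvd_diff[OF odvd_trans[OF QQ2 V2] odvd_mult[OF \<open>odvd Q xx\<close> SO(2)]])
    thus ?thesis by simp
  qed
  \<comment> \<open>Only \<open>t \<in> K\<close> is known. The factor \<open>V\<close> makes the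
    element integral, since \<open>s ^ q = U * V ^ (q - 1)\<close>, and it avoids dividing by
    \<open>V\<close>.\<close>
  define s where "s = V * t"
  have sq: "s ^ q = U * V ^ (q - 1)"
    using t(2) q0 by (simp add: s_def power_mult_distrib power_eq_if[of V q])
  have sK: "s \<in> K" unfolding s_def by (intro K_closed OK_K UVO t)
  have sqO: "s ^ q \<in> OK" unfolding sq by (intro OK_closed UVO)
  have sO: "s \<in> OK" using sK sqO algebraic_int_if_power[of s q] q0 by (simp add: OK_iff)
  have Vn: "odvd Q (V ^ n - 1)" for n
  proof (induction n)
    case 0 show ?case by (simp add: odvd_0)
  next
    case (Suc n)
    have "odvd Q (V * (V ^ n - 1) + (V - 1))" by (intro odvd_add odvd_mult' Suc V1 UVO)
    thus ?case by (simp add: algebra_simps)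
  qed
  have "odvd Q (U * (V ^ (q - 1) - 1) + (U - 1))" by (intro odvd_add odvd_mult' Vn U1 UVO)
  hence "odvd Q (s ^ q - 1)" unfolding sq by (simp add: algebra_simps)
  moreover have "odvd Q ((s + (- 1)) ^ q - (s ^ q + (- 1) ^ q))"
    unfolding Q_def by (intro freshman q sO OK_closed)
  ultimately have "odvd Q (((s + (- 1)) ^ q - (s ^ q + (- 1) ^ q)) + (s ^ q - 1))"
    by (intro odvd_add)
  hence "odvd Q ((s - 1) ^ q)" using q(2) by simp
  hence "odvd Q (s - 1)" unfolding Q_def
    by (rule reduced_mod_prime[OF q(1,3) OK_closed(8)[OF sO OK_closed(2)]])
  then obtain v where v: "v \<in> OK" "s - 1 = Q * v" by (auto simp: odvd_def)
  hence "s = 1 + of_nat q * v" by (simp add: Q_def algebra_simps)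
  then obtain u where u: "u \<in> OK" "s ^ q = 1 + Q ^ 2 * v * (1 + Q * u)"
    using one_plus_power_prime[OF q(1,2) v(1)] by (auto simp: Q_def)
  have s2: "odvd (Q\<^sup>2) (U * V ^ (q - 1) - 1)"
    unfolding sq[symmetric] u(2) by (rule odvdI[of "v * (1 + Q * u)"]) (auto intro!: OK_closed v u xO)
  have "odvd (Q\<^sup>2) (V ^ n - (1 - of_nat n * (xx * S')))" for n
  proof (induction n)
    case 0 show ?case by (simp add: odvd_0)
  next
    case (Suc n)
    have "V ^ Suc n - (1 - of_nat (Suc n) * (xx * S')) =
        V * (V ^ n - (1 - of_nat n * (xx * S'))) + (V - (1 - xx * S')) * (1 - of_nat n * (xx * S')) +
        xx\<^sup>2 * (of_nat n * S'\<^sup>2)"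
      by (simp add: algebra_simps power2_eq_square)
    also have "odvd (Q\<^sup>2) \<dots>"
      by (intro odvd_add odvd_mult odvd_mult' Suc V2 UVO Q2X2 OK_closed xO SO)
    finally show ?case .
  qed
  from this[of "q - 1"] have Vq: "odvd (Q\<^sup>2) (V ^ (q - 1) - (1 - of_nat (q - 1) * (xx * S')))" .
  \<comment> \<open>As \<open>q\<close> divides \<open>x\<close>, the exponent \<open>q - 1\<close>
    acts on the linear term modulo \<open>q ^ 2\<close> like \<open>-1\<close>, so
    \<open>V ^ (q - 1)\<close> serves as the inverse of \<open>V\<close>.\<close>
  have V2': "odvd (Q\<^sup>2) (V ^ (q - 1) - (1 + xx * S'))"
  proof -
    have "V ^ (q - 1) - (1 + xx * S') = (V ^ (q - 1) - (1 - of_nat (q - 1) * (xx * S'))) - Q\<^sup>2 * (of_int x' * S')"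
      using q0 by (simp add: xxq Q_def of_nat_diff algebra_simps power2_eq_square)
    also have "odvd (Q\<^sup>2) \<dots>" by (intro odvd_diff Vq odvd_self OK_closed SO)
    finally show ?thesis .
  qed
  have O1: "1 + xx * S' \<in> OK" and O2: "S * S' \<in> OK" by (intro OK_closed xO SO)+
  have "odvd (Q\<^sup>2) ((U * V ^ (q - 1) - 1) - (U * (V ^ (q - 1) - (1 + xx * S')) +
      (U - (1 - xx * S)) * (1 + xx * S')) + xx\<^sup>2 * (S * S'))"
    by (rule odvd_add[OF odvd_diff[OF s2 odvd_add[OF odvd_mult'[OF V2' UVO(1)] odvd_mult[OF U2 O1]]]
          odvd_mult[OF Q2X2 O2]])
  also have "(U * V ^ (q - 1) - 1) - (U * (V ^ (q - 1) - (1 + xx * S')) +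
      (U - (1 - xx * S)) * (1 + xx * S')) + xx\<^sup>2 * (S * S') = xx * (S' - S)"
    by (simp add: algebra_simps power2_eq_square)
  finally obtain w where w: "w \<in> OK" "xx * (S' - S) = Q\<^sup>2 * w" by (auto simp: odvd_def)
  \<comment> \<open>One \<open>q\<close> is used up by \<open>x = q * x'\<close>. A congruence
    modulo \<open>q\<close> remains, and \<open>x'\<close> is prime to \<open>q\<close> because
    \<open>q ^ 2\<close> does not divide \<open>x\<close>.\<close>
  hence "of_int x' * (S' - S) = Q * w" using Q0 by (simp add: xxq power2_eq_square)
  hence "odvd (of_nat q) (of_int x' * (S' - S))" using w(1) by (auto simp: odvd_def Q_def)
  moreover have "coprime (int q) x'"
  proof -
    have "\<not> int q dvd x'" using nd by (auto simp: x' power2_eq_square)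
    thus ?thesis using q(1) by (simp add: prime_imp_coprime)
  qed
  ultimately have "odvd (of_nat q) (S' - S)" by (rule odvd_coprime_cancel) (intro OK_closed SO)
  hence "odvd (of_nat q) (S - S')" using odvd_minus by fastforce
  also have "S - S' = (\<Sum>c\<in>G. of_int (int (e c) - int (e (p - c))) * \<zeta> ^ c)"
  proof -
    have "S' = (\<Sum>c\<in>G. of_nat (e (p - c)) * \<zeta> ^ (p - (p - c)))"
      unfolding S'_def by (rule sum.reindex_bij_betw[OF bij_minus_G, symmetric])
    also have "\<dots> = (\<Sum>c\<in>G. of_nat (e (p - c)) * \<zeta> ^ c)"
      by (intro sum.cong refl) (auto simp: G_def)
    finally show ?thesis by (simp add: S_def sum_subtractf[symmetric] left_diff_distrib)
  qed
  finally have 1: "odvd (of_nat q) (\<Sum>c\<in>G. of_int (int (e c) - int (e (p - c))) * \<zeta> ^ c)" .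
  have "(\<Sum>c\<in>G. int (e (p - c))) = (\<Sum>c\<in>G. int (e c))"
    by (rule sum.reindex_bij_betw[OF bij_minus_G])
  hence "(\<Sum>c\<in>G. int (e c) - int (e (p - c))) = 0" by (simp add: sum_subtractf)
  moreover have "coprime q p" using q p(1) by (simp add: primes_coprime)
  ultimately show ?thesis using zeta_comb_dvd[OF 1 q0 _ _ d] by simp
qed

end

section \<open>The rank of a finite abelian group\<close>

lemma (in module) card_carrier_le_if_finite_span:
  assumes "finite S" "S \<subseteq> carrier M" "span S = carrier M" "finite (carrier R)"
  shows "card (carrier M) \<le> card (carrier R) ^ card S"
proof -
  define Y where "Y = (S \<rightarrow>\<^sub>E carrier R)"
  have fin: "finite Y" unfolding Y_def using assms by (intro finite_PiE) auto
  have "carrier M \<subseteq> (\<lambda>a. lincomb a S) ` Y"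
  proof
    fix v assume "v \<in> carrier M"
    hence "v \<in> span S" using assms(3) by simp
    then obtain a where a: "a \<in> S \<rightarrow> carrier R" "v = lincomb a S"
      using finite_span[OF assms(1,2)] by auto
    have "lincomb (restrict a S) S = lincomb a S"
      using a assms(2) by (intro lincomb_cong) auto
    moreover have "restrict a S \<in> Y" using a(1) by (auto simp: Y_def)
    ultimately show "v \<in> (\<lambda>a. lincomb a S) ` Y"
      using a(2) by (intro image_eqI[of _ _ "restrict a S"]) simp_all
  qed
  hence "card (carrier M) \<le> card ((\<lambda>a. lincomb a S) ` Y)"
    using fin by (intro card_mono) auto
  also have "\<dots> \<le> card Y" using fin by (rule card_image_le)
  also have "card Y = card (carrier R) ^ card S" unfolding Y_def using assms(1) by (simp add: card_PiE)
  finally show ?thesis .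
qed

lemma (in module) span_carrier: "span (carrier M) = carrier M"
proof
  show "span (carrier M) \<subseteq> carrier M"
    using span_is_submodule[of "carrier M"] by (auto simp: submodule_def)
  show "carrier M \<subseteq> span (carrier M)"
    by (rule in_own_span) auto
qed

section \<open>Torsion and the quotient by \<open>q\<close>-th powers\<close>

lemma (in comm_group) pow_subgroup: "subgroup ((\<lambda>a. a [^] (q::nat)) ` carrier G) G"
proof (rule subgroupI)
  show "(\<lambda>a. a [^] q) ` carrier G \<noteq> {}" by auto
next
  fix a assume "a \<in> (\<lambda>a. a [^] q) ` carrier G"
  then obtain b where "b \<in> carrier G" "a = b [^] q" by auto
  hence "inv a = inv b [^] q" "inv b \<in> carrier G" by (simp_all add: nat_pow_inv)
  thus "inv a \<in> (\<lambda>a. a [^] q) ` carrier G" by auto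
next
  fix a b assume "a \<in> (\<lambda>a. a [^] q) ` carrier G" "b \<in> (\<lambda>a. a [^] q) ` carrier G"
  then obtain c d where "c \<in> carrier G" "a = c [^] q" "d \<in> carrier G" "b = d [^] q" by auto
  hence "a \<otimes> b = (c \<otimes> d) [^] q" "c \<otimes> d \<in> carrier G" by (simp_all add: pow_mult_distrib m_comm)
  thus "a \<otimes> b \<in> (\<lambda>a. a [^] q) ` carrier G" by auto
qed auto

text \<open>Kernel and cokernel of the \<open>q\<close>-th power map of a finite group have the same
  order. The rank is defined by the cokernel, whereas the ideal classes at hand are elements of the
  kernel.\<close>

lemma (in comm_group) card_torsion_eq_card_mod_powers:
  assumes "finite (carrier G)"
  shows "card {a \<in> carrier G. a [^] (q::nat) = \<one>} = card (carrier (mod_powers q G))"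
proof -
  define H where "H = (\<lambda>a. a [^] q) ` carrier G"
  define N where "N = {a \<in> carrier G. a [^] q = \<one>}"
  have H: "subgroup H G" unfolding H_def by (rule pow_subgroup)
  interpret h: group_hom G G "\<lambda>a. a [^] q"
    by unfold_locales (auto simp: hom_def pow_mult_distrib m_comm)
  have ker: "kernel G G (\<lambda>a. a [^] q) = N" by (simp add: kernel_def N_def)
  have N: "subgroup N G" using h.subgroup_kernel by (simp add: ker)
  have finH: "finite H" "finite N" using assms by (auto simp: H_def N_def)
  have NH: "card (rcosets N) = card H"
  proof -
    have "bij_betw (\<lambda>Y. the_elem ((\<lambda>a. a [^] q) ` Y)) (carrier (G Mod N)) H"
      unfolding ker[symmetric]
    proof (rule bij_betw_imageI)
      show "inj_on (\<lambda>Y. the_elem ((\<lambda>a. a [^] q) ` Y)) (carrier (G Mod kernel G G (\<lambda>a. a [^] q)))"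
        by (rule h.FactGroup_inj_on)
      have "group_hom G (G\<lparr>carrier := H\<rparr>) (\<lambda>a. a [^] q)"
        using H subgroup.subgroup_is_group[OF H is_group]
        by (auto simp: group_hom_def group_hom_axioms_def hom_def H_def pow_mult_distrib m_comm is_group)
      from group_hom.FactGroup_onto[OF this]
      show "(\<lambda>Y. the_elem ((\<lambda>a. a [^] q) ` Y)) ` carrier (G Mod kernel G G (\<lambda>a. a [^] q)) = H"
        by (simp add: H_def kernel_def)
    qed
    from bij_betw_same_card[OF this] show ?thesis by (simp add: FactGroup_def)
  qed
  have "card (rcosets H) * card H = card H * card N"
    using lagrange[OF N] lagrange[OF H] by (simp add: NH)
  moreover have "card H > 0" using finH subgroup.one_closed[OF H] by (auto simp: card_gt_0_iff)
  ultimately have "card (rcosets H) = card N" by simp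
  thus ?thesis by (simp add: mod_powers_def FactGroup_def H_def[symmetric] N_def)
qed

lemma (in comm_group) mod_powers_comm_group: "comm_group (mod_powers q G)"
  unfolding mod_powers_def using abelian_FactGroup[OF pow_subgroup] .

lemma (in comm_group) mod_powers_pow:
  assumes "Y \<in> carrier (mod_powers q G)"
  shows "Y [^]\<^bsub>mod_powers q G\<^esub> q = \<one>\<^bsub>mod_powers q G\<^esub>"
proof -
  define H where "H = (\<lambda>a. a [^] q) ` carrier G"
  have H: "subgroup H G" unfolding H_def by (rule pow_subgroup)
  interpret H: normal H G using subgroup_imp_normal[OF H] .
  obtain a where a: "a \<in> carrier G" "Y = H #> a"
    using assms by (auto simp: mod_powers_def H_def[symmetric] FactGroup_def RCOSETS_def)
  have "(H #> a) [^]\<^bsub>G Mod H\<^esub> n = H #> (a [^] n)" for n :: nat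
  proof (induction n)
    case 0
    show ?case using H.subset by (simp add: FactGroup_def coset_mult_one)
  next
    case (Suc n)
    thus ?case using a by (simp add: FactGroup_def H.rcos_sum)
  qed
  hence "Y [^]\<^bsub>G Mod H\<^esub> q = H #> (a [^] q)" using a by simp
  also have "\<dots> = H" using a H by (intro coset_join2) (auto simp: H_def)
  finally show ?thesis by (simp add: mod_powers_def H_def[symmetric] FactGroup_def)
qed

text \<open>By \<open>mod_powers_pow\<close> exponents matter only modulo \<open>q\<close>, which
  makes the action compatible with sums and products reduced modulo \<open>q\<close>.\<close>

lemma (in comm_group) mod_powers_vectorspace:
  assumes "prime q"
  shows "vectorspace (residue_ring (int q)) (mod_powers_module q G)"
proof -
  interpret R: residues_prime q "residue_ring (int q)"
    using assms by unfold_locales auto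
  interpret B: comm_group "mod_powers q G" by (rule mod_powers_comm_group)
  let ?R = "residue_ring (int q)" and ?M = "mod_powers_module q G" and ?B = "mod_powers q G"
  have q0: "q > 0" using assms prime_gt_0_nat by blast
  have pow: "x [^]\<^bsub>?B\<^esub> (k mod int q) = x [^]\<^bsub>?B\<^esub> k" if "x \<in> carrier ?B" for x and k :: int
  proof -
    have "x [^]\<^bsub>?B\<^esub> k = x [^]\<^bsub>?B\<^esub> (int q * (k div int q) + k mod int q)" by simp
    also have "\<dots> = (x [^]\<^bsub>?B\<^esub> int q) [^]\<^bsub>?B\<^esub> (k div int q) \<otimes>\<^bsub>?B\<^esub> x [^]\<^bsub>?B\<^esub> (k mod int q)"
      using that by (simp only: B.int_pow_mult B.int_pow_pow)
    also have "x [^]\<^bsub>?B\<^esub> int q = \<one>\<^bsub>?B\<^esub>" using mod_powers_pow[OF that] by (simp add: int_pow_int)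
    finally show ?thesis using that by simp
  qed
  have ab: "abelian_group ?M"
  proof (rule abelian_groupI)
    fix x assume "x \<in> carrier ?M"
    thus "\<exists>y\<in>carrier ?M. y \<oplus>\<^bsub>?M\<^esub> x = \<zero>\<^bsub>?M\<^esub>"
      by (intro bexI[of _ "inv\<^bsub>?B\<^esub> x"]) (auto simp: mod_powers_module_def)
  qed (auto simp: mod_powers_module_def B.m_ac)
  have "module ?R ?M"
  proof (rule moduleI[OF R.cring ab])
    fix a b x assume abx: "a \<in> carrier ?R" "b \<in> carrier ?R" "x \<in> carrier ?M"
    show "(a \<oplus>\<^bsub>?R\<^esub> b) \<odot>\<^bsub>?M\<^esub> x = a \<odot>\<^bsub>?M\<^esub> x \<oplus>\<^bsub>?M\<^esub> b \<odot>\<^bsub>?M\<^esub> x"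
      using abx by (simp add: mod_powers_module_def R.res_add_eq pow B.int_pow_mult)
    show "(a \<otimes>\<^bsub>?R\<^esub> b) \<odot>\<^bsub>?M\<^esub> x = a \<odot>\<^bsub>?M\<^esub> (b \<odot>\<^bsub>?M\<^esub> x)"
      using abx by (simp add: mod_powers_module_def R.res_mult_eq pow B.int_pow_pow mult.commute)
  qed (auto simp: mod_powers_module_def B.int_pow_distrib R.res_one_eq)
  thus ?thesis using R.is_field by (simp add: vectorspace_def)
qed

lemma (in comm_group) card_torsion_le_q_rank:
  assumes "finite (carrier G)" "prime q"
  shows "card {a \<in> carrier G. a [^] q = \<one>} \<le> q ^ q_rank q G"
proof -
  interpret R: residues_prime q "residue_ring (int q)"
    using assms by unfold_locales auto
  interpret V: vectorspace "residue_ring (int q)" "mod_powers_module q G"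
    by (rule mod_powers_vectorspace[OF assms(2)])
  let ?M = "mod_powers_module q G"
  have cM: "carrier ?M = carrier (mod_powers q G)" by (simp add: mod_powers_module_def)
  have fin: "finite (carrier ?M)"
    unfolding cM mod_powers_def FactGroup_def using assms(1) by (simp add: RCOSETS_def)
  \<comment> \<open>\<open>dim\<close> is the least size of a finite generating set; the finite
    carrier shows that there is one at all.\<close>
  have "\<exists>A. finite A \<and> card A = card (carrier ?M) \<and> A \<subseteq> carrier ?M \<and> V.gen_set A"
    using fin V.span_carrier by (intro exI[of _ "carrier ?M"]) auto
  hence "\<exists>A. finite A \<and> card A = V.dim \<and> A \<subseteq> carrier ?M \<and> V.gen_set A"
    unfolding V.dim_def by (rule LeastI)
  then obtain A where A: "finite A" "card A = V.dim" "A \<subseteq> carrier ?M" "V.gen_set A" by blast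
  have cR: "carrier (residue_ring (int q)) = {0..int q - 1}" by (rule R.res_carrier_eq)
  have "card (carrier ?M) \<le> card (carrier (residue_ring (int q))) ^ card A"
    using A by (intro V.card_carrier_le_if_finite_span) (auto simp: cR)
  hence "card (carrier ?M) \<le> q ^ V.dim" by (simp add: cR A(2))
  thus ?thesis
    using card_torsion_eq_card_mod_powers[OF assms(1), of q] by (simp add: cM q_rank_def)
qed

section \<open>The relative class group\<close>

lemma ring_complex_subring:
  assumes "1 \<in> A" "\<And>x. x \<in> A \<Longrightarrow> - x \<in> A"
    "\<And>x y. x \<in> A \<Longrightarrow> y \<in> A \<Longrightarrow> x + y \<in> A" "\<And>x y. x \<in> A \<Longrightarrow> y \<in> A \<Longrightarrow> x * y \<in> A"
  shows "ring (complex_ring\<lparr>carrier := A\<rparr>)"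
proof -
  have c: "ring complex_ring" by (rule ring_from_type_algebra)
  have "subring A complex_ring"
    by (rule ring.subringI[OF c]) (use assms in auto)
  from ring.subring_is_ring[OF c this] show "ring (complex_ring\<lparr>carrier := A\<rparr>)" .
qed

context prime_cyclotomic
begin

lemma ring_OK: "ring (complex_ring\<lparr>carrier := OK\<rparr>)"
  by (intro ring_complex_subring OK_closed)

lemma ideal_OK_iff: "ideal J (complex_ring\<lparr>carrier := OK\<rparr>) \<longleftrightarrow> OK_module J \<and> J \<subseteq> OK"
proof
  assume "ideal J (complex_ring\<lparr>carrier := OK\<rparr>)"
  then interpret J: ideal J "complex_ring\<lparr>carrier := OK\<rparr>" .
  have "J \<subseteq> OK" using J.a_subset by simp
  moreover have "OK_module J"
    unfolding OK_module_def
    using additive_subgroup.zero_closed[OF J.is_additive_subgroup]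
      additive_subgroup.a_closed[OF J.is_additive_subgroup] J.I_l_closed by simp
  ultimately show "OK_module J \<and> J \<subseteq> OK" by blast
next
  assume J: "OK_module J \<and> J \<subseteq> OK"
  interpret R: ring "complex_ring\<lparr>carrier := OK\<rparr>" by (rule ring_OK)
  show "ideal J (complex_ring\<lparr>carrier := OK\<rparr>)"
  proof (rule idealI[OF ring_OK])
    have inv: "inv\<^bsub>add_monoid (complex_ring\<lparr>carrier := OK\<rparr>)\<^esub> x = - x" if "x \<in> OK" for x
      using R.minus_equality[of "- x" x] that by (simp add: a_inv_def OK_closed(6))
    show "subgroup J (add_monoid (complex_ring\<lparr>carrier := OK\<rparr>))"
    proof (rule group.subgroupI[OF abelian_group.a_group[OF ring.is_abelian_group[OF ring_OK]]])
      show "J \<subseteq> carrier (add_monoid (complex_ring\<lparr>carrier := OK\<rparr>))" using J by simp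
      show "J \<noteq> {}" using J OK_moduleD(1) by auto
      show "inv\<^bsub>add_monoid (complex_ring\<lparr>carrier := OK\<rparr>)\<^esub> x \<in> J" if "x \<in> J" for x
        using that J inv[of x] OK_module_minus[of J x] by auto
      show "x \<otimes>\<^bsub>add_monoid (complex_ring\<lparr>carrier := OK\<rparr>)\<^esub> y \<in> J" if "x \<in> J" "y \<in> J" for x y
        using that J OK_moduleD(2) by simp
    qed
  next
    fix a x assume ax: "a \<in> J" "x \<in> carrier (complex_ring\<lparr>carrier := OK\<rparr>)"
    hence "x * a \<in> J" using J OK_moduleD(3) by simp
    thus "x \<otimes>\<^bsub>complex_ring\<lparr>carrier := OK\<rparr>\<^esub> a \<in> J" "a \<otimes>\<^bsub>complex_ring\<lparr>carrier := OK\<rparr>\<^esub> x \<in> J"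
      by (simp_all add: mult.commute)
  qed
qed

lemma fractional_ideal_iff: "fractional_ideal K I \<longleftrightarrow> frac_ideal I"
proof -
  have "OK_module (sc d I) \<longleftrightarrow> OK_module I" if "d \<noteq> 0" for d
  proof
    assume "OK_module (sc d I)"
    hence "OK_module (sc (inverse d) (sc d I))" by (rule OK_module_sc)
    thus "OK_module I" using that by (simp only: sc_sc left_inverse[OF that] sc_1)
  qed (rule OK_module_sc)
  thus ?thesis
    unfolding fractional_ideal_def frac_ideal_def OK_def[symmetric] ideal_OK_iff by blast
qed

section \<open>The class group in terms of scaled ideals\<close>

definition FI :: "complex set monoid" where "FI = fractional_ideal_group K"
definition PK :: "complex set set" where "PK = principal_fractional_ideals K"

lemma FI_simps [simp]: "carrier FI = {I. frac_ideal I}" "I \<otimes>\<^bsub>FI\<^esub> J = ip I J" "\<one>\<^bsub>FI\<^esub> = OK"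
  by (simp_all add: FI_def fractional_ideal_group_def fractional_ideal_iff OK_def)

lemma PK_iff: "I \<in> PK \<longleftrightarrow> (\<exists>a\<in>K. a \<noteq> 0 \<and> I = sc a OK)"
  by (auto simp: PK_def principal_fractional_ideals_def OK_def)

lemma frac_ideal_OK_module: "frac_ideal I \<Longrightarrow> OK_module I"
  by (simp add: frac_ideal_def)

lemma frac_ideal_OK: "frac_ideal OK"
  by (rule nz_ideal_frac_ideal[OF nz_ideal_OK])

lemma comm_group_FI: "comm_group FI"
proof (rule comm_groupI)
  fix I assume "I \<in> carrier FI"
  hence "frac_ideal I" by simp
  then obtain J where "frac_ideal J" "ip I J = OK" using frac_ideal_inverse by blast
  thus "\<exists>J\<in>carrier FI. J \<otimes>\<^bsub>FI\<^esub> I = \<one>\<^bsub>FI\<^esub>"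
    by (intro bexI[of _ J]) (simp_all add: ip_commute[of J I])
qed (simp_all add: frac_ideal_ip frac_ideal_OK ip_assoc ip_OK frac_ideal_OK_module, rule ip_commute)

lemma subgroup_PK: "subgroup PK FI"
proof -
  interpret FI: comm_group FI by (rule comm_group_FI)
  show ?thesis
  proof (rule FI.subgroupI)
    show "PK \<subseteq> carrier FI" by (auto simp: PK_iff intro!: frac_ideal_sc frac_ideal_OK)
    have "OK \<in> PK" unfolding PK_iff by (intro bexI[of _ 1] conjI) (simp_all add: K_closed)
    thus "PK \<noteq> {}" by blast
  next
    fix I assume "I \<in> PK"
    then obtain a where a: "a \<in> K" "a \<noteq> 0" "I = sc a OK" by (auto simp: PK_iff)
    have "ip (sc (inverse a) OK) I = OK"
      unfolding a ip_sc_left ip_sc_right ip_OK[OF OK_module_OK] sc_sc using a by simp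
    moreover have "frac_ideal (sc (inverse a) OK)" "frac_ideal I" using a by (auto intro!: frac_ideal_sc frac_ideal_OK K_closed)
    ultimately have "inv\<^bsub>FI\<^esub> I = sc (inverse a) OK"
      by (intro FI.inv_equality) simp_all
    thus "inv\<^bsub>FI\<^esub> I \<in> PK" using a unfolding PK_iff
      by (intro bexI[of _ "inverse a"]) (simp_all add: K_closed)
  next
    fix I J assume "I \<in> PK" "J \<in> PK"
    then obtain a b where ab: "a \<in> K" "a \<noteq> 0" "I = sc a OK" "b \<in> K" "b \<noteq> 0" "J = sc b OK"
      by (auto simp: PK_iff)
    have "ip I J = sc (b * a) OK"
      unfolding ab ip_sc_left ip_sc_right ip_OK[OF OK_module_OK] sc_sc by (simp add: mult.commute)
    thus "I \<otimes>\<^bsub>FI\<^esub> J \<in> PK" using ab unfolding PK_iff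
      by (intro bexI[of _ "b * a"]) (simp_all add: K_closed)
  qed
qed

definition Cl :: "complex set set monoid" where "Cl = class_group K"

lemma Cl_FactGroup: "Cl = FI Mod PK"
  by (simp add: Cl_def class_group_def FI_def PK_def)

lemma comm_group_Cl: "comm_group Cl"
  unfolding Cl_FactGroup using comm_group.abelian_FactGroup[OF comm_group_FI subgroup_PK] .

text \<open>The coset of \<open>I\<close> modulo principal ideals, see
  \<open>ideal_class_coset\<close>; in this form equality of classes is visibly scaling by a field
  element.\<close>

definition ideal_class :: "complex set \<Rightarrow> complex set set" where
  "ideal_class I = {sc a I |a. a \<in> K \<and> a \<noteq> 0}"

lemma ideal_class_coset: "OK_module I \<Longrightarrow> PK #>\<^bsub>FI\<^esub> I = ideal_class I"
proof -
  assume I: "OK_module I"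
  have "ip (sc a OK) I = sc a I" for a by (simp only: ip_sc_left ip_OK[OF I])
  moreover have "(\<exists>h\<in>PK. J = ip h I) \<longleftrightarrow> (\<exists>a\<in>K. a \<noteq> 0 \<and> J = ip (sc a OK) I)" for J
    by (metis PK_iff)
  ultimately have "(\<exists>h\<in>PK. J = ip h I) \<longleftrightarrow> J \<in> ideal_class I" for J
    by (simp only: ideal_class_def mem_Collect_eq) metis
  thus ?thesis unfolding r_coset_def FI_simps by blast
qed

lemma self_in_ideal_class: "I \<in> ideal_class I"
  unfolding ideal_class_def by (rule CollectI, rule exI[of _ 1]) (simp add: K_closed)

lemma ideal_class_sc: 
  assumes "a \<in> K" "a \<noteq> 0"
  shows "ideal_class (sc a I) = ideal_class I"
proof -
  have "\<exists>c. sc b (sc a I) = sc c I \<and> c \<in> K \<and> c \<noteq> 0" if "b \<in> K" "b \<noteq> 0" for b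
    using that assms by (intro exI[of _ "b * a"]) (simp add: sc_sc K_closed)
  moreover have "\<exists>c. sc b I = sc c (sc a I) \<and> c \<in> K \<and> c \<noteq> 0" if "b \<in> K" "b \<noteq> 0" for b
  proof -
    have "b / a * a = b" using assms by simp
    hence "sc (b / a) (sc a I) = sc b I" by (simp only: sc_sc)
    moreover have "b / a \<in> K" "b / a \<noteq> 0" using that assms by (auto intro: K_closed(11))
    ultimately show ?thesis by metis
  qed
  ultimately show ?thesis unfolding ideal_class_def by blast
qed

lemma ideal_class_eq_iff: "ideal_class I = ideal_class J \<longleftrightarrow> (\<exists>a\<in>K. a \<noteq> 0 \<and> I = sc a J)"
proof
  assume "ideal_class I = ideal_class J"
  hence "I \<in> ideal_class J" using self_in_ideal_class[of I] by simp
  thus "\<exists>a\<in>K. a \<noteq> 0 \<and> I = sc a J" by (auto simp: ideal_class_def)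
qed (auto simp: ideal_class_sc)

lemma Cl_carrier: "carrier Cl = {ideal_class I |I. frac_ideal I}"
proof -
  have "carrier Cl = {PK #>\<^bsub>FI\<^esub> I |I. frac_ideal I}"
    unfolding Cl_FactGroup FactGroup_def RCOSETS_def by auto
  also have "\<dots> = (\<lambda>I. PK #>\<^bsub>FI\<^esub> I) ` {I. frac_ideal I}" by blast
  also have "\<dots> = ideal_class ` {I. frac_ideal I}" by (intro image_cong refl) (simp add: ideal_class_coset frac_ideal_OK_module)
  also have "\<dots> = {ideal_class I |I. frac_ideal I}" by blast
  finally show ?thesis .
qed

lemma Cl_one: "\<one>\<^bsub>Cl\<^esub> = ideal_class OK"
proof -
  have "\<one>\<^bsub>Cl\<^esub> = PK" by (simp add: Cl_FactGroup FactGroup_def)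
  moreover have "J \<in> PK \<longleftrightarrow> J \<in> ideal_class OK" for J
    unfolding PK_iff ideal_class_def mem_Collect_eq by metis
  ultimately show ?thesis by blast
qed

lemma Cl_mult: "frac_ideal I \<Longrightarrow> frac_ideal J \<Longrightarrow> ideal_class I \<otimes>\<^bsub>Cl\<^esub> ideal_class J = ideal_class (ip I J)"
proof -
  assume IJ: "frac_ideal I" "frac_ideal J"
  interpret FI: comm_group FI by (rule comm_group_FI)
  interpret PK: normal PK FI by (rule FI.subgroup_imp_normal[OF subgroup_PK])
  have "ideal_class I \<otimes>\<^bsub>Cl\<^esub> ideal_class J = (PK #>\<^bsub>FI\<^esub> I) <#>\<^bsub>FI\<^esub> (PK #>\<^bsub>FI\<^esub> J)"
    using IJ by (simp add: Cl_FactGroup FactGroup_def ideal_class_coset frac_ideal_OK_module)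
  also have "\<dots> = PK #>\<^bsub>FI\<^esub> (I \<otimes>\<^bsub>FI\<^esub> J)" using IJ by (intro PK.rcos_sum) auto
  also have "\<dots> = ideal_class (ip I J)" using IJ by (simp add: ideal_class_coset frac_ideal_OK_module frac_ideal_ip)
  finally show ?thesis .
qed

lemma finite_Cl: "finite (carrier Cl)"
proof -
  obtain S where S: "finite S" "\<And>J. J \<in> S \<Longrightarrow> nz_ideal J"
    "\<And>I. frac_ideal I \<Longrightarrow> \<exists>a\<in>K. a \<noteq> 0 \<and> sc a I \<in> S"
    using finite_class_representatives by blast
  have "carrier Cl \<subseteq> ideal_class ` S"
  proof
    fix C assume "C \<in> carrier Cl"
    then obtain I where I: "frac_ideal I" "C = ideal_class I" by (auto simp: Cl_carrier)
    then obtain a where "a \<in> K" "a \<noteq> 0" "sc a I \<in> S" using S(3) by blast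
    moreover from this have "C = ideal_class (sc a I)" using I by (simp add: ideal_class_sc)
    ultimately show "C \<in> ideal_class ` S" by blast
  qed
  thus ?thesis using S(1) finite_subset by blast
qed

lemma frac_ideal_ideal_pow: "frac_ideal I \<Longrightarrow> frac_ideal (ideal_pow I n)"
  by (induction n) (auto intro: frac_ideal_OK frac_ideal_ip)

lemma ideal_pow_ip: "ideal_pow (ip I J) n = ip (ideal_pow I n) (ideal_pow J n)"
proof (induction n)
  case 0
  show ?case by (simp add: ip_OK OK_module_OK)
next
  case (Suc n)
  have "ip (ip I J) (ip A B) = ip (ip I A) (ip J B)" for A B
    by (metis ip_assoc ip_commute)
  thus ?case using Suc by simp
qed

lemma ideal_pow_sc: "ideal_pow (sc a I) n = sc (a ^ n) (ideal_pow I n)"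
proof (induction n)
  case (Suc n)
  have "ideal_pow (sc a I) (Suc n) = ip (sc a I) (sc (a ^ n) (ideal_pow I n))" by (simp only: ideal_pow.simps Suc)
  also have "\<dots> = sc (a ^ Suc n) (ideal_pow I (Suc n))"
    by (simp only: ip_sc_left ip_sc_right sc_sc ideal_pow.simps power_Suc2)
  finally show ?case .
qed simp

lemma ideal_pow_OK: "ideal_pow OK n = OK"
  by (induction n) (simp_all add: ip_OK OK_module_OK)

lemma Cl_pow: "frac_ideal I \<Longrightarrow> ideal_class I [^]\<^bsub>Cl\<^esub> n = ideal_class (ideal_pow I n)"
proof (induction n)
  case 0
  thus ?case by (simp add: Cl_one)
next
  case (Suc n)
  thus ?case by (simp add: Cl_mult frac_ideal_ideal_pow ip_commute)
qed

subsection \<open>The maximal real subfield and the relative norm\<close>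

definition K\<^sub>p :: "complex set" where "K\<^sub>p = rat_adjoin (\<zeta> + inverse \<zeta>)"

lemma inverse_zeta: "inverse \<zeta> = cnj \<zeta>"
proof -
  have "\<zeta> * \<zeta> ^ (p - 1) = 1" using p3 zeta_p by (metis power_eq_if not_numeral_le_zero)
  thus ?thesis unfolding cnj_zeta by (rule inverse_unique)
qed

text \<open>A real \<open>x\<close> is half of \<open>x + cnj x\<close>, a rational combination of
  the \<open>\<zeta> ^ k + cnj \<zeta> ^ k\<close>. These obey a three-term recursion of Chebyshev
  type, so they are polynomials in \<open>\<zeta> + inverse \<zeta>\<close>.\<close>

lemma real_subfield_iff: "x \<in> K\<^sub>p \<longleftrightarrow> x \<in> K \<and> cnj x = x"
proof
  assume "x \<in> K\<^sub>p"
  thus "x \<in> K \<and> cnj x = x"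
    unfolding K\<^sub>p_def
  proof (induction rule: rat_adjoin_induct)
    case gen
    show ?case by (simp add: inverse_zeta K_closed cnj_in_K)
  qed (auto intro: K_closed)
next
  assume x: "x \<in> K \<and> cnj x = x"
  obtain r where r: "x = (\<Sum>k<p. of_rat (r k) * \<zeta> ^ k)" using K_coords x by blast
  have e: "\<zeta> ^ k + cnj \<zeta> ^ k \<in> K\<^sub>p" for k
  proof (induction k rule: less_induct)
    case (less k)
    have g: "\<zeta> + cnj \<zeta> \<in> K\<^sub>p" using rat_adjoin_gen[of "\<zeta> + inverse \<zeta>"] by (simp add: K\<^sub>p_def inverse_zeta)
    have zz: "\<zeta> * cnj \<zeta> = 1" using zeta_nz inverse_zeta by (metis right_inverse)
    consider "k = 0" | "k = 1" | j where "k = Suc (Suc j)" by (metis One_nat_def not0_implies_Suc)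
    thus ?case
    proof cases
      case 1
      have "1 + 1 \<in> K\<^sub>p" unfolding K\<^sub>p_def by (intro rat_adjoin_add rat_adjoin_1)
      thus ?thesis using 1 by simp
    next
      case 2
      thus ?thesis using g by simp
    next
      case 3
      have "\<zeta> ^ k + cnj \<zeta> ^ k = (\<zeta> + cnj \<zeta>) * (\<zeta> ^ Suc j + cnj \<zeta> ^ Suc j) -
          (\<zeta> * cnj \<zeta>) * (\<zeta> ^ j + cnj \<zeta> ^ j)"
        by (simp add: 3 algebra_simps)
      also have "\<dots> \<in> K\<^sub>p"
        using g less[of "Suc j"] less[of j] 3 unfolding zz K\<^sub>p_def
        by (intro rat_adjoin_diff rat_adjoin_mult rat_adjoin_1) auto
      finally show ?thesis .
    qed
  qed
  have "cnj (of_rat s) = of_rat s" for s by (cases s) (simp add: of_rat_rat)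
  hence "cnj x = (\<Sum>k<p. of_rat (r k) * cnj \<zeta> ^ k)" by (simp add: r)
  hence "x + cnj x = (\<Sum>k<p. of_rat (r k) * (\<zeta> ^ k + cnj \<zeta> ^ k))"
    unfolding r by (simp add: sum.distrib distrib_left)
  also have "\<dots> \<in> K\<^sub>p" using e unfolding K\<^sub>p_def by (intro rat_adjoin_sum rat_adjoin_mult rat_adjoin_of_rat) auto
  finally have "x + x \<in> K\<^sub>p" using x by simp
  hence "(x + x) / of_nat 2 \<in> K\<^sub>p" unfolding K\<^sub>p_def by (intro rat_adjoin_divide rat_adjoin_of_nat)
  thus "x \<in> K\<^sub>p" by simp
qed

definition OF :: "complex set" where "OF = ring_of_integers K\<^sub>p"

lemma OF_iff: "x \<in> OF \<longleftrightarrow> x \<in> OK \<and> cnj x = x"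
  by (auto simp: OF_def ring_of_integers_def real_subfield_iff OK_iff)

lemma OF_closed:
  "0 \<in> OF" "1 \<in> OF" "x \<in> OF \<Longrightarrow> y \<in> OF \<Longrightarrow> x + y \<in> OF" "x \<in> OF \<Longrightarrow> y \<in> OF \<Longrightarrow> x * y \<in> OF"
  by (auto simp: OF_iff intro: OK_closed)

lemma zeta_neq_cnj: "\<zeta> \<noteq> cnj \<zeta>"
proof
  assume "\<zeta> = cnj \<zeta>"
  hence "\<zeta> ^ 1 = \<zeta> ^ (p - 1)" by (simp add: cnj_zeta)
  hence "1 mod p = (p - 1) mod p" by (simp only: zeta_eq_iff)
  thus False using p3 by simp
qed

text \<open>An embedding over \<open>K\<^sub>p\<close> preserves the sum and the product of
  \<open>\<zeta>\<close> and \<open>cnj \<zeta>\<close>, so it maps \<open>\<zeta>\<close> to a root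
  of their common quadratic polynomial; its value at \<open>\<zeta>\<close> determines it on
  \<open>K\<close>.\<close>

lemma embeddings: "embeddings_over K\<^sub>p K = {restrict (\<lambda>x. x) K, restrict cnj K}"
proof (intro equalityI subsetI)
  fix s assume s: "s \<in> embeddings_over K\<^sub>p K"
  have ext: "s \<in> extensional K" using s by (simp add: embeddings_over_def)
  have hom: "s \<in> Ring.ring_hom (complex_ring\<lparr>carrier := K\<rparr>) complex_ring"
    using s by (simp add: embeddings_over_def)
  have fix_real: "s x = x" if "x \<in> K\<^sub>p" for x using s that by (simp add: embeddings_over_def)
  have mult: "s (x * y) = s x * s y" if "x \<in> K" "y \<in> K" for x y
    using ring_hom_mult[OF hom, of x y] that by simp
  have add: "s (x + y) = s x + s y" if "x \<in> K" "y \<in> K" for x y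
    using ring_hom_add[OF hom, of x y] that by simp
  have s1: "s 1 = 1" using ring_hom_one[OF hom] by simp
  have zero: "s 0 = 0" using add[of 0 0] K_closed(1) by simp
  have minus: "s (- x) = - s x" if "x \<in> K" for x
  proof -
    have "s x + s (- x) = 0" using add[of x "- x"] that zero by (simp add: K_closed)
    thus ?thesis by (simp add: add_eq_0_iff)
  qed
  have inv: "s (inverse x) = inverse (s x)" if "x \<in> K" "x \<noteq> 0" for x
  proof -
    have "s x * s (inverse x) = 1" using mult[of x "inverse x"] that s1 by (simp add: K_closed)
    thus ?thesis by (metis inverse_unique)
  qed
  have zK: "\<zeta> \<in> K" "cnj \<zeta> \<in> K" by (auto intro: K_closed cnj_in_K)
  have zz: "\<zeta> * cnj \<zeta> = 1" using zeta_nz inverse_zeta by (metis right_inverse)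
  have "s (\<zeta> + cnj \<zeta>) = \<zeta> + cnj \<zeta>"
    using fix_real[of "\<zeta> + cnj \<zeta>"] rat_adjoin_gen[of "\<zeta> + inverse \<zeta>"] by (simp add: K\<^sub>p_def inverse_zeta)
  hence sum: "s \<zeta> + s (cnj \<zeta>) = \<zeta> + cnj \<zeta>" using add zK by simp
  have prod: "s \<zeta> * s (cnj \<zeta>) = 1" using mult[OF zK] zz s1 by simp
  have "(s \<zeta> - \<zeta>) * (s \<zeta> - cnj \<zeta>) = s \<zeta> * s \<zeta> - s \<zeta> * (\<zeta> + cnj \<zeta>) + \<zeta> * cnj \<zeta>"
    by (simp add: algebra_simps)
  also have "\<dots> = 0" unfolding sum[symmetric] zz prod[symmetric] by (simp add: algebra_simps)
  finally have "s \<zeta> = \<zeta> \<or> s \<zeta> = cnj \<zeta>" by simp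
  thus "s \<in> {restrict (\<lambda>x. x) K, restrict cnj K}"
  proof
    assume sz: "s \<zeta> = \<zeta>"
    have "s x = x" if "x \<in> K" for x
      using that unfolding K_def
    proof (induction rule: rat_adjoin_induct)
      case one show ?case by (rule s1)
    next
      case gen show ?case by (rule sz)
    qed (simp_all add: add mult minus inv K_def[symmetric])
    hence "s = restrict (\<lambda>x. x) K" using ext by (intro extensionalityI[of s K]) auto
    thus ?thesis by simp
  next
    assume sz: "s \<zeta> = cnj \<zeta>"
    have "s x = cnj x" if "x \<in> K" for x
      using that unfolding K_def
    proof (induction rule: rat_adjoin_induct)
      case one show ?case using s1 by simp
    next
      case gen show ?case by (rule sz)
    qed (simp_all add: add mult minus inv K_def[symmetric])
    hence "s = restrict cnj K" using ext by (intro extensionalityI[of s K]) auto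
    thus ?thesis by simp
  qed
next
  fix s assume "s \<in> {restrict (\<lambda>x. x) K, restrict cnj K}"
  hence "s = restrict (\<lambda>x. x) K \<or> s = restrict cnj K" by simp
  thus "s \<in> embeddings_over K\<^sub>p K"
    by (elim disjE) (auto simp: embeddings_over_def Ring.ring_hom_def K_closed real_subfield_iff)
qed

lemma relative_norm_eq:
  assumes "x \<in> K"
  shows "relative_norm K\<^sub>p K x = x * cnj x"
proof -
  have "restrict (\<lambda>x. x) K \<zeta> \<noteq> restrict cnj K \<zeta>" using zeta_neq_cnj K_closed(14) by simp
  hence "restrict (\<lambda>x. x) K \<noteq> restrict cnj K" by metis
  thus ?thesis using assms by (simp add: relative_norm_def embeddings)
qed

section \<open>Relative norms of ideals and ideal classes\<close>

definition NI :: "complex set \<Rightarrow> complex set" where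
  "NI I = ip OF ((\<lambda>x. x * cnj x) ` I)"

lemma ideal_norm_eq: "frac_ideal I \<Longrightarrow> ideal_norm K\<^sub>p K I = NI I"
proof -
  assume "frac_ideal I"
  hence "relative_norm K\<^sub>p K ` I = (\<lambda>x. x * cnj x) ` I"
    by (intro image_cong refl relative_norm_eq frac_ideal_K)
  thus ?thesis by (simp add: ideal_norm_def NI_def OF_def)
qed

lemma NI_sc: "NI (sc a I) = sc (a * cnj a) (NI I)"
proof -
  have "(\<lambda>x. x * cnj x) ` (sc a I) = sc (a * cnj a) ((\<lambda>x. x * cnj x) ` I)"
    by (simp add: image_image mult_ac)
  thus ?thesis unfolding NI_def by (simp only: ip_sc_right)
qed

lemma ip_OF_OF: "ip OF OF = OF"
proof
  show "ip OF OF \<subseteq> OF" by (intro ip_subset OF_closed)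
  show "OF \<subseteq> ip OF OF" using ip_mem[OF OF_closed(2)] by force
qed

lemma ip_OF_NI: "ip OF (NI I) = NI I"
  unfolding NI_def ip_assoc[symmetric] ip_OF_OF ..

lemma ip_OK_OF: "ip OK OF = OK"
proof
  show "ip OK OF \<subseteq> OK" by (intro ip_subset OK_closed(7,9)) (auto simp: OF_iff)
  show "OK \<subseteq> ip OK OF" using ip_mem[OF _ OF_closed(2), of _ OK] by force
qed

text \<open>The equation makes \<open>OK + OK * z\<close> stable under \<open>z\<close>, and a
  denominator of \<open>z\<close> makes it a fractional ideal; so \<open>stabilizer_integral\<close>
  applies.\<close>

lemma integral_quadratic:
  assumes z: "z \<in> K" "z * z = a * z - b" and ab: "a \<in> OK" "b \<in> OK"
  shows "z \<in> OK"
proof -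
  define J where "J = {u + v * z |u v. u \<in> OK \<and> v \<in> OK}"
  have JI: "u + v * z \<in> J" if "u \<in> OK" "v \<in> OK" for u v using that by (auto simp: J_def)
  have om: "OK_module J"
    unfolding OK_module_def
  proof (intro conjI ballI)
    show "0 \<in> J" using JI[OF OK_closed(1) OK_closed(1)] by simp
  next
    fix x y assume "x \<in> J" "y \<in> J"
    then obtain u v u' v' where uv: "x = u + v * z" "y = u' + v' * z" "u \<in> OK" "v \<in> OK" "u' \<in> OK" "v' \<in> OK"
      by (auto simp: J_def)
    have "x + y = (u + u') + (v + v') * z" by (simp add: uv algebra_simps)
    also have "\<dots> \<in> J" by (intro JI OK_closed(7) uv)
    finally show "x + y \<in> J" .
  next
    fix c x assume c: "c \<in> OK" and "x \<in> J"
    then obtain u v where uv: "x = u + v * z" "u \<in> OK" "v \<in> OK" by (auto simp: J_def)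
    have "c * x = (c * u) + (c * v) * z" by (simp add: uv algebra_simps)
    also have "\<dots> \<in> J" by (intro JI OK_closed(9) uv c)
    finally show "c * x \<in> J" .
  qed
  obtain n where n: "n > 0" "of_nat n * z \<in> OK" using OK_denominator[OF z(1)] .
  have "1 \<in> J" using JI[OF OK_closed(2) OK_closed(1)] by simp
  hence "J \<noteq> {0}" by (metis one_neq_zero singletonD)
  moreover have "sc (of_nat n) J \<subseteq> OK"
  proof
    fix y assume "y \<in> sc (of_nat n) J"
    then obtain u v where uv: "y = of_nat n * (u + v * z)" "u \<in> OK" "v \<in> OK" by (auto simp: J_def)
    have "y = of_nat n * u + v * (of_nat n * z)" by (simp add: uv algebra_simps)
    also have "\<dots> \<in> OK" by (intro OK_closed(4,7,9) uv n)
    finally show "y \<in> OK" .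
  qed
  ultimately have "frac_ideal J" using om n(1) OK_closed(4)[of n] unfolding frac_ideal_def
    by (intro conjI bexI[of _ "of_nat n"]) auto
  then obtain d where d: "d \<in> OK" "d \<noteq> 0" "nz_ideal (sc d J)" using frac_ideal_nz_ideal by blast
  have "z * x \<in> sc d J" if "x \<in> sc d J" for x
  proof -
    obtain u v where uv: "x = d * (u + v * z)" "u \<in> OK" "v \<in> OK" using \<open>x \<in> sc d J\<close> by (auto simp: J_def)
    have "z * x = d * (u * z + v * (z * z))" by (simp add: uv algebra_simps)
    also have "\<dots> = d * (- (v * b) + (u + v * a) * z)" unfolding z(2) by (simp add: algebra_simps)
    also have "\<dots> \<in> sc d J" by (intro imageI JI OK_closed(6,7,9) uv ab)
    finally show ?thesis .
  qed
  hence "algebraic_int z" using stabilizer_integral[OF d(3)] by blast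
  thus ?thesis using z(1) by (simp add: OK_iff)
qed

lemma OK_module_cnj:
  assumes om: "OK_module I"
  shows "OK_module (cnj ` I)"
  unfolding OK_module_def
proof (intro conjI ballI)
  show "0 \<in> cnj ` I" using imageI[OF OK_moduleD(1)[OF om], of cnj] by simp
  show "x + y \<in> cnj ` I" if xy: "x \<in> cnj ` I" "y \<in> cnj ` I" for x y
  proof -
    obtain u v where "x = cnj u" "y = cnj v" "u \<in> I" "v \<in> I" using xy by blast
    thus ?thesis using imageI[OF OK_moduleD(2)[OF om, of u v], of cnj] by simp
  qed
  show "a * x \<in> cnj ` I" if ax: "a \<in> OK" "x \<in> cnj ` I" for a x
  proof -
    obtain u where "x = cnj u" "u \<in> I" using ax by blast
    thus ?thesis using imageI[OF OK_moduleD(3)[OF om OK_cnj[OF ax(1)], of u], of cnj] by simp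
  qed
qed

text \<open>For \<open>a, b \<in> I\<close> the product \<open>a * cnj b\<close> is a root of a quadratic polynomial whose coefficients
  are made of norms, hence it is integral over the ideal generated by the norms.\<close>

lemma ideal_of_norms:
  assumes I: "frac_ideal I"
  shows "ip OK ((\<lambda>x. x * cnj x) ` I) = ip I (cnj ` I)"
proof
  define N where "N = (\<lambda>x. x * cnj x) ` I"
  define M where "M = ip OK N"
  have om: "OK_module I" by (rule frac_ideal_OK_module[OF I])
  have omc: "OK_module (cnj ` I)" by (rule OK_module_cnj[OF om])
  show "ip OK ((\<lambda>x. x * cnj x) ` I) \<subseteq> ip I (cnj ` I)"
    by (intro ip_subset OK_moduleD[OF OK_module_ip[OF om omc]]) (auto intro: ip_mem)
  have NM: "x * cnj x \<in> M" if "x \<in> I" for x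
    using ip_mem[OF OK_closed(2), of "x * cnj x" N] that by (simp add: M_def N_def)
  have omM: "OK_module M"
  proof -
    have "0 \<in> M" using NM[OF OK_moduleD(1)[OF om]] by simp
    moreover have "a * x \<in> M" if "a \<in> OK" "x \<in> M" for a x
      using that(2) unfolding M_def
    proof (induction rule: ip_induct)
      case (prod i j)
      have "a * i * j \<in> ip OK N" by (intro ip_mem OK_closed(9) that(1) prod)
      thus ?case by (simp add: mult.assoc)
    next
      case (add x y)
      thus ?case by (simp add: distrib_left ip_add)
    qed
    ultimately show ?thesis by (auto simp: OK_module_def M_def ip_add)
  qed
  obtain x0 where x0: "x0 \<in> I" "x0 \<noteq> 0" using frac_ideal_nonzero_elem[OF I] by blast
  have "M \<noteq> {0}" using NM[OF x0(1)] x0(2) by (metis complex_cnj_zero_iff mult_eq_0_iff singletonD)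
  obtain d where d: "d \<in> OK" "d \<noteq> 0" "nz_ideal (sc d I)" using frac_ideal_nz_ideal[OF I] .
  have "sc (d * cnj d) M \<subseteq> OK"
  proof
    fix y assume "y \<in> sc (d * cnj d) M"
    then obtain x where x: "x \<in> M" "y = d * cnj d * x" by blast
    have "d * cnj d * x \<in> OK" using x(1) unfolding M_def
    proof (induction rule: ip_induct)
      case (prod i j)
      then obtain u where u: "u \<in> I" "j = u * cnj u" by (auto simp: N_def)
      have du: "d * u \<in> OK" using d(3) u by (auto simp: nz_ideal_def)
      have "i * ((d * u) * cnj (d * u)) \<in> OK"
        by (rule OK_closed(9)[OF prod(1) OK_closed(9)[OF du OK_cnj[OF du]]])
      thus ?case by (simp add: u mult_ac)
    next
      case (add x y)
      thus ?case by (simp add: distrib_left OK_closed)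
    qed
    thus "y \<in> OK" by (simp add: x)
  qed
  moreover have "d * cnj d \<in> OK" "d * cnj d \<noteq> 0" using d by (auto intro: OK_closed(9) OK_cnj)
  ultimately have "frac_ideal M" using omM \<open>M \<noteq> {0}\<close> unfolding frac_ideal_def by blast
  then obtain M' where M': "frac_ideal M'" "ip M M' = OK" using frac_ideal_inverse by blast
  have "a * cnj b \<in> M" if ab: "a \<in> I" "b \<in> I" for a b
  proof -
    define t where "t = a * cnj b"
    have tK: "t \<in> K" unfolding t_def using frac_ideal_K[OF I] ab by (intro K_closed cnj_in_K)
    \<comment> \<open>Polarization: the trace of \<open>a * cnj b\<close> is a difference of norms
      of \<open>a + b\<close>, \<open>a\<close> and \<open>b\<close>.\<close>
    have m1: "t + cnj t \<in> M"
    proof -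
      have "t + cnj t = (a + b) * cnj (a + b) - a * cnj a - b * cnj b" by (simp add: t_def algebra_simps)
      also have "\<dots> \<in> M" by (intro OK_module_diff[OF omM] NM OK_moduleD(2)[OF om] ab)
      finally show ?thesis .
    qed
    have cOK: "c * x \<in> OK" if "c \<in> M'" "x \<in> M" for c x
      using ip_mem[OF that(2,1)] M'(2) by (simp add: mult.commute)
    \<comment> \<open>Integrality over the ideal \<open>M\<close> is tested after multiplication
      with elements of its inverse \<open>M'\<close>, which makes both coefficients of the quadratic
      integral. Then \<open>M * M' = OK\<close> brings \<open>t\<close> back into
      \<open>M\<close>.\<close>
    have ct: "c * t \<in> OK" if c: "c \<in> M'" for c
    proof (rule integral_quadratic)
      show "c * t \<in> K" by (intro K_closed tK frac_ideal_K[OF M'(1) c])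
      show "(c * t) * (c * t) = (c * (t + cnj t)) * (c * t) - (c * (a * cnj a)) * (c * (b * cnj b))"
        by (simp add: t_def algebra_simps)
      show "c * (t + cnj t) \<in> OK" by (intro cOK c m1)
      show "(c * (a * cnj a)) * (c * (b * cnj b)) \<in> OK" by (intro OK_closed(9) cOK c NM ab)
    qed
    have "x * t \<in> M" if "x \<in> ip M M'" for x
      using that
    proof (induction rule: ip_induct)
      case (prod m c)
      have "(c * t) * m \<in> M" by (intro OK_moduleD(3)[OF omM] ct prod)
      thus ?case by (simp add: mult_ac)
    next
      case (add x y)
      thus ?case by (simp add: distrib_right OK_moduleD(2)[OF omM])
    qed
    from this[of 1] show ?thesis using M'(2) OK_closed(2) by (simp add: t_def)
  qed
  thus "ip I (cnj ` I) \<subseteq> ip OK ((\<lambda>x. x * cnj x) ` I)"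
    unfolding M_def[symmetric] N_def[symmetric] by (intro ip_subset OK_moduleD(2)[OF omM]) auto
qed

lemma ip_OK_NI: "frac_ideal I \<Longrightarrow> ip OK (NI I) = ip I (cnj ` I)"
  unfolding NI_def ip_assoc[symmetric] ip_OK_OF by (rule ideal_of_norms)

text \<open>Take the norm of an expression of \<open>1\<close> as a combination of elements of \<open>N\<close>.\<close>

lemma OF_ideal_trivial:
  assumes N: "N \<subseteq> OF" "0 \<in> N" "\<And>x y. x \<in> N \<Longrightarrow> y \<in> N \<Longrightarrow> x + y \<in> N"
    "\<And>a x. a \<in> OF \<Longrightarrow> x \<in> N \<Longrightarrow> a * x \<in> N" and 1: "1 \<in> ip OK N"
  shows "1 \<in> N"
proof -
  have real: "cnj x = x" if "x \<in> N" for x using that N(1) by (auto simp: OF_iff)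
  have sub: "ip OK N \<subseteq> OK" using N(1) by (intro ip_subset OK_closed(7,9)) (auto simp: OF_iff)
  \<comment> \<open>The norm of a sum differs from the sum of the norms by such a trace. It stays in
    \<open>N\<close> because elements of \<open>N\<close> are real and traces of integers lie in
    \<open>OF\<close>.\<close>
  have tr: "y * w + cnj (y * w) \<in> N" if "y \<in> ip OK N" "w \<in> OK" for y w
    using that(1)
  proof (induction rule: ip_induct)
    case (prod k n)
    have "(k * w + cnj (k * w)) * n \<in> N"
      using prod that(2) by (intro N(4)) (auto simp: OF_iff add.commute intro!: OK_closed(7,9) OK_cnj)
    thus ?case using real[OF prod(2)] by (simp add: algebra_simps)
  next
    case (add x y)
    have "(x * w + cnj (x * w)) + (y * w + cnj (y * w)) \<in> N" by (rule N(3)[OF add(3,4)])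
    thus ?case by (simp add: algebra_simps)
  qed
  have "y * cnj y \<in> N" if "y \<in> ip OK N" for y
    using that
  proof (induction rule: ip_induct)
    case (prod k n)
    have "(k * cnj k * n) * n \<in> N"
      using prod N(1) by (intro N(4)) (auto simp: OF_iff mult_ac intro!: OK_closed(9) OK_cnj)
    thus ?case using real[OF prod(2)] by (simp add: mult_ac)
  next
    case (add x y)
    have yO: "cnj y \<in> OK" using add(2) sub by (intro OK_cnj) auto
    have "(x * cnj x + y * cnj y) + (x * cnj y + cnj (x * cnj y)) \<in> N"
      by (rule N(3)[OF N(3)[OF add(3,4)] tr[OF add(1) yO]])
    thus ?case by (simp add: algebra_simps)
  qed
  from this[OF 1] show ?thesis by simp
qed

text \<open>Extending \<open>NI I\<close> to \<open>OK\<close> gives \<open>I\<close> times its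
  conjugate. Conversely, dividing by the real generator \<open>g\<close> leaves an ideal of
  \<open>OF\<close> whose extension is \<open>OK\<close>, and \<open>OF_ideal_trivial\<close> shows
  that it is \<open>OF\<close>. From here on the kernel of the norm is described inside
  \<open>OK\<close> alone.\<close>

lemma norm_principal_iff:
  assumes I: "frac_ideal I"
  shows "(\<exists>g\<in>K\<^sub>p. g \<noteq> 0 \<and> NI I = sc g OF) \<longleftrightarrow> (\<exists>g\<in>K\<^sub>p. g \<noteq> 0 \<and> ip I (cnj ` I) = sc g OK)"
proof
  assume "\<exists>g\<in>K\<^sub>p. g \<noteq> 0 \<and> NI I = sc g OF"
  then obtain g where g: "g \<in> K\<^sub>p" "g \<noteq> 0" "NI I = sc g OF" by blast
  have "ip I (cnj ` I) = sc g OK"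
    unfolding ip_OK_NI[OF I, symmetric] g(3) ip_sc_right ip_OK_OF ..
  thus "\<exists>g\<in>K\<^sub>p. g \<noteq> 0 \<and> ip I (cnj ` I) = sc g OK" using g by blast
next
  assume "\<exists>g\<in>K\<^sub>p. g \<noteq> 0 \<and> ip I (cnj ` I) = sc g OK"
  then obtain g where g: "g \<in> K\<^sub>p" "g \<noteq> 0" "ip I (cnj ` I) = sc g OK" by blast
  define N where "N = sc (inverse g) (NI I)"
  have gg: "inverse g * g = 1" using g(2) by simp
  have N: "ip OK N = OK"
    unfolding N_def ip_sc_right ip_OK_NI[OF I] g(3) sc_sc gg sc_1 ..
  have NI_real: "cnj x = x" if "x \<in> NI I" for x
    using that unfolding NI_def
    by (induction rule: ip_induct) (auto simp: OF_iff mult.commute)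
  have greal: "cnj g = g" using g(1) by (simp add: real_subfield_iff)
  have sub: "N \<subseteq> OF"
  proof
    fix x assume x: "x \<in> N"
    have "1 * x \<in> ip OK N" by (intro ip_mem OK_closed x)
    hence "x \<in> OK" using N by simp
    moreover have "cnj x = x" using x NI_real greal by (auto simp: N_def)
    ultimately show "x \<in> OF" by (simp add: OF_iff)
  qed
  have NN: "ip OF N = N" unfolding N_def ip_sc_right ip_OF_NI ..
  have mult: "a * x \<in> N" if "a \<in> OF" "x \<in> N" for a x using ip_mem[OF that] NN by simp
  have "1 \<in> N"
  proof (rule OF_ideal_trivial[OF sub])
    show "1 \<in> ip OK N" using N OK_closed(2) by simp
    show "x + y \<in> N" if "x \<in> N" "y \<in> N" for x y using ip_add[of x OF N y] that NN by simp
    show "a * x \<in> N" if "a \<in> OF" "x \<in> N" for a x by (rule mult[OF that])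
    obtain x0 where "x0 \<in> I" using OK_moduleD(1)[OF frac_ideal_OK_module[OF I]] by blast
    hence "1 * (x0 * cnj x0) \<in> NI I" unfolding NI_def by (intro ip_mem OF_closed imageI)
    hence "inverse g * (1 * (x0 * cnj x0)) \<in> N" unfolding N_def by (rule imageI)
    thus "0 \<in> N" using mult[OF OF_closed(1)] by fastforce
  qed
  hence "OF \<subseteq> N" using mult[of _ 1] by auto
  hence "N = OF" using sub by blast
  have "g * inverse g = 1" using g(2) by simp
  hence "NI I = sc g N" unfolding N_def sc_sc by (simp only: sc_1)
  thus "\<exists>g\<in>K\<^sub>p. g \<noteq> 0 \<and> NI I = sc g OF" using g \<open>N = OF\<close> by blast
qed

text \<open>Replacing \<open>I\<close> by \<open>a * I\<close> multiplies its norm by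
  \<open>a * cnj a\<close>, a nonzero element of \<open>K\<^sub>p\<close>. All members of a class
  thus have norms in one class, so \<open>the_elem\<close> is applied to a singleton.\<close>

lemma class_norm_eq:
  assumes I: "frac_ideal I"
  shows "class_norm K\<^sub>p K (ideal_class I) = {sc b (NI I) |b. b \<in> K\<^sub>p \<and> b \<noteq> 0}"
proof -
  have coset: "principal_fractional_ideals K\<^sub>p #>\<^bsub>fractional_ideal_group K\<^sub>p\<^esub> J =
      {sc b J |b. b \<in> K\<^sub>p \<and> b \<noteq> 0}" if "ip OF J = J" for J
  proof -
    have "ip (sc b OF) J = sc b J" for b unfolding ip_sc_left \<open>ip OF J = J\<close> ..
    thus ?thesis
      unfolding r_coset_def principal_fractional_ideals_def fractional_ideal_group_def OF_def by auto
  qed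
  have "principal_fractional_ideals K\<^sub>p #>\<^bsub>fractional_ideal_group K\<^sub>p\<^esub> ideal_norm K\<^sub>p K J =
      {sc b (NI I) |b. b \<in> K\<^sub>p \<and> b \<noteq> 0}" if "J \<in> ideal_class I" for J
  proof -
    obtain a where a: "a \<in> K" "a \<noteq> 0" "J = sc a I" using \<open>J \<in> ideal_class I\<close> by (auto simp: ideal_class_def)
    have aa: "a * cnj a \<in> K\<^sub>p" "a * cnj a \<noteq> 0"
      using a by (auto simp: real_subfield_iff mult.commute intro!: K_closed cnj_in_K)
    have "ideal_norm K\<^sub>p K J = sc (a * cnj a) (NI I)"
      unfolding a(3) ideal_norm_eq[OF frac_ideal_sc[OF I a(1,2)]] NI_sc ..
    hence "principal_fractional_ideals K\<^sub>p #>\<^bsub>fractional_ideal_group K\<^sub>p\<^esub> ideal_norm K\<^sub>p K J =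
        {sc b (sc (a * cnj a) (NI I)) |b. b \<in> K\<^sub>p \<and> b \<noteq> 0}"
      by (simp only: coset ip_sc_right ip_OF_NI)
    also have "\<dots> = {sc b (NI I) |b. b \<in> K\<^sub>p \<and> b \<noteq> 0}"
    proof (intro equalityI subsetI)
      fix L assume "L \<in> {sc b (sc (a * cnj a) (NI I)) |b. b \<in> K\<^sub>p \<and> b \<noteq> 0}"
      then obtain b where b: "b \<in> K\<^sub>p" "b \<noteq> 0" "L = sc (b * (a * cnj a)) (NI I)"
        unfolding sc_sc by blast
      moreover have "b * (a * cnj a) \<in> K\<^sub>p" using b(1) aa(1) unfolding K\<^sub>p_def by (rule rat_adjoin_mult)
      moreover have "b * (a * cnj a) \<noteq> 0" using b aa by simp
      ultimately show "L \<in> {sc b (NI I) |b. b \<in> K\<^sub>p \<and> b \<noteq> 0}" by blast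
    next
      fix L assume "L \<in> {sc b (NI I) |b. b \<in> K\<^sub>p \<and> b \<noteq> 0}"
      then obtain b where b: "b \<in> K\<^sub>p" "b \<noteq> 0" "L = sc b (NI I)" by blast
      have "b / (a * cnj a) * (a * cnj a) = b" using aa by simp
      hence "L = sc (b / (a * cnj a)) (sc (a * cnj a) (NI I))" unfolding sc_sc b(3) by simp
      moreover have "b / (a * cnj a) \<in> K\<^sub>p" using b aa unfolding K\<^sub>p_def by (intro rat_adjoin_divide)
      moreover have "b / (a * cnj a) \<noteq> 0" using b aa by simp
      ultimately show "L \<in> {sc b (sc (a * cnj a) (NI I)) |b. b \<in> K\<^sub>p \<and> b \<noteq> 0}" by blast
    qed
    finally show ?thesis .
  qed
  hence "(\<lambda>J. principal_fractional_ideals K\<^sub>p #>\<^bsub>fractional_ideal_group K\<^sub>p\<^esub> ideal_norm K\<^sub>p K J) ` ideal_class I =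
      {{sc b (NI I) |b. b \<in> K\<^sub>p \<and> b \<noteq> 0}}"
    using self_in_ideal_class[of I] by blast
  thus ?thesis unfolding class_norm_def by simp
qed

definition RC :: "complex set set monoid" where "RC = relative_class_group K\<^sub>p K"

text \<open>The ideals whose class lies in the kernel of the norm. The generator is taken in
  \<open>K\<^sub>p\<close> because triviality is meant in the class group of
  \<open>K\<^sub>p\<close>.\<close>

definition norm_trivial :: "complex set \<Rightarrow> bool" where
  "norm_trivial I \<longleftrightarrow> frac_ideal I \<and> (\<exists>g\<in>K\<^sub>p. g \<noteq> 0 \<and> ip I (cnj ` I) = sc g OK)"

lemma RC_eq: "RC = Cl\<lparr>carrier := {ideal_class I |I. norm_trivial I}\<rparr>"
proof -
  have one: "\<one>\<^bsub>class_group K\<^sub>p\<^esub> = {sc b OF |b. b \<in> K\<^sub>p \<and> b \<noteq> 0}"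
    by (simp add: class_group_def FactGroup_def principal_fractional_ideals_def OF_def)
  have "class_norm K\<^sub>p K (ideal_class I) = \<one>\<^bsub>class_group K\<^sub>p\<^esub> \<longleftrightarrow> norm_trivial I" if I: "frac_ideal I" for I
  proof -
    have 1: "1 \<in> K\<^sub>p" unfolding K\<^sub>p_def by (rule rat_adjoin_1)
    have "class_norm K\<^sub>p K (ideal_class I) = \<one>\<^bsub>class_group K\<^sub>p\<^esub> \<longleftrightarrow> (\<exists>g\<in>K\<^sub>p. g \<noteq> 0 \<and> NI I = sc g OF)"
      unfolding class_norm_eq[OF I] one
    proof
      assume e: "{sc b (NI I) |b. b \<in> K\<^sub>p \<and> b \<noteq> 0} = {sc b OF |b. b \<in> K\<^sub>p \<and> b \<noteq> 0}"
      have "sc 1 (NI I) \<in> {sc b (NI I) |b. b \<in> K\<^sub>p \<and> b \<noteq> 0}"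
        by (rule CollectI, rule exI[of _ 1]) (simp only: 1 one_neq_zero not_False_eq_True simp_thms)
      hence "NI I \<in> {sc b OF |b. b \<in> K\<^sub>p \<and> b \<noteq> 0}" unfolding e sc_1 .
      thus "\<exists>g\<in>K\<^sub>p. g \<noteq> 0 \<and> NI I = sc g OF" by blast
    next
      assume "\<exists>g\<in>K\<^sub>p. g \<noteq> 0 \<and> NI I = sc g OF"
      then obtain g where g: "g \<in> K\<^sub>p" "g \<noteq> 0" "NI I = sc g OF" by blast
      show "{sc b (NI I) |b. b \<in> K\<^sub>p \<and> b \<noteq> 0} = {sc b OF |b. b \<in> K\<^sub>p \<and> b \<noteq> 0}"
      proof (intro equalityI subsetI)
        fix L assume "L \<in> {sc b (NI I) |b. b \<in> K\<^sub>p \<and> b \<noteq> 0}"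
        then obtain b where b: "b \<in> K\<^sub>p" "b \<noteq> 0" "L = sc (b * g) OF" unfolding g(3) sc_sc by blast
        moreover have "b * g \<in> K\<^sub>p" using b g unfolding K\<^sub>p_def by (intro rat_adjoin_mult)
        moreover have "b * g \<noteq> 0" using b g by simp
        ultimately show "L \<in> {sc b OF |b. b \<in> K\<^sub>p \<and> b \<noteq> 0}" by blast
      next
        fix L assume "L \<in> {sc b OF |b. b \<in> K\<^sub>p \<and> b \<noteq> 0}"
        then obtain b where b: "b \<in> K\<^sub>p" "b \<noteq> 0" "L = sc b OF" by blast
        have "b / g * g = b" using g by simp
        hence "L = sc (b / g) (NI I)" unfolding g(3) sc_sc b(3) by simp
        moreover have "b / g \<in> K\<^sub>p" using b g unfolding K\<^sub>p_def by (intro rat_adjoin_divide)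
        moreover have "b / g \<noteq> 0" using b g by simp
        ultimately show "L \<in> {sc b (NI I) |b. b \<in> K\<^sub>p \<and> b \<noteq> 0}" by blast
      qed
    qed
    thus ?thesis using norm_principal_iff[OF I] I by (simp add: norm_trivial_def)
  qed
  hence "kernel Cl (class_group K\<^sub>p) (class_norm K\<^sub>p K) = {ideal_class I |I. norm_trivial I}"
    unfolding kernel_def Cl_carrier by (auto simp: norm_trivial_def)
  thus ?thesis by (simp add: RC_def relative_class_group_def Cl_def)
qed

lemma cnj_ip: "cnj ` ip I J = ip (cnj ` I) (cnj ` J)"
proof
  have *: "cnj x \<in> ip (cnj ` I) (cnj ` J)" if "x \<in> ip I J" for x I J
    using that by (induction rule: ip_induct) (auto intro: ip_mem ip_add)
  show "cnj ` ip I J \<subseteq> ip (cnj ` I) (cnj ` J)" using * by blast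
  show "ip (cnj ` I) (cnj ` J) \<subseteq> cnj ` ip I J"
  proof
    fix x assume "x \<in> ip (cnj ` I) (cnj ` J)"
    from *[OF this] have "cnj x \<in> ip I J" by (simp add: image_image)
    from imageI[OF this, of cnj] show "x \<in> cnj ` ip I J" by simp
  qed
qed

lemma cnj_OK: "cnj ` OK = OK"
proof
  show "cnj ` OK \<subseteq> OK" using OK_cnj by blast
  show "OK \<subseteq> cnj ` OK"
  proof
    fix x assume "x \<in> OK"
    from imageI[OF OK_cnj[OF this], of cnj] show "x \<in> cnj ` OK" by simp
  qed
qed

lemma cnj_sc: "cnj ` sc a I = sc (cnj a) (cnj ` I)"
  by (simp add: image_image)

lemma ip_interchange: "ip (ip A B) (ip C D) = ip (ip A C) (ip B D)"
  by (metis ip_assoc ip_commute)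

lemma norm_trivial_ip: "norm_trivial I \<Longrightarrow> norm_trivial J \<Longrightarrow> norm_trivial (ip I J)"
proof -
  assume IJ: "norm_trivial I" "norm_trivial J"
  then obtain g h where gh: "g \<in> K\<^sub>p" "g \<noteq> 0" "ip I (cnj ` I) = sc g OK"
    "h \<in> K\<^sub>p" "h \<noteq> 0" "ip J (cnj ` J) = sc h OK" by (auto simp: norm_trivial_def)
  have "ip (ip I J) (cnj ` ip I J) = ip (ip I (cnj ` I)) (ip J (cnj ` J))"
    unfolding cnj_ip by (rule ip_interchange)
  also have "\<dots> = sc (h * g) OK"
    unfolding gh ip_sc_left ip_sc_right ip_OK[OF OK_module_OK] sc_sc by (simp add: mult.commute)
  finally have "ip (ip I J) (cnj ` ip I J) = sc (h * g) OK" .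
  moreover have "h * g \<in> K\<^sub>p" "h * g \<noteq> 0" using gh unfolding K\<^sub>p_def by (auto intro: rat_adjoin_mult)
  ultimately show ?thesis using IJ frac_ideal_ip unfolding norm_trivial_def by blast
qed

lemma norm_trivial_OK: "norm_trivial OK"
proof -
  have "ip OK (cnj ` OK) = sc 1 OK" unfolding cnj_OK ip_OK[OF OK_module_OK] sc_1 ..
  moreover have "1 \<in> K\<^sub>p" unfolding K\<^sub>p_def by (rule rat_adjoin_1)
  ultimately show ?thesis using frac_ideal_OK unfolding norm_trivial_def by (intro conjI bexI[of _ 1]) auto
qed

lemma norm_trivial_inverse:
  assumes "norm_trivial I" "frac_ideal J" "ip I J = OK"
  shows "norm_trivial J"
proof -
  obtain g where g: "g \<in> K\<^sub>p" "g \<noteq> 0" "ip I (cnj ` I) = sc g OK" using assms by (auto simp: norm_trivial_def)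
  have "ip (ip I (cnj ` I)) (ip J (cnj ` J)) = ip (ip I J) (cnj ` ip I J)"
    unfolding cnj_ip by (rule ip_interchange)
  also have "\<dots> = OK" unfolding assms(3) cnj_OK by (rule ip_OK[OF OK_module_OK])
  finally have "sc g (ip OK (ip J (cnj ` J))) = OK" unfolding g(3) ip_sc_left .
  moreover have "ip OK (ip J (cnj ` J)) = ip J (cnj ` J)"
    unfolding ip_assoc[symmetric] ip_OK[OF frac_ideal_OK_module[OF assms(2)]] ..
  ultimately have "sc (inverse g) (sc g (ip J (cnj ` J))) = sc (inverse g) OK" by simp
  moreover have "inverse g * g = 1" using g(2) by simp
  ultimately have "ip J (cnj ` J) = sc (inverse g) OK" by (simp only: sc_sc sc_1)
  moreover have "inverse g \<in> K\<^sub>p" using g(1) unfolding K\<^sub>p_def by (rule rat_adjoin_inverse)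
  moreover have "inverse g \<noteq> 0" using g(2) by simp
  ultimately show ?thesis using assms(2) unfolding norm_trivial_def by blast
qed

lemma comm_group_RC: "comm_group RC"
proof -
  interpret Cl: comm_group Cl by (rule comm_group_Cl)
  have "subgroup {ideal_class I |I. norm_trivial I} Cl"
  proof (rule Cl.subgroupI)
    show "{ideal_class I |I. norm_trivial I} \<subseteq> carrier Cl" by (auto simp: Cl_carrier norm_trivial_def)
    show "{ideal_class I |I. norm_trivial I} \<noteq> {}" using norm_trivial_OK by blast
  next
    fix C assume "C \<in> {ideal_class I |I. norm_trivial I}"
    then obtain I where I: "norm_trivial I" "C = ideal_class I" by blast
    then obtain J where J: "frac_ideal J" "ip I J = OK" using frac_ideal_inverse by (auto simp: norm_trivial_def)
    have fI: "frac_ideal I" using I by (simp add: norm_trivial_def)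
    have "ideal_class J \<otimes>\<^bsub>Cl\<^esub> ideal_class I = \<one>\<^bsub>Cl\<^esub>"
      using J fI by (simp add: Cl_mult Cl_one ip_commute[of J I])
    moreover have "ideal_class I \<in> carrier Cl" "ideal_class J \<in> carrier Cl" using fI J by (auto simp: Cl_carrier)
    ultimately have "inv\<^bsub>Cl\<^esub> C = ideal_class J" using Cl.inv_equality I(2) by simp
    thus "inv\<^bsub>Cl\<^esub> C \<in> {ideal_class I |I. norm_trivial I}" using norm_trivial_inverse[OF I(1) J] by blast
  next
    fix C D assume "C \<in> {ideal_class I |I. norm_trivial I}" "D \<in> {ideal_class I |I. norm_trivial I}"
    then obtain I J where IJ: "norm_trivial I" "norm_trivial J" "C = ideal_class I" "D = ideal_class J" by blast
    hence "C \<otimes>\<^bsub>Cl\<^esub> D = ideal_class (ip I J)" by (simp add: Cl_mult norm_trivial_def)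
    thus "C \<otimes>\<^bsub>Cl\<^esub> D \<in> {ideal_class I |I. norm_trivial I}" using norm_trivial_ip IJ by blast
  qed
  hence "group RC" unfolding RC_eq by (rule subgroup.subgroup_is_group) (rule Cl.is_group)
  moreover have "C \<otimes>\<^bsub>RC\<^esub> D = D \<otimes>\<^bsub>RC\<^esub> C" if "C \<in> carrier RC" "D \<in> carrier RC" for C D
    using that Cl.m_comm[of C D] by (auto simp: RC_eq Cl_carrier norm_trivial_def)
  ultimately show ?thesis by (intro group.group_comm_groupI) auto
qed

lemma finite_RC: "finite (carrier RC)"
  by (rule finite_subset[OF _ finite_Cl]) (auto simp: RC_eq Cl_carrier norm_trivial_def)

lemma RC_pow: "norm_trivial I \<Longrightarrow> ideal_class I [^]\<^bsub>RC\<^esub> (n::nat) = ideal_class (ideal_pow I n)"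
proof -
  assume "norm_trivial I"
  hence "ideal_class I [^]\<^bsub>Cl\<^esub> n = ideal_class (ideal_pow I n)" by (simp add: Cl_pow norm_trivial_def)
  thus ?thesis by (simp add: RC_eq nat_pow_def)
qed

lemma RC_one: "\<one>\<^bsub>RC\<^esub> = ideal_class OK"
  by (simp add: RC_eq Cl_one)

end

section \<open>A relation between ideal classes\<close>

context prime_cyclotomic
begin

lemma nz_ideal_cnj:
  assumes "nz_ideal I"
  shows "nz_ideal (cnj ` I)"
proof -
  obtain x where x: "x \<in> I" "x \<noteq> 0" using frac_ideal_nonzero_elem[OF nz_ideal_frac_ideal[OF assms]] by blast
  have "cnj ` I \<noteq> {0}" using imageI[OF x(1), of cnj] x(2) by (metis complex_cnj_zero_iff singletonD)
  thus ?thesis using assms OK_module_cnj OK_cnj by (auto simp: nz_ideal_def)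
qed

lemma cnj_ideal_pow: "cnj ` ideal_pow I n = ideal_pow (cnj ` I) n"
  by (induction n) (simp_all add: cnj_OK cnj_ip)

lemma ideal_pow_ideal_pow: "ideal_pow (ideal_pow I a) n = ideal_pow (ideal_pow I n) a"
  by (induction a) (simp_all add: ideal_pow_OK ideal_pow_ip)

lemma sc_OK_eqD:
  assumes "sc a OK = sc b OK" "a \<noteq> 0" "b \<noteq> 0"
  obtains e where "e \<in> OK" "inverse e \<in> OK" "e \<noteq> 0" "a = b * e"
proof -
  have "a * 1 \<in> sc a OK" "b * 1 \<in> sc b OK" by (intro imageI OK_closed)+
  hence "a \<in> sc b OK" "b \<in> sc a OK" using assms(1) by simp_all
  then obtain e f where ef: "e \<in> OK" "a = b * e" "f \<in> OK" "b = a * f" by (elim imageE)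
  have "e * f = 1" using ef(2,4) assms by (metis mult.assoc mult_cancel_left mult.right_neutral)
  hence "inverse e = f" by (rule inverse_unique)
  have "e \<noteq> 0" using \<open>e * f = 1\<close> by (metis mult_zero_left zero_neq_one)
  show ?thesis
  proof (rule that[of e])
    show "inverse e \<in> OK" unfolding \<open>inverse e = f\<close> by (rule ef(3))
  qed (rule ef(1) \<open>e \<noteq> 0\<close> ef(2))+
qed

definition comax :: "complex \<Rightarrow> complex \<Rightarrow> bool" where
  "comax a b \<longleftrightarrow> (\<exists>u\<in>OK. \<exists>v\<in>OK. u * a + v * b = 1)"

lemma comax_commute: "comax a b \<longleftrightarrow> comax b a"
  unfolding comax_def by (metis add.commute)

lemma comax_1: "comax a 1"
  unfolding comax_def using OK_closed(1,2) by force

lemma comax_mult: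
  assumes "comax a b" "comax a c" "a \<in> OK" "b \<in> OK" "c \<in> OK"
  shows "comax a (b * c)"
proof -
  obtain u v where uv: "u \<in> OK" "v \<in> OK" "u * a + v * b = 1" using assms(1) by (auto simp: comax_def)
  obtain s t where st: "s \<in> OK" "t \<in> OK" "s * a + t * c = 1" using assms(2) by (auto simp: comax_def)
  have "(u * (s * a + t * c) + v * b * s) * a + (v * t) * (b * c) = (u * a + v * b) * (s * a + t * c)"
    by (simp add: algebra_simps)
  also have "\<dots> = 1" by (simp add: uv st)
  finally have "(u * (s * a + t * c) + v * b * s) * a + (v * t) * (b * c) = 1" .
  moreover have "u * (s * a + t * c) + v * b * s \<in> OK" "v * t \<in> OK"
    by (intro OK_closed(7,9) uv st assms)+
  ultimately show ?thesis unfolding comax_def by blast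
qed

lemma comax_power:
  assumes "comax a b" "a \<in> OK" "b \<in> OK"
  shows "comax a (b ^ n)"
  by (induction n) (auto intro!: comax_mult comax_1 assms OK_closed(10))

lemma comax_prod:
  assumes "finite A" "\<And>i. i \<in> A \<Longrightarrow> comax a (f i)" "a \<in> OK" "\<And>i. i \<in> A \<Longrightarrow> f i \<in> OK"
  shows "comax a (\<Prod>i\<in>A. f i)"
  using assms(1,2,4)
  by (induction A) (auto intro!: comax_mult comax_1 assms(3) OK_prod)

text \<open>The root is the ideal generated by \<open>x\<close> and \<open>w\<close>. Its
  \<open>n\<close>-th power lies in the ideal generated by \<open>x\<close> and
  \<open>w ^ n = x * R\<close>, hence in \<open>(x)\<close>. Conversely \<open>R\<close> and
  \<open>x ^ (n - 1)\<close> are comaximal, and multiplying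
  \<open>u * R + v * x ^ (n - 1) = 1\<close> by \<open>x\<close> writes \<open>x\<close> through
  \<open>w ^ n\<close> and \<open>x ^ n\<close>.\<close>

lemma root_ideal:
  assumes x: "x \<in> OK" "x \<noteq> 0" and w: "w \<in> OK" and R: "R \<in> OK" "comax x R" "x * R = w ^ n" and n: "n > 0"
  obtains A where "nz_ideal A" "ideal_pow A n = sc x OK"
proof -
  define L where "L m = {a * x + b * w ^ m |a b. a \<in> OK \<and> b \<in> OK}" for m
  have LI: "a * x + b * w ^ m \<in> L m" if "a \<in> OK" "b \<in> OK" for a b m using that by (auto simp: L_def)
  have Ladd: "y + z \<in> L m" if yz: "y \<in> L m" "z \<in> L m" for y z m
  proof -
    obtain a b c d where abcd: "y = a * x + b * w ^ m" "z = c * x + d * w ^ m" "a \<in> OK" "b \<in> OK" "c \<in> OK" "d \<in> OK"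
      using yz by (auto simp: L_def)
    have "y + z = (a + c) * x + (b + d) * w ^ m" by (simp add: abcd algebra_simps)
    also have "\<dots> \<in> L m" by (intro LI OK_closed(7) abcd)
    finally show ?thesis .
  qed
  define A where "A = L 1"
  have omA: "OK_module A"
    unfolding OK_module_def
  proof (intro conjI ballI)
    show "0 \<in> A" using LI[OF OK_closed(1) OK_closed(1), of 1] by (simp add: A_def)
    show "y + z \<in> A" if "y \<in> A" "z \<in> A" for y z using Ladd that by (simp add: A_def)
    show "c * y \<in> A" if cy: "c \<in> OK" "y \<in> A" for c y
    proof -
      obtain a b where ab: "y = a * x + b * w ^ 1" "a \<in> OK" "b \<in> OK" using cy(2) by (auto simp: A_def L_def)
      have "c * y = (c * a) * x + (c * b) * w ^ 1" by (simp add: ab algebra_simps)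
      also have "\<dots> \<in> A" unfolding A_def by (intro LI OK_closed(9) ab cy)
      finally show ?thesis .
    qed
  qed
  have xA: "x \<in> A" using LI[OF OK_closed(2) OK_closed(1), of 1] by (simp add: A_def)
  have wA: "w \<in> A" using LI[OF OK_closed(1) OK_closed(2), of 1] by (simp add: A_def)
  have AO: "A \<subseteq> OK"
  proof
    fix y assume "y \<in> A"
    then obtain a b where ab: "y = a * x + b * w ^ 1" "a \<in> OK" "b \<in> OK" by (auto simp: A_def L_def)
    show "y \<in> OK" unfolding ab(1) by (intro OK_closed(7,9,10) ab x w)
  qed
  have "A \<noteq> {0}" using xA x(2) by blast
  hence iA: "nz_ideal A" using omA AO by (simp add: nz_ideal_def)
  have powA: "y ^ m \<in> ideal_pow A m" if "y \<in> A" for y m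
    by (induction m) (auto intro: OK_closed(2) ip_mem that)
  have sub: "ideal_pow A m \<subseteq> L m" for m
  proof (induction m)
    case 0
    show ?case
    proof
      fix y assume "y \<in> ideal_pow A 0"
      hence "0 * x + y * w ^ 0 \<in> L 0" by (intro LI OK_closed(1)) simp
      thus "y \<in> L 0" by simp
    qed
  next
    case (Suc m)
    have "ip A (ideal_pow A m) \<subseteq> L (Suc m)"
    proof (rule ip_subset)
      fix y z assume yz: "y \<in> A" "z \<in> ideal_pow A m"
      obtain a b where ab: "y = a * x + b * w ^ 1" "a \<in> OK" "b \<in> OK" using yz(1) by (auto simp: A_def L_def)
      obtain c d where cd: "z = c * x + d * w ^ m" "c \<in> OK" "d \<in> OK"
        using yz(2) Suc by (auto simp: L_def)
      have "y * z = (a * z + b * w * c) * x + (b * d) * w ^ Suc m" by (simp add: ab cd algebra_simps)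
      also have "\<dots> \<in> L (Suc m)"
        unfolding cd(1) by (intro LI OK_closed(7,9,10) ab cd x w)
      finally show "y * z \<in> L (Suc m)" .
    qed (rule Ladd)
    thus ?case by simp
  qed
  have "ideal_pow A n = sc x OK"
  proof
    show "ideal_pow A n \<subseteq> sc x OK"
    proof
      fix y assume "y \<in> ideal_pow A n"
      then obtain a b where ab: "y = a * x + b * w ^ n" "a \<in> OK" "b \<in> OK" using sub[of n] by (auto simp: L_def)
      have "y = x * (a + b * R)" unfolding ab(1) R(3)[symmetric] by (simp add: algebra_simps)
      moreover have "a + b * R \<in> OK" by (intro OK_closed(7,9) ab R)
      ultimately show "y \<in> sc x OK" by blast
    qed
    have "comax R (x ^ (n - 1))" using R x by (intro comax_power) (simp_all add: comax_commute)
    then obtain u v where uv: "u \<in> OK" "v \<in> OK" "u * R + v * x ^ (n - 1) = 1" by (auto simp: comax_def)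
    have om: "OK_module (ideal_pow A n)" by (rule OK_module_ideal_pow[OF omA])
    have "x = x * (u * R + v * x ^ (n - 1))" using uv(3) by simp
    also have "\<dots> = u * (x * R) + v * (x * x ^ (n - 1))" by (simp add: algebra_simps)
    also have "x * x ^ (n - 1) = x ^ n" using n by (simp add: power_eq_if)
    also have "u * (x * R) + v * x ^ n \<in> ideal_pow A n"
      unfolding R(3) by (intro OK_moduleD(2)[OF om] OK_moduleD(3)[OF om] uv powA xA wA)
    finally have xin: "x \<in> ideal_pow A n" .
    show "sc x OK \<subseteq> ideal_pow A n"
    proof
      fix y assume "y \<in> sc x OK"
      then obtain a where "a \<in> OK" "y = a * x" by (auto simp: mult.commute)
      thus "y \<in> ideal_pow A n" using OK_moduleD(3)[OF om _ xin] by simp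
    qed
  qed
  thus ?thesis using that iA by blast
qed

text \<open>\<open>I\<close> is \<open>A\<close> times the inverse of its conjugate. The conjugate
  of \<open>I\<close> is then inverse to \<open>I\<close>, so \<open>norm_trivial\<close> holds with
  generator 1.\<close>

lemma root_ideal_quotient:
  assumes A: "nz_ideal A" "ideal_pow A n = sc x OK" and x: "x \<in> K" "x \<noteq> 0"
  obtains I where "norm_trivial I" "ideal_pow I n = sc (x / cnj x) OK"
proof -
  obtain B where B: "frac_ideal B" "ip (cnj ` A) B = OK" using nz_ideal_inverse[OF nz_ideal_cnj[OF A(1)]] .
  define I where "I = ip A B"
  have fI: "frac_ideal I" unfolding I_def by (intro frac_ideal_ip nz_ideal_frac_ideal A B)
  have "ip (ideal_pow (cnj ` A) n) (ideal_pow B n) = OK" unfolding ideal_pow_ip[symmetric] B(2) by (rule ideal_pow_OK)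
  moreover have "ideal_pow (cnj ` A) n = sc (cnj x) OK" unfolding cnj_ideal_pow[symmetric] A(2) cnj_sc cnj_OK ..
  ultimately have "sc (cnj x) (ideal_pow B n) = OK"
    by (simp only: ip_sc_left ip_OK[OF frac_ideal_OK_module[OF frac_ideal_ideal_pow[OF B(1)]]])
  hence "sc (inverse (cnj x)) (sc (cnj x) (ideal_pow B n)) = sc (inverse (cnj x)) OK" by simp
  moreover have "inverse (cnj x) * cnj x = 1" using x(2) by simp
  ultimately have Bn: "ideal_pow B n = sc (inverse (cnj x)) OK" by (simp only: sc_sc sc_1)
  have "ideal_pow I n = ip (sc x OK) (sc (inverse (cnj x)) OK)" unfolding I_def ideal_pow_ip A(2) Bn ..
  also have "\<dots> = sc (inverse (cnj x) * x) OK" by (simp only: ip_sc_left ip_sc_right ip_OK[OF OK_module_OK] sc_sc)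
  also have "inverse (cnj x) * x = x / cnj x" by (simp add: divide_inverse)
  finally have 1: "ideal_pow I n = sc (x / cnj x) OK" .
  have "cnj ` ip (cnj ` A) B = ip A (cnj ` B)" unfolding cnj_ip by (simp add: image_image)
  hence AB: "ip A (cnj ` B) = OK" unfolding B(2) cnj_OK by simp
  have "ip I (cnj ` I) = ip (ip A B) (ip (cnj ` B) (cnj ` A))"
    unfolding I_def cnj_ip by (simp only: ip_commute)
  also have "\<dots> = ip (ip A (cnj ` B)) (ip B (cnj ` A))" by (rule ip_interchange)
  also have "\<dots> = OK" unfolding AB ip_commute[of B] B(2) by (rule ip_OK[OF OK_module_OK])
  finally have "ip I (cnj ` I) = sc 1 OK" by (simp only: sc_1)
  moreover have "1 \<in> K\<^sub>p" unfolding K\<^sub>p_def by (rule rat_adjoin_1)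
  ultimately have "norm_trivial I" using fI unfolding norm_trivial_def by (metis one_neq_zero)
  thus ?thesis using that 1 by blast
qed

primrec idprod :: "(nat \<Rightarrow> complex set) \<Rightarrow> (nat \<Rightarrow> nat) \<Rightarrow> nat \<Rightarrow> complex set" where
  "idprod I e 0 = OK"
| "idprod I e (Suc m) = ip (ideal_pow (I (Suc m)) (e (Suc m))) (idprod I e m)"

lemma norm_trivial_ideal_pow: "norm_trivial I \<Longrightarrow> norm_trivial (ideal_pow I n)"
  by (induction n) (auto intro: norm_trivial_OK norm_trivial_ip)

lemma norm_trivial_idprod:
  "(\<And>c. c \<in> {1..m} \<Longrightarrow> norm_trivial (I c)) \<Longrightarrow> norm_trivial (idprod I e m)"
proof (induction m)
  case 0
  show ?case by (simp add: norm_trivial_OK)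
next
  case (Suc m)
  have "norm_trivial (idprod I e m)" by (rule Suc.IH) (simp add: Suc.prems)
  thus ?case using Suc.prems[of "Suc m"] by (simp add: norm_trivial_ip norm_trivial_ideal_pow)
qed

lemma ideal_pow_idprod:
  "(\<And>c. c \<in> {1..m} \<Longrightarrow> ideal_pow (I c) n = sc (g c) OK) \<Longrightarrow>
    ideal_pow (idprod I e m) n = sc (\<Prod>c\<in>{1..m}. g c ^ e c) OK"
proof (induction m)
  case 0
  show ?case by (simp add: ideal_pow_OK)
next
  case (Suc m)
  define P where "P = (\<Prod>c\<in>{1..m}. g c ^ e c)"
  have IH: "ideal_pow (idprod I e m) n = sc P OK" unfolding P_def by (rule Suc.IH) (simp add: Suc.prems)
  have "ideal_pow (ideal_pow (I (Suc m)) (e (Suc m))) n = sc (g (Suc m) ^ e (Suc m)) OK"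
    using Suc.prems[of "Suc m"] by (simp only: ideal_pow_ideal_pow[of "I (Suc m)"] ideal_pow_sc ideal_pow_OK) (simp add: ideal_pow_sc ideal_pow_OK)
  hence "ideal_pow (idprod I e (Suc m)) n = sc (P * g (Suc m) ^ e (Suc m)) OK"
    by (simp only: idprod.simps ideal_pow_ip IH ip_sc_left ip_sc_right ip_OK[OF OK_module_OK] sc_sc)
  also have "P * g (Suc m) ^ e (Suc m) = (\<Prod>c\<in>{1..Suc m}. g c ^ e c)"
    by (simp add: P_def mult.commute)
  finally show ?case .
qed

text \<open>Pigeonhole: the \<open>q ^ m\<close> exponent vectors with entries below
  \<open>q\<close> give classes in the \<open>q\<close>-torsion, which has at most
  \<open>q ^ q_rank q RC\<close> elements. The colliding vectors are kept on opposite sides, so that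
  no negative exponents arise. The \<open>q\<close>-th power of the resulting equality of ideals is
  an equation between numbers up to a unit.\<close>

lemma small_rank_relation:
  assumes q: "prime q" and rank: "q_rank q RC < m"
    and I: "\<And>c. c \<in> {1..m} \<Longrightarrow> norm_trivial (I c)"
      "\<And>c. c \<in> {1..m} \<Longrightarrow> ideal_pow (I c) q = sc (g c) OK"
    and g: "\<And>c. c \<in> {1..m} \<Longrightarrow> g c \<in> K \<and> g c \<noteq> 0"
  obtains e e' b u where "e \<in> {1..m} \<rightarrow>\<^sub>E {0..<q}" "e' \<in> {1..m} \<rightarrow>\<^sub>E {0..<q}" "e \<noteq> e'"
    "b \<in> K" "b \<noteq> 0" "u \<in> OK" "inverse u \<in> OK" "u \<noteq> 0"
    "(\<Prod>c\<in>{1..m}. g c ^ e c) = (b ^ q * (\<Prod>c\<in>{1..m}. g c ^ e' c)) * u"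
proof -
  interpret RC: comm_group RC by (rule comm_group_RC)
  define E where "E = ({1..m} \<rightarrow>\<^sub>E {0..<q})"
  define h where "h e = ideal_class (idprod I e m)" for e
  define T where "T = {a \<in> carrier RC. a [^]\<^bsub>RC\<^esub> q = \<one>\<^bsub>RC\<^esub>}"
  define gp where "gp e = (\<Prod>c\<in>{1..m}. g c ^ e c)" for e :: "nat \<Rightarrow> nat"
  have gp: "gp e \<in> K" "gp e \<noteq> 0" for e
    unfolding gp_def using g by (auto intro!: K_prod K_closed)
  have ip: "ideal_pow (idprod I e m) q = sc (gp e) OK" for e
    unfolding gp_def by (rule ideal_pow_idprod[OF I(2)])
  have "h e \<in> T" for e
  proof -
    have nt: "norm_trivial (idprod I e m)" using I(1) by (rule norm_trivial_idprod)
    have "h e [^]\<^bsub>RC\<^esub> q = ideal_class (sc (gp e) OK)" by (simp only: h_def RC_pow[OF nt] ip)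
    also have "\<dots> = \<one>\<^bsub>RC\<^esub>" by (simp only: ideal_class_sc[OF gp] RC_one)
    finally show ?thesis using nt by (auto simp: T_def h_def RC_eq)
  qed
  moreover have finT: "finite T" using finite_RC by (simp add: T_def)
  ultimately have "card (h ` E) \<le> card T" by (intro card_mono) auto
  also have "\<dots> \<le> q ^ q_rank q RC" unfolding T_def by (rule RC.card_torsion_le_q_rank[OF finite_RC q])
  also have "\<dots> < q ^ m" using rank prime_gt_1_nat[OF q] by (intro power_strict_increasing) auto
  also have "q ^ m = card E" by (simp add: E_def card_PiE)
  finally have "\<not> inj_on h E" by (rule pigeonhole)
  then obtain e e' where e: "e \<in> E" "e' \<in> E" "h e = h e'" "e \<noteq> e'" by (auto simp: inj_on_def)
  then obtain b where b: "b \<in> K" "b \<noteq> 0" "idprod I e m = sc b (idprod I e' m)"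
    unfolding h_def ideal_class_eq_iff by blast
  have "sc (gp e) OK = sc (b ^ q * gp e') OK"
    using arg_cong[OF b(3), of "\<lambda>J. ideal_pow J q"] by (simp only: ip ideal_pow_sc sc_sc)
  moreover have "b ^ q * gp e' \<noteq> 0" using b gp by simp
  ultimately obtain u where "u \<in> OK" "inverse u \<in> OK" "u \<noteq> 0" "gp e = (b ^ q * gp e') * u"
    using sc_OK_eqD gp(2) by metis
  thus ?thesis using that[of e e' b u] e b unfolding E_def gp_def by blast
qed

section \<open>The numbers \<open>xi x c\<close> and their ideals\<close>

lemma one_minus_zeta_nz: "c \<in> G \<Longrightarrow> 1 - \<zeta> ^ c \<noteq> 0"
  using zeta_eq_1_iff[of c] G_not_dvd[of c] by auto

lemma one_minus_zeta_dvd: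
  assumes "c \<in> G"
  obtains t where "t \<in> OK" "(1 - \<zeta> ^ c) * t = of_nat p"
proof
  show "(\<Prod>d\<in>G - {c}. 1 - \<zeta> ^ d) \<in> OK" by (intro OK_prod OK_closed)
  show "(1 - \<zeta> ^ c) * (\<Prod>d\<in>G - {c}. 1 - \<zeta> ^ d) = of_nat p"
    using prod.remove[OF finite_G assms, of "\<lambda>d. 1 - \<zeta> ^ d"] prod_one_minus_zeta by (simp add: G_def)
qed

lemma minus_G: "c \<in> G \<Longrightarrow> p - c \<in> G"
  by (auto simp: G_def)

lemma zeta_minus: "c \<in> G \<Longrightarrow> \<zeta> ^ c * \<zeta> ^ (p - c) = 1"
  by (simp add: G_def power_add[symmetric] zeta_p)

lemma cnj_zeta_power: "c \<in> G \<Longrightarrow> cnj (\<zeta> ^ c) = \<zeta> ^ (p - c)"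
proof -
  assume c: "c \<in> G"
  have "\<zeta> ^ c * cnj (\<zeta> ^ c) = of_real ((norm (\<zeta> ^ c))\<^sup>2)" by (rule complex_norm_square[symmetric])
  hence "\<zeta> ^ c * cnj (\<zeta> ^ c) = \<zeta> ^ c * \<zeta> ^ (p - c)"
    by (simp only: norm_zeta_power zeta_minus[OF c]) simp
  thus ?thesis using zeta_nz by (simp del: complex_cnj_power)
qed

definition xi :: "int \<Rightarrow> nat \<Rightarrow> complex" where
  "xi x c = (of_int x - \<zeta> ^ c) / (1 - \<zeta> ^ c)"

text \<open>\<open>1 - \<zeta> ^ c\<close> divides \<open>p\<close>, so dividing
  \<open>x - 1\<close> by it costs only one of the two factors \<open>p\<close>.\<close>

lemma xi_cong_1:
  assumes "x - 1 = int p ^ 2 * k" "c \<in> G"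
  obtains v where "v \<in> OK" "xi x c = 1 + of_nat p * v"
proof -
  obtain t where t: "t \<in> OK" "(1 - \<zeta> ^ c) * t = of_nat p" using one_minus_zeta_dvd[OF assms(2)] .
  have "of_int x - \<zeta> ^ c = (1 - \<zeta> ^ c) + of_int (x - 1)" by simp
  also have "of_int (x - 1) = (of_nat p * (of_nat p * of_int k) :: complex)"
    by (simp only: assms(1)) (simp add: power2_eq_square)
  also have "of_nat p * (of_nat p * of_int k) = of_nat p * (((1 - \<zeta> ^ c) * t) * of_int k)"
    by (simp only: t(2))
  also have "(1 - \<zeta> ^ c) + \<dots> = (1 - \<zeta> ^ c) * (1 + of_nat p * (of_int k * t))"
    by (simp add: algebra_simps)
  finally have "xi x c = 1 + of_nat p * (of_int k * t)"
    using one_minus_zeta_nz[OF assms(2)] by (simp add: xi_def)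
  moreover have "of_int k * t \<in> OK" by (intro OK_closed(3,9) t)
  ultimately show ?thesis using that by blast
qed

lemma xi_OK: "x - 1 = int p ^ 2 * k \<Longrightarrow> c \<in> G \<Longrightarrow> xi x c \<in> OK"
  using xi_cong_1[of x k c] OK_closed(2,4,7,9) by metis

text \<open>The ideal generated by both numbers contains \<open>\<zeta> ^ d - \<zeta> ^ c\<close>, a
  divisor of \<open>p\<close>, and \<open>xi x c\<close> is 1 modulo \<open>p\<close>.\<close>

lemma xi_comax:
  assumes x: "x - 1 = int p ^ 2 * k" and cd: "c \<in> G" "d \<in> G" "c \<noteq> d"
  shows "comax (xi x c) (xi x d)"
proof -
  obtain v where v: "v \<in> OK" "xi x c = 1 + of_nat p * v" using xi_cong_1[OF x cd(1)] .
  \<comment> \<open>\<open>\<zeta> ^ j\<close> is the quotient of \<open>\<zeta> ^ c\<close> by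
    \<open>\<zeta> ^ d\<close>, so the difference of the two is a root of unity times
    \<open>1 - \<zeta> ^ j\<close>.\<close>
  define j where "j = (c + (p - d)) mod p"
  have "\<not> p dvd c + (p - d)"
  proof
    assume "p dvd c + (p - d)"
    then obtain l where l: "c + (p - d) = p * l" by blast
    have "0 < c + (p - d)" "c + (p - d) < 2 * p" using cd by (auto simp: G_def)
    hence "0 < p * l" "p * l < p * 2" using l by auto
    hence "0 < l" "l < 2" by auto
    hence "l = 1" by simp
    thus False using l cd by (auto simp: G_def)
  qed
  hence jG: "j \<in> G" using p3 by (auto simp: G_def j_def Suc_le_eq mod_greater_zero_iff_not_dvd)
  have "\<zeta> ^ d * \<zeta> ^ j = \<zeta> ^ d * \<zeta> ^ (c + (p - d))" by (simp add: j_def zeta_mod)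
  also have "\<dots> = \<zeta> ^ c * (\<zeta> ^ d * \<zeta> ^ (p - d))" by (simp add: power_add)
  finally have dj: "\<zeta> ^ d * \<zeta> ^ j = \<zeta> ^ c" using zeta_minus[OF cd(2)] by simp
  obtain t where t: "t \<in> OK" "(1 - \<zeta> ^ j) * t = of_nat p" using one_minus_zeta_dvd[OF jG] .
  define s where "s = \<zeta> ^ (p - d) * t"
  have sO: "s \<in> OK" unfolding s_def by (intro OK_closed(5,9) t)
  have "(\<zeta> ^ d - \<zeta> ^ c) * s = (\<zeta> ^ d * \<zeta> ^ (p - d)) * ((1 - \<zeta> ^ j) * t)"
    unfolding dj[symmetric] s_def by (simp add: algebra_simps)
  hence ps: "(\<zeta> ^ d - \<zeta> ^ c) * s = of_nat p" using zeta_minus[OF cd(2)] t(2) by simp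
  have xc: "xi x c * (1 - \<zeta> ^ c) = of_int x - \<zeta> ^ c" "xi x d * (1 - \<zeta> ^ d) = of_int x - \<zeta> ^ d"
    using one_minus_zeta_nz[OF cd(1)] one_minus_zeta_nz[OF cd(2)] by (simp_all add: xi_def)
  hence zz: "\<zeta> ^ d - \<zeta> ^ c = xi x c * (1 - \<zeta> ^ c) - xi x d * (1 - \<zeta> ^ d)" by simp
  have "(1 - v * s * (1 - \<zeta> ^ c)) * xi x c + (v * s * (1 - \<zeta> ^ d)) * xi x d =
      xi x c - v * ((xi x c * (1 - \<zeta> ^ c) - xi x d * (1 - \<zeta> ^ d)) * s)"
    by (simp add: algebra_simps)
  also have "\<dots> = 1" unfolding zz[symmetric] ps using v(2) by (simp add: mult.commute)
  finally have "(1 - v * s * (1 - \<zeta> ^ c)) * xi x c + (v * s * (1 - \<zeta> ^ d)) * xi x d = 1" .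
  moreover have "1 - v * s * (1 - \<zeta> ^ c) \<in> OK" "v * s * (1 - \<zeta> ^ d) \<in> OK"
    by (intro OK_closed v sO)+
  ultimately show ?thesis unfolding comax_def by blast
qed

text \<open>The quotient of \<open>xi x c\<close> by its conjugate is \<open>- (\<zeta> ^ c)\<close>
  times \<open>(1 - x * \<zeta> ^ (p - c)) / (1 - x * \<zeta> ^ c)\<close>, whose factors, unlike
  \<open>x - \<zeta> ^ c\<close>, are 1 modulo \<open>q\<close>. Squaring removes the sign and is
  the form that \<open>gsq\<close> produces.\<close>

lemma xi_quotient_square:
  assumes c: "c \<in> G" and nz: "of_int x - \<zeta> ^ c \<noteq> 0" "1 - of_int x * \<zeta> ^ c \<noteq> 0"
  shows "(xi x c / cnj (xi x c))\<^sup>2 * (1 - of_int x * \<zeta> ^ c)\<^sup>2 = (\<zeta> ^ c)\<^sup>2 * (1 - of_int x * \<zeta> ^ (p - c))\<^sup>2"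
proof -
  define z where "z = \<zeta> ^ c"
  define w where "w = \<zeta> ^ (p - c)"
  define y where "y = (of_int x :: complex)"
  have zw: "z * w = 1" unfolding z_def w_def by (rule zeta_minus[OF c])
  have z1: "1 - z \<noteq> 0" unfolding z_def by (rule one_minus_zeta_nz[OF c])
  have w1: "1 - w \<noteq> 0" unfolding w_def by (rule one_minus_zeta_nz[OF minus_G[OF c]])
  have z0: "z \<noteq> 0" "w \<noteq> 0" using zw by auto
  have yz: "1 - y * z \<noteq> 0" using nz by (simp add: y_def z_def)
  have "y - w = - (w * (1 - y * z))" using zw by (simp add: algebra_simps)
  hence yw: "y - w \<noteq> 0" using yz z0 by simp
  have cx: "cnj (xi x c) = (y - w) / (1 - w)"
    unfolding xi_def using cnj_zeta_power[OF c] by (simp add: y_def w_def del: complex_cnj_power)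
  have e: "(y - z) * (1 - w) * (1 - y * z) = - (z * (1 - y * w)) * ((1 - z) * (y - w))"
  proof -
    have "y - z = - (z * (1 - y * w))" using zw by (simp add: algebra_simps)
    moreover have "(1 - w) * (1 - y * z) = (1 - z) * (y - w)"
    proof -
      have "(1 - w) * (1 - y * z) = 1 - y * z - w + y * (z * w)" by (simp add: algebra_simps)
      moreover have "(1 - z) * (y - w) = y - w - y * z + z * w" by (simp add: algebra_simps)
      ultimately show ?thesis by (simp add: zw)
    qed
    ultimately show ?thesis by (simp only: mult.assoc)
  qed
  have "xi x c / cnj (xi x c) = (y - z) * (1 - w) / ((1 - z) * (y - w))"
    unfolding cx by (simp add: xi_def y_def z_def)
  hence "xi x c / cnj (xi x c) * (1 - y * z) = ((y - z) * (1 - w) * (1 - y * z)) / ((1 - z) * (y - w))" by simp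
  also have "\<dots> = - (z * (1 - y * w))" unfolding e using z1 yw by simp
  finally have "(xi x c / cnj (xi x c) * (1 - y * z))\<^sup>2 = (z * (1 - y * w))\<^sup>2" by simp
  thus ?thesis by (simp only: power_mult_distrib y_def z_def w_def)
qed

lemma square_dvd_if_small_rank:
  assumes q: "prime q" "odd q" "q \<noteq> p" and qx: "int q dvd x" and x0: "x \<noteq> 0"
    and x: "x - 1 = int p ^ 2 * k" and u: "(\<Sum>i<p. x ^ i) = int p * u ^ q"
    and rank: "q_rank q RC < (p - 1) div 2"
  shows "int q ^ 2 dvd x"
proof (rule ccontr)
  assume nd: "\<not> int q ^ 2 dvd x"
  define m where "m = (p - 1) div 2"
  have pm: "p = 2 * m + 1" using p(2) p3 by (simp add: m_def)
  have q0: "q > 0" and q2: "q \<ge> 2" using q(1) prime_gt_0_nat prime_ge_2_nat by blast+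
  define xx where "xx = (of_int x :: complex)"
  have mG: "c \<in> G" if "c \<in> {1..m}" for c unfolding G_def using that pm by simp
  \<comment> \<open>This keeps \<open>x\<close> off the unit circle, so that no factor
    \<open>x - \<zeta> ^ c\<close> or \<open>1 - x * \<zeta> ^ c\<close> vanishes.\<close>
  have ax: "\<bar>x\<bar> \<ge> 2"
  proof -
    have "int q \<le> \<bar>x\<bar>" using dvd_imp_le_int[OF x0 qx] by simp
    thus ?thesis using q2 by linarith
  qed
  have nz1: "xx - \<zeta> ^ c \<noteq> 0" for c
  proof
    assume "xx - \<zeta> ^ c = 0"
    hence "norm xx = 1" using norm_zeta_power[of c] by simp
    thus False using ax by (simp add: xx_def)
  qed
  have nz2: "1 - xx * \<zeta> ^ c \<noteq> 0" for c
  proof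
    assume "1 - xx * \<zeta> ^ c = 0"
    hence "norm (xx * \<zeta> ^ c) = 1" by simp
    thus False using ax norm_zeta_power[of c] by (simp add: xx_def norm_mult)
  qed
  have xinz: "xi x c \<noteq> 0" if "c \<in> G" for c
    using nz1[of c] one_minus_zeta_nz[OF that] by (simp add: xi_def xx_def)
  \<comment> \<open>The denominators multiply to \<open>p\<close>, exactly the extra factor of the
    geometric sum.\<close>
  have prod: "(\<Prod>c\<in>G. xi x c) = of_int u ^ q"
  proof -
    have "(\<Prod>c\<in>G. xi x c) = (\<Sum>i<p. xx ^ i) / of_nat p"
      using prod_roots[of xx] prod_one_minus_zeta by (simp add: xi_def prod_dividef G_def xx_def)
    also have "(\<Sum>i<p. xx ^ i) = of_int (\<Sum>i<p. x ^ i)" by (simp add: xx_def)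
    also have "\<dots> = of_nat p * of_int u ^ q" by (simp add: u)
    finally show ?thesis using p3 by simp
  qed
  have "\<exists>I. norm_trivial I \<and> ideal_pow I q = sc (xi x c / cnj (xi x c)) OK" if c: "c \<in> G" for c
  proof -
    define R where "R = (\<Prod>d\<in>G - {c}. xi x d)"
    have xO: "xi x d \<in> OK" if "d \<in> G" for d by (rule xi_OK[OF x that])
    have R: "R \<in> OK" unfolding R_def by (intro OK_prod xO) auto
    have "comax (xi x c) R"
      unfolding R_def using finite_G xO c by (intro comax_prod xi_comax[OF x]) auto
    moreover have "xi x c * R = of_int u ^ q"
      using prod.remove[OF finite_G c, of "xi x"] prod by (simp add: R_def)
    ultimately obtain A where A: "nz_ideal A" "ideal_pow A q = sc (xi x c) OK"
      using root_ideal[OF xO[OF c] xinz[OF c] OK_closed(3) R _ _ q0] by metis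
    show ?thesis using root_ideal_quotient[OF A OK_K[OF xO[OF c]] xinz[OF c]] by metis
  qed
  then obtain I where I: "\<And>c. c \<in> G \<Longrightarrow> norm_trivial (I c)"
    "\<And>c. c \<in> G \<Longrightarrow> ideal_pow (I c) q = sc (xi x c / cnj (xi x c)) OK" by metis
  define g where "g c = xi x c / cnj (xi x c)" for c
  have gK: "g c \<in> K \<and> g c \<noteq> 0" if "c \<in> {1..m}" for c
    using xinz[OF mG[OF that]] OK_K[OF xi_OK[OF x mG[OF that]]]
    by (auto simp: g_def intro!: K_closed(11) cnj_in_K)
  have rank': "q_rank q RC < m" using rank by (simp add: m_def)
  obtain e e' b w where e: "e \<in> {1..m} \<rightarrow>\<^sub>E {0..<q}" "e' \<in> {1..m} \<rightarrow>\<^sub>E {0..<q}" "e \<noteq> e'"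
    and b: "b \<in> K" "b \<noteq> 0" and w: "w \<in> OK" "inverse w \<in> OK" "w \<noteq> 0"
    and rel: "(\<Prod>c\<in>{1..m}. g c ^ e c) = (b ^ q * (\<Prod>c\<in>{1..m}. g c ^ e' c)) * w"
    using small_rank_relation[OF q(1) rank' I(1)[OF mG] I(2)[OF mG, folded g_def] gK] .
  define gp where "gp e = (\<Prod>c\<in>{1..m}. g c ^ e c)" for e :: "nat \<Rightarrow> nat"
  have gp0: "gp e \<noteq> 0" for e unfolding gp_def using gK by auto
  have gcnj: "gp e * cnj (gp e) = 1" for e
  proof -
    have "g c * cnj (g c) = 1" if "c \<in> {1..m}" for c using xinz[OF mG[OF that]] by (simp add: g_def)
    hence "(\<Prod>c\<in>{1..m}. g c ^ e c * cnj (g c) ^ e c) = 1"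
      by (simp add: power_mult_distrib[symmetric])
    thus ?thesis by (simp add: gp_def prod.distrib)
  qed
  obtain r where r: "r \<in> K" "w / cnj w = r ^ q" using unit_over_conjugate[OF q w] .
  define s where "s = r * (b / cnj b)"
  have sK: "s \<in> K" unfolding s_def by (intro K_closed(9,11) r b cnj_in_K)
  \<comment> \<open>Dividing the relation by its conjugate turns the unit \<open>w\<close> into the
    \<open>q\<close>-th power \<open>w / cnj w\<close>; since \<open>gp e * cnj (gp e) = 1\<close>,
    it squares both products.\<close>
  have gsq: "(gp e)\<^sup>2 = s ^ q * (gp e')\<^sup>2"
  proof -
    have rel': "gp e = b ^ q * gp e' * w" using rel by (simp add: gp_def)
    have "(gp e)\<^sup>2 = (gp e / cnj (gp e)) * (gp e * cnj (gp e))" using gp0[of e] by (simp add: power2_eq_square)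
    also have "\<dots> = gp e / cnj (gp e)" by (simp add: gcnj)
    also have "\<dots> = (b ^ q * gp e' * w) / (cnj b ^ q * cnj (gp e') * cnj w)" by (simp add: rel')
    also have "\<dots> = (w / cnj w) * (b / cnj b) ^ q * (gp e' / cnj (gp e'))"
      by (simp add: power_divide mult_ac)
    also have "gp e' / cnj (gp e') = (gp e')\<^sup>2"
    proof -
      have "(gp e')\<^sup>2 = (gp e' / cnj (gp e')) * (gp e' * cnj (gp e'))" using gp0[of e'] by (simp add: power2_eq_square)
      thus ?thesis by (simp add: gcnj)
    qed
    finally show ?thesis by (simp only: r(2) s_def power_mult_distrib)
  qed
  have qnp: "\<not> p dvd q" using q p(1) primes_dvd_imp_eq by blast
  \<comment> \<open>\<open>q\<close> is invertible modulo \<open>p\<close>, so the factors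
    \<open>\<zeta> ^ c\<close> from \<open>xi_quotient_square\<close> are \<open>q\<close>-th powers
    and can be moved into \<open>t\<close>.\<close>
  obtain v where v: "(q * v) mod p = 1 mod p" using inverse_mod[OF qnp] by metis
  have zroot: "(\<zeta> ^ (c * v)) ^ q = \<zeta> ^ c" for c
  proof -
    have "\<zeta> ^ (q * v) = \<zeta> ^ 1" using v by (rule zeta_cong)
    hence "(\<zeta> ^ (q * v)) ^ c = \<zeta> ^ c" by simp
    thus ?thesis by (simp add: power_mult[symmetric] mult_ac)
  qed
  define D where "D e = (\<Prod>c\<in>{1..m}. (1 - xx * \<zeta> ^ c) ^ (2 * e c))" for e :: "nat \<Rightarrow> nat"
  define N where "N e = (\<Prod>c\<in>{1..m}. (1 - xx * \<zeta> ^ (p - c)) ^ (2 * e c))" for e :: "nat \<Rightarrow> nat"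
  define Z where "Z e = (\<Prod>c\<in>{1..m}. (\<zeta> ^ (c * v)) ^ (2 * e c))" for e :: "nat \<Rightarrow> nat"
  have ZK: "Z e \<in> K" "Z e \<noteq> 0" for e
    unfolding Z_def using zeta_nz by (auto intro!: K_prod K_closed(12) K_zeta)
  have D0: "D e \<noteq> 0" and N0: "N e \<noteq> 0" for e unfolding D_def N_def using nz2 by auto
  have gD: "(gp e)\<^sup>2 * D e = Z e ^ q * N e" for e
  proof -
    have "(gp e)\<^sup>2 * D e = (\<Prod>c\<in>{1..m}. ((g c)\<^sup>2 * (1 - xx * \<zeta> ^ c)\<^sup>2) ^ e c)"
      by (simp add: gp_def D_def prod_power_distrib prod.distrib[symmetric] power_mult_distrib
          power_mult[symmetric] mult.commute)
    also have "\<dots> = (\<Prod>c\<in>{1..m}. ((\<zeta> ^ c)\<^sup>2 * (1 - xx * \<zeta> ^ (p - c))\<^sup>2) ^ e c)"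
    proof (intro prod.cong refl)
      fix c assume c: "c \<in> {1..m}"
      show "((g c)\<^sup>2 * (1 - xx * \<zeta> ^ c)\<^sup>2) ^ e c = ((\<zeta> ^ c)\<^sup>2 * (1 - xx * \<zeta> ^ (p - c))\<^sup>2) ^ e c"
        using xi_quotient_square[OF mG[OF c], of x] nz1[of c] nz2[of c] by (simp add: g_def xx_def)
    qed
    also have "\<dots> = (\<Prod>c\<in>{1..m}. ((((\<zeta> ^ (c * v)) ^ q)\<^sup>2 * (1 - xx * \<zeta> ^ (p - c))\<^sup>2) ^ e c))"
      by (simp only: zroot)
    also have "\<dots> = Z e ^ q * N e"
      by (simp add: Z_def N_def prod_power_distrib prod.distrib[symmetric] power_mult_distrib
          power_mult[symmetric] mult_ac)
    finally show ?thesis .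
  qed
  define t where "t = s * Z e' / Z e"
  have tK: "t \<in> K" unfolding t_def by (intro K_closed(9,11) sK ZK)
  \<comment> \<open>Clearing denominators puts \<open>e'\<close> on the indices up to
    \<open>m\<close> and \<open>e\<close> on their negatives, as \<open>qth_power_relation\<close>
    expects. The differences \<open>f c - f (p - c)\<close> are then
    \<open>2 * (e' c - e c)\<close>, and 2 is invertible modulo \<open>q\<close>.\<close>
  define f where "f c = (if c \<le> m then 2 * e' c else 2 * e (p - c))" for c
  have split: "(\<Prod>c\<in>G. h c) = (\<Prod>c\<in>{1..m}. h c) * (\<Prod>c\<in>{1..m}. h (p - c))" for h :: "nat \<Rightarrow> complex"
  proof -
    have G: "G = {1..m} \<union> {m + 1..2 * m}" unfolding G_def using pm by auto
    have "(\<Prod>c\<in>G. h c) = (\<Prod>c\<in>{1..m}. h c) * (\<Prod>c\<in>{m + 1..2 * m}. h c)"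
      unfolding G by (intro prod.union_disjoint) auto
    also have "(\<Prod>c\<in>{m + 1..2 * m}. h c) = (\<Prod>c\<in>{1..m}. h (p - c))"
      by (rule prod.reindex_bij_witness[of _ "\<lambda>c. p - c" "\<lambda>c. p - c"]) (auto simp: pm)
    finally show ?thesis .
  qed
  have U: "D e' * N e = (\<Prod>c\<in>G. (1 - of_int x * \<zeta> ^ c) ^ f c)"
  proof -
    have "(\<Prod>c\<in>{1..m}. (1 - of_int x * \<zeta> ^ (p - c)) ^ f (p - c)) = N e"
      unfolding N_def by (intro prod.cong refl) (auto simp: f_def pm xx_def)
    moreover have "(\<Prod>c\<in>{1..m}. (1 - of_int x * \<zeta> ^ c) ^ f c) = D e'"
      unfolding D_def by (intro prod.cong refl) (auto simp: f_def xx_def)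
    ultimately show ?thesis by (simp add: split)
  qed
  have V: "N e' * D e = (\<Prod>c\<in>G. (1 - of_int x * \<zeta> ^ (p - c)) ^ f c)"
  proof -
    have "(\<Prod>c\<in>{1..m}. (1 - of_int x * \<zeta> ^ (p - (p - c))) ^ f (p - c)) = D e"
      unfolding D_def by (intro prod.cong refl) (auto simp: f_def pm xx_def)
    moreover have "(\<Prod>c\<in>{1..m}. (1 - of_int x * \<zeta> ^ (p - c)) ^ f c) = N e'"
      unfolding N_def by (intro prod.cong refl) (auto simp: f_def xx_def)
    ultimately show ?thesis by (simp add: split)
  qed
  have UV: "D e' * N e = N e' * D e * t ^ q"
  proof -
    have "Z e ^ q * (D e' * N e) = D e' * ((gp e)\<^sup>2 * D e)"
      unfolding gD by (simp only: mult_ac)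
    also have "\<dots> = s ^ q * ((gp e')\<^sup>2 * D e') * D e"
      unfolding gsq by (simp only: mult_ac)
    also have "\<dots> = Z e ^ q * (N e' * D e * t ^ q)"
      unfolding gD t_def using ZK(2)[of e] by (simp add: power_divide power_mult_distrib)
    finally show ?thesis using ZK(2)[of e] by simp
  qed
  have "e c = e' c" if c: "c \<in> {1..m}" for c
  proof -
    have "int q dvd int (f c) - int (f (p - c))"
      by (rule qth_power_relation[OF q qx U V tK UV nd mG[OF c]])
    also have "int (f c) - int (f (p - c)) = 2 * (int (e' c) - int (e c))"
      using c by (auto simp: f_def pm)
    finally have "int q dvd 2 * (int (e' c) - int (e c))" .
    moreover have "coprime (int q) 2" using q(2) by simp
    ultimately have "int q dvd int (e' c) - int (e c)" using coprime_dvd_mult_right_iff by blast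
    moreover have "e c < q" "e' c < q" using e(1,2) c by (auto dest: PiE_mem)
    ultimately show ?thesis
      by (metis cong_iff_dvd_diff cong_int_iff cong_less_modulus_unique_nat)
  qed
  hence "e = e'" using e(1,2) by (intro PiE_ext[of e "{1..m}" _ e']) auto
  thus False using e(3) by simp
qed

end

text \<open>Modulo \<open>q\<close> Fermat reduces \<open>x - 1 = p ^ (q - 1) * a ^ q\<close> to
  \<open>a = -1\<close>, and taking \<open>q\<close>-th powers lifts this to
  \<open>a ^ q = -1\<close> modulo \<open>q ^ 2\<close>. The same equation modulo
  \<open>q ^ 2\<close> then gives \<open>p ^ (q - 1) = 1\<close>.\<close>

lemma (in catalan_solution) wieferich_if_square_dvd:
  assumes "int q ^ 2 dvd x"
  shows "int q ^ 2 dvd int p ^ q - int p"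
proof -
  obtain a u where a: "x - 1 = int p ^ (q - 1) * a ^ q"
    using dvd_factors[OF cassels] by metis
  have q0: "q > 0" using q3 by simp
  have "\<not> q dvd p" using p(1) q(1) p_neq_q primes_dvd_imp_eq by blast
  hence "[p ^ (q - 1) = 1] (mod q)" by (rule fermat_theorem[OF q(1)])
  hence "[int (p ^ (q - 1)) = int 1] (mod int q)" by (simp only: cong_int_iff)
  hence pq: "int q dvd int p ^ (q - 1) - 1" by (simp add: cong_iff_dvd_diff)
  have aq: "int q dvd a ^ q - a"
    by (rule int_fermat[OF q(1)])
  have qx: "int q dvd x" using assms by (rule dvd_trans[rotated]) (simp add: power2_eq_square)
  have "int q dvd x - (int p ^ (q - 1) - 1) * a ^ q - (a ^ q - a)"
    by (intro dvd_diff qx aq dvd_mult2 pq)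
  also have "x - (int p ^ (q - 1) - 1) * a ^ q - (a ^ q - a) = a + 1" using a by (simp add: algebra_simps)
  finally have a1: "int q dvd a + 1" .
  define w where "w = - a"
  have w1: "int q dvd w - 1"
  proof -
    have "w - 1 = - (a + 1)" by (simp add: w_def)
    thus ?thesis using a1 by (simp only: dvd_minus_iff)
  qed
  have "int q dvd (\<Sum>i<q. w ^ i)"
  proof -
    have "int q dvd (\<Sum>i<q. w ^ i) - int q" using w1 sum_powers_cong1 dvd_trans by blast
    thus ?thesis by (metis diff_add_cancel dvd_add dvd_refl)
  qed
  hence "int q * int q dvd (w - 1) * (\<Sum>i<q. w ^ i)" using w1 by (intro mult_dvd_mono)
  also have "(w - 1) * (\<Sum>i<q. w ^ i) = w ^ q - 1" by (rule power_diff_1_eq[symmetric])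
  also have "w ^ q = - (a ^ q)" using q(2) by (simp add: w_def)
  finally have "int q ^ 2 dvd - (a ^ q) - 1" by (simp only: power2_eq_square)
  also have "- (a ^ q) - 1 = - (a ^ q + 1)" by simp
  finally have "int q ^ 2 dvd a ^ q + 1" by (simp only: dvd_minus_iff)
  hence "int q ^ 2 dvd x - int p ^ (q - 1) * (a ^ q + 1)"
    by (intro dvd_diff assms dvd_mult)
  also have "x - int p ^ (q - 1) * (a ^ q + 1) = 1 - int p ^ (q - 1)"
    using a by (simp add: algebra_simps)
  finally have "int q ^ 2 dvd - int p * (1 - int p ^ (q - 1))" by (rule dvd_mult)
  also have "- int p * (1 - int p ^ (q - 1)) = int p * int p ^ (q - 1) - int p" by (simp add: algebra_simps)
  also have "int p * int p ^ (q - 1) = int p ^ q" using q0 by (simp add: power_eq_if)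
  finally show ?thesis .
qed

theorem theorem2:
  fixes p q :: nat and \<zeta> :: complex
  assumes "prime p" and "odd p" and "prime q" and "odd q"
    and "primitive_root_of_unity p \<zeta>"
    and "\<exists>x y :: int. x \<noteq> 0 \<and> y \<noteq> 0 \<and> x ^ p - y ^ q = 1"
  shows "(int q)\<^sup>2 dvd int p ^ q - int p \<or>
    real (q_rank q (relative_class_group (rat_adjoin (\<zeta> + inverse \<zeta>)) (rat_adjoin \<zeta>)))
      \<ge> (real p - 5) / 2"
proof (rule disjCI)
  assume small: "\<not> real (q_rank q (relative_class_group (rat_adjoin (\<zeta> + inverse \<zeta>)) (rat_adjoin \<zeta>)))
      \<ge> (real p - 5) / 2"
  obtain x y :: int where xy: "x \<noteq> 0" "y \<noteq> 0" "x ^ p - y ^ q = 1" using assms(6) by blast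
  interpret S: catalan_solution p q x y by unfold_locales (use assms xy in auto)
  interpret C: prime_cyclotomic p \<zeta> by unfold_locales (use assms in auto)
  obtain a u where a: "x - 1 = int p ^ (q - 1) * a ^ q" "(\<Sum>i<p. x ^ i) = int p * u ^ q"
    using S.dvd_factors[OF S.cassels] by metis
  \<comment> \<open>\<open>q \<ge> 3\<close> makes the exponent of \<open>p\<close> at least 2, as
    \<open>xi_cong_1\<close> requires.\<close>
  have "q - 1 = 2 + (q - 3)" using S.q3 by simp
  hence "int p ^ (q - 1) = int p ^ 2 * int p ^ (q - 3)" by (metis power_add)
  hence k: "x - 1 = int p ^ 2 * (int p ^ (q - 3) * a ^ q)" using a(1) by (simp add: mult.assoc)
  have RC: "C.RC = relative_class_group (rat_adjoin (\<zeta> + inverse \<zeta>)) (rat_adjoin \<zeta>)"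
    by (simp add: C.RC_def C.K\<^sub>p_def C.K_def)
  \<comment> \<open>\<open>(p - 5) / 2\<close> lies below \<open>(p - 1) / 2\<close>, the number of
    ideal classes that \<open>small_rank_relation\<close> compares with the rank.\<close>
  have "real (q_rank q C.RC) < real ((p - 1) div 2)"
  proof -
    have "2 * ((p - 1) div 2) = p - 1" using assms(2) by simp
    hence "2 * real ((p - 1) div 2) = real p - 1" using S.p3 by linarith
    thus ?thesis using small by (simp add: RC)
  qed
  hence "q_rank q C.RC < (p - 1) div 2" by (simp only: of_nat_less_iff)
  hence "int q ^ 2 dvd x"
    using C.square_dvd_if_small_rank[OF assms(3,4) S.p_neq_q[symmetric] S.cassels' xy(1) k a(2)] by blast
  thus "(int q)\<^sup>2 dvd int p ^ q - int p" by (rule S.wieferich_if_square_dvd)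
qed

end
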